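(* Let $s\ge 3$, $u_0\in H^s$, $B>0$ and $b>0$, and set $$F(t,x_0)=2Bb\,u_0(x_0)+Bb^{\frac32}\|u_0\|_{L^2}+2B^2b^{\frac32}\|u_0\|_{L^2}\,t .$$ Suppose there exist $x_0\in\mathbf R$ and $T>0$ such that $F(T,x_0)\ge 0$ and $$u_0'(x_0)\le -\alpha\left(\frac{F(T,x_0)^{\frac14}+\sqrt{F(T,x_0)^{\frac12}+\frac{1+\frac1\alpha}{1-\frac1{2\alpha}}\,\frac4T}}{2}\right)^2$$ for some $\alpha\ge 1$. Then the solution of $$\partial_t u+u\,\partial_x u+\int_{\mathbf R}B e^{-b|x-\xi|}u_\xi(t,\xi)\,d\xi=0,\qquad u(0,x)=u_0(x),$$ blows up in finite time. Moreover, the blow-up time $T_0$ satisfies $$T_0\le -\frac{1+\frac1\alpha}{1-\frac1{2\alpha}}\,\frac{1}{u_0'(x_0)+\sqrt{-u_0'(x_0)}\,F(T,x_0)^{\frac14}}\le T.$$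
   Context: The equation is posed for real-valued $u(t,x)$, $t>0$, $x\in\mathbf R$. $H^s=H^s(\mathbf R)$ is the Sobolev space with norm $\|f\|_{H^s}=\|(1+|\xi|^2)^{s/2}\widehat f\,\|_{L^2}$. For $u_0\in H^s$, $s>3/2$, the solution is the unique $u\in C([0,T_0);H^s)\cap C^1([0,T_0);H^{s-1})$ defined up to its maximal existence time $T_0\in(0,\infty]$. It blows up in finite time if $T_0<\infty$, and $T_0$ is then called the blow-up time. *)

theory Defs
  imports "HOL-Analysis.Analysis"
begin

definition square_integrable :: "(real \<Rightarrow> 'a::{banach, second_countable_topology}) \<Rightarrow> bool" where
  "square_integrable f \<longleftrightarrow>
     f \<in> borel_measurable lborel \<and> integrable lborel (\<lambda>x. (norm (f x))\<^sup>2)"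

definition L2norm :: "(real \<Rightarrow> 'a::{banach, second_countable_topology}) \<Rightarrow> real" where
  "L2norm f = sqrt (LINT x|lborel. (norm (f x))\<^sup>2)"

definition truncated_fourier :: "real \<Rightarrow> (real \<Rightarrow> real) \<Rightarrow> real \<Rightarrow> complex" where
  "truncated_fourier R f \<xi> =
     (LINT x:{-R..R}|lborel. cis (- (x * \<xi>)) * complex_of_real (f x)) / complex_of_real (sqrt (2 * pi))"

(* The Fourier-Plancherel transform on L2, in the unitary normalization: the L2 limit of the
   Fourier integrals over [-R,R].  It is determined by f only up to null sets, hence a relation.
   The L2 distance is a nonnegative extended integral, so that no junk value can arise. *)
definition has_fourier_transform :: "(real \<Rightarrow> real) \<Rightarrow> (real \<Rightarrow> complex) \<Rightarrow> bool" where
  "has_fourier_transform f g \<longleftrightarrow>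
     square_integrable f \<and> square_integrable g \<and>
     ((\<lambda>R. \<integral>\<^sup>+ \<xi>. ennreal ((norm (truncated_fourier R f \<xi> - g \<xi>))\<^sup>2) \<partial>lborel) \<longlongrightarrow> 0) at_top"

definition fourier :: "(real \<Rightarrow> real) \<Rightarrow> real \<Rightarrow> complex" where
  "fourier f = (SOME g. has_fourier_transform f g)"

definition sobolev_weight :: "real \<Rightarrow> (real \<Rightarrow> complex) \<Rightarrow> real \<Rightarrow> complex" where
  "sobolev_weight s g \<xi> = complex_of_real ((1 + \<xi>\<^sup>2) powr (s / 2)) * g \<xi>"

(* Representatives of the elements of H^s(R) for s >= 0 (for s < 0 the requirement that f be
   square integrable would be too strong). *)
definition sobolev :: "real \<Rightarrow> (real \<Rightarrow> real) set" where
  "sobolev s = {f. \<exists>g. has_fourier_transform f g \<and> square_integrable (sobolev_weight s g)}"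

(* Independent of the choice made in fourier; meaningful on sobolev s. *)
definition sobolev_norm :: "real \<Rightarrow> (real \<Rightarrow> real) \<Rightarrow> real" where
  "sobolev_norm s f = L2norm (sobolev_weight s (fourier f))"

definition sobolev_continuous_on :: "real set \<Rightarrow> real \<Rightarrow> (real \<Rightarrow> real \<Rightarrow> real) \<Rightarrow> bool" where
  "sobolev_continuous_on I s u \<longleftrightarrow>
     (\<forall>t\<in>I. u t \<in> sobolev s) \<and>
     (\<forall>t\<in>I. ((\<lambda>r. sobolev_norm s (\<lambda>x. u r x - u t x)) \<longlongrightarrow> 0) (at t within I))"

(* v is the time derivative of u in H^s, one-sided at end points of I. *)
definition sobolev_derivative_on ::
  "real set \<Rightarrow> real \<Rightarrow> (real \<Rightarrow> real \<Rightarrow> real) \<Rightarrow> (real \<Rightarrow> real \<Rightarrow> real) \<Rightarrow> bool" where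
  "sobolev_derivative_on I s u v \<longleftrightarrow>
     (\<forall>t\<in>I. u t \<in> sobolev s \<and> v t \<in> sobolev s) \<and>
     (\<forall>t\<in>I. ((\<lambda>r. sobolev_norm s (\<lambda>x. (u r x - u t x) / (r - t) - v t x)) \<longlongrightarrow> 0) (at t within I))"

definition time_interval :: "ereal \<Rightarrow> real set" where
  "time_interval T0 = {t. 0 \<le> t \<and> ereal t < T0}"

(* u is in C([0,T0);H^s) and in C^1([0,T0);H^(s-1)), and solves the Cauchy problem.  Intended for
   s > 3/2: each u t is the continuous representative of its class, which is then C^1, so that
   deriv is the classical space derivative.  The time derivative v is an H^(s-1) class, so the
   equation is imposed almost everywhere in x. *)
definition is_solution ::
  "real \<Rightarrow> real \<Rightarrow> real \<Rightarrow> (real \<Rightarrow> real) \<Rightarrow> ereal \<Rightarrow> (real \<Rightarrow> real \<Rightarrow> real) \<Rightarrow> bool" where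
  "is_solution B b s u0 T0 u \<longleftrightarrow>
     0 < T0 \<and>
     (\<forall>t\<in>time_interval T0. continuous_on UNIV (u t)) \<and>
     sobolev_continuous_on (time_interval T0) s u \<and>
     u 0 = u0 \<and>
     (\<exists>v. sobolev_derivative_on (time_interval T0) (s - 1) u v \<and>
          sobolev_continuous_on (time_interval T0) (s - 1) v \<and>
          (\<forall>t\<in>time_interval T0. 0 < t \<longrightarrow>
             (AE x in lborel.
                v t x + u t x * deriv (u t) x
                  + (LINT \<xi>|lborel. B * exp (- b * \<bar>x - \<xi>\<bar>) * deriv (u t) \<xi>) = 0)))"

(* The solution is not the restriction of a solution with a longer life span, i.e. T0 is its
   maximal existence time. *)
definition is_maximal_solution ::
  "real \<Rightarrow> real \<Rightarrow> real \<Rightarrow> (real \<Rightarrow> real) \<Rightarrow> ereal \<Rightarrow> (real \<Rightarrow> real \<Rightarrow> real) \<Rightarrow> bool" where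
  "is_maximal_solution B b s u0 T0 u \<longleftrightarrow>
     is_solution B b s u0 T0 u \<and>
     \<not> (\<exists>T1 v. T0 < T1 \<and> is_solution B b s u0 T1 v \<and> (\<forall>t\<in>time_interval T0. v t = u t))"

definition blows_up_in_finite_time :: "ereal \<Rightarrow> bool" where
  "blows_up_in_finite_time T0 \<longleftrightarrow> T0 < \<infinity>"

definition F_bound :: "real \<Rightarrow> real \<Rightarrow> (real \<Rightarrow> real) \<Rightarrow> real \<Rightarrow> real \<Rightarrow> real" where
  "F_bound B b u0 t x0 =
     2 * B * b * u0 x0 + B * b powr (3/2) * L2norm u0 + 2 * B\<^sup>2 * b powr (3/2) * L2norm u0 * t"

end

(* Along a characteristic X' = u(t,X), X(0) = x0, the slope m(t) = u_x(t,X(t)) satisfies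
   m' = -m^2 + 2 B b u - b^2 K*u with K = B exp(-b|x|), because
   K'' = b^2 K - 2 B b delta.  The L2 norm of u is conserved and the L2 norms of exp(-b|x|) are explicit, so
   Cauchy-Schwarz bounds K*u and the growth of u along X; this gives m' <= -m^2 + F(t,x0).  With
   F = F(T,x0), the quantity w = -m - sqrt F then satisfies w' >= w^2, hence the solution cannot
   exist past the time 1/w(0), which lies before the claimed bound.

   The definitions only control u through Fourier transforms given as L2 limits, so the classical
   derivatives have to be recovered first.  Levy's inversion theorem, applied to the positive and
   negative parts of f restricted to [-R,R], yields that f and the absolutely convergent inverse
   transform of its Fourier transform have the same integral over every interval.  Of Plancherel's
   theorem only one inequality is needed; it follows by inserting a Gaussian weight. *)
theory Submission
  imports Defs "HOL-Probability.Levy"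
begin

text \<open>The hypothesis s >= 3 enters through a count of derivatives. Integrability of the k-th
  moment of a Fourier transform is bought here with k + 1 powers of the Sobolev weight, so H^s gives
  two classical space derivatives of u, and H^(s-1) gives one of the time derivative of u. The slope
  m is u_x at a moving point; to differentiate it in time, the difference quotients of u_x must
  converge uniformly in x, and convergence in H^(s-1) supplies exactly that.

  The lifespan estimate is a contradiction: a solution living longer than the claimed bound is
  restricted to the compact time interval up to that bound, where all constants are uniform.

  The constants fit as follows. Put G = F^(1/4), p = sqrt(-u0'(x0)), and let c be the fraction in
  alpha. The hypothesis places p above the positive root of z^2 - G z = c/T. Hence the claimed bound
  c/(p^2 - p G) is at most T, and since G <= p and c >= 1 it is at least the Riccati time 1/(p^2 -
  G^2).\<close>

section \<open>Square-integrable functions and the Fourier-Plancherel relation\<close>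

lemma square_integrable_measurable [measurable_dest]:
  "square_integrable f \<Longrightarrow> f \<in> borel_measurable borel"
  by (simp add: square_integrable_def)

lemma square_integrable_iff_nn:
  "square_integrable f \<longleftrightarrow>
     f \<in> borel_measurable borel \<and> (\<integral>\<^sup>+x. ennreal ((norm (f x))\<^sup>2) \<partial>lborel) < \<infinity>"
  by (auto simp: square_integrable_def integrable_iff_bounded)

lemma nn_integral_L2norm:
  assumes "square_integrable f"
  shows "(\<integral>\<^sup>+x. ennreal ((norm (f x))\<^sup>2) \<partial>lborel) = ennreal ((L2norm f)\<^sup>2)"
  using assms by (subst nn_integral_eq_integral) (auto simp: L2norm_def square_integrable_def)

lemma L2norm_nonneg [simp]: "0 \<le> L2norm f"
  by (simp add: L2norm_def)

lemma L2norm_power2: "(L2norm f)\<^sup>2 = (LINT x|lborel. (norm (f x))\<^sup>2)"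
  by (simp add: L2norm_def)

lemma square_integrable_bound:
  fixes f :: "real \<Rightarrow> 'a::{banach, second_countable_topology}"
    and g :: "real \<Rightarrow> 'b::{banach, second_countable_topology}"
  assumes g: "square_integrable g" and [measurable]: "f \<in> borel_measurable borel"
    and "AE x in lborel. norm (f x) \<le> norm (g x)"
  shows "square_integrable f" "L2norm f \<le> L2norm g"
proof -
  have le: "AE x in lborel. (norm (f x))\<^sup>2 \<le> (norm (g x))\<^sup>2"
    using assms(3) by eventually_elim (simp add: power_mono)
  have "integrable lborel (\<lambda>x. (norm (f x))\<^sup>2)"
    using g le unfolding square_integrable_def
    by (auto intro!: Bochner_Integration.integrable_bound[where f = "\<lambda>x. (norm (g x))\<^sup>2"])
  then show f: "square_integrable f"
    by (simp add: square_integrable_def)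
  show "L2norm f \<le> L2norm g"
    unfolding L2norm_def using f g le
    by (intro real_sqrt_le_mono integral_mono_AE) (auto simp: square_integrable_def)
qed

lemma square_integrable_add:
  fixes f g :: "real \<Rightarrow> 'a::{banach, second_countable_topology}"
  assumes f: "square_integrable f" and g: "square_integrable g"
  shows "square_integrable (\<lambda>x. f x + g x)"
proof -
  note [measurable] = square_integrable_measurable[OF f] square_integrable_measurable[OF g]
  have "(norm (f x + g x))\<^sup>2 \<le> 2 * (norm (f x))\<^sup>2 + 2 * (norm (g x))\<^sup>2" for x
  proof -
    have "(norm (f x + g x))\<^sup>2 \<le> (norm (f x) + norm (g x))\<^sup>2"
      by (simp add: norm_triangle_ineq power_mono)
    also have "\<dots> \<le> 2 * (norm (f x))\<^sup>2 + 2 * (norm (g x))\<^sup>2"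
      using sum_squares_bound[of "norm (f x)" "norm (g x)"] by (simp add: power2_sum)
    finally show ?thesis .
  qed
  note le = this
  have "integrable lborel (\<lambda>x. 2 * (norm (f x))\<^sup>2 + 2 * (norm (g x))\<^sup>2)"
    using f g by (simp add: square_integrable_def)
  then have "integrable lborel (\<lambda>x. (norm (f x + g x))\<^sup>2)"
    by (rule Bochner_Integration.integrable_bound) (auto simp: le)
  then show ?thesis
    by (simp add: square_integrable_def)
qed

lemma square_integrable_scaleR:
  fixes f :: "real \<Rightarrow> 'a::{banach, second_countable_topology}"
  assumes f: "square_integrable f"
  shows "square_integrable (\<lambda>x. c *\<^sub>R f x)" "L2norm (\<lambda>x. c *\<^sub>R f x) = \<bar>c\<bar> * L2norm f"
  using assms
  by (auto simp: square_integrable_def L2norm_def power_mult_distrib real_sqrt_mult)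

lemma square_integrable_mult:
  fixes f :: "real \<Rightarrow> 'a::{banach, second_countable_topology}"
    and g :: "real \<Rightarrow> 'b::{banach, second_countable_topology}"
  assumes f: "square_integrable f" and g: "square_integrable g"
  shows "integrable lborel (\<lambda>x. norm (f x) * norm (g x))"
    and "(LINT x|lborel. norm (f x) * norm (g x)) \<le> L2norm f * L2norm g"
proof -
  note [measurable] = square_integrable_measurable[OF f] square_integrable_measurable[OF g]
  let ?I = "\<integral>\<^sup>+x. ennreal (norm (f x) * norm (g x)) \<partial>lborel"
  have "?I\<^sup>2 \<le> ennreal ((L2norm f * L2norm g)\<^sup>2)"
    using Cauchy_Schwarz_nn_integral[of "\<lambda>x. ennreal (norm (f x))" lborel "\<lambda>x. ennreal (norm (g x))"]
    by (simp add: ennreal_mult ennreal_power nn_integral_L2norm[OF f] nn_integral_L2norm[OF g]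
        power_mult_distrib)
  note sq = this
  \<comment> \<open>Finiteness of the square turns the extended integral into a real number, where
    the square root of the inequality can be taken.\<close>
  then have "?I\<^sup>2 < top"
    by (rule le_less_trans) simp
  then obtain i where i: "?I = ennreal i" "0 \<le> i"
    by (cases ?I) auto
  with sq have "i\<^sup>2 \<le> (L2norm f * L2norm g)\<^sup>2"
    by (simp add: ennreal_power)
  then have "i \<le> L2norm f * L2norm g"
    by (rule power2_le_imp_le) simp
  with i have le: "?I \<le> ennreal (L2norm f * L2norm g)"
    by (simp add: ennreal_leI)
  then have "?I < \<infinity>"
    by (rule le_less_trans) simp
  then show int: "integrable lborel (\<lambda>x. norm (f x) * norm (g x))"
    by (auto simp: integrable_iff_bounded)
  show "(LINT x|lborel. norm (f x) * norm (g x)) \<le> L2norm f * L2norm g"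
    using le by (subst (asm) nn_integral_eq_integral[OF int]) auto
qed

lemma L2norm_mult_bound:
  fixes f g :: "real \<Rightarrow> 'a::{banach, real_normed_field, second_countable_topology}"
  assumes f: "square_integrable f" and g: "square_integrable g"
  shows "integrable lborel (\<lambda>x. f x * g x)"
    and "norm (LINT x|lborel. f x * g x) \<le> L2norm f * L2norm g"
proof -
  note [measurable] = square_integrable_measurable[OF f] square_integrable_measurable[OF g]
  show "integrable lborel (\<lambda>x. f x * g x)"
    by (rule Bochner_Integration.integrable_bound[OF square_integrable_mult(1)[OF f g]])
      (auto simp: norm_mult)
  then show "norm (LINT x|lborel. f x * g x) \<le> L2norm f * L2norm g"
    using square_integrable_mult(2)[OF f g]
    by (intro order_trans[OF integral_norm_bound]) (simp add: norm_mult)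
qed

section \<open>Truncated Fourier transforms, linearity and uniqueness of their L2 limits\<close>

lemma truncated_fourier_measurable [measurable]:
  assumes [measurable]: "f \<in> borel_measurable borel"
  shows "truncated_fourier R f \<in> borel_measurable borel"
proof -
  have "(\<lambda>(\<xi>, x). indicator {-R..R} x *\<^sub>R (cis (- (x * \<xi>)) * complex_of_real (f x)))
      \<in> borel_measurable (borel \<Otimes>\<^sub>M lborel)"
    unfolding cis_conv_exp by measurable
  then show ?thesis
    unfolding truncated_fourier_def set_lebesgue_integral_def
    by (intro borel_measurable_divide lborel.borel_measurable_lebesgue_integral) auto
qed

text \<open>Cauchy-Schwarz against the indicator. It guarantees that the truncated transforms are
  genuine integrals and not the default value 0, which their linearity depends on.\<close>

lemma square_integrable_truncate:
  fixes f :: "real \<Rightarrow> real"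
  assumes f: "square_integrable f"
  shows "integrable lborel (\<lambda>x. indicator {-R..R} x * f x)"
proof -
  have "square_integrable (indicator {-R..R} :: real \<Rightarrow> real)"
    by (auto simp: square_integrable_def power2_eq_square emeasure_lborel_Icc_eq
        intro!: integrable_real_indicator simp flip: indicator_inter_arith)
  from L2norm_mult_bound(1)[OF this f] show ?thesis .
qed

lemma truncated_fourier_lincomb:
  assumes f: "square_integrable f" and h: "square_integrable h"
  shows "truncated_fourier R (\<lambda>x. a * f x + c * h x) \<xi> =
    complex_of_real a * truncated_fourier R f \<xi> + complex_of_real c * truncated_fourier R h \<xi>"
proof -
  have int: "integrable lborel (\<lambda>x. indicator {-R..R} x *\<^sub>R (cis (- (x * \<xi>)) * complex_of_real (k x)))"
    if "square_integrable k" for k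
  proof (rule Bochner_Integration.integrable_bound[OF square_integrable_truncate[OF that, of R]])
    note [measurable] = square_integrable_measurable[OF that]
    show "(\<lambda>x. indicator {-R..R} x *\<^sub>R (cis (- (x * \<xi>)) * complex_of_real (k x))) \<in> borel_measurable lborel"
      unfolding cis_conv_exp by measurable
  qed (auto simp: norm_mult)
  have "(LINT x|lborel. indicator {-R..R} x *\<^sub>R (cis (- (x * \<xi>)) * complex_of_real (a * f x + c * h x)))
    = (LINT x|lborel. complex_of_real a * (indicator {-R..R} x *\<^sub>R (cis (- (x * \<xi>)) * complex_of_real (f x)))
      + complex_of_real c * (indicator {-R..R} x *\<^sub>R (cis (- (x * \<xi>)) * complex_of_real (h x))))"
    by (intro Bochner_Integration.integral_cong) (simp_all add: scaleR_conv_of_real algebra_simps)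
  also have "\<dots> = complex_of_real a * (LINT x|lborel. indicator {-R..R} x *\<^sub>R (cis (- (x * \<xi>)) * complex_of_real (f x)))
      + complex_of_real c * (LINT x|lborel. indicator {-R..R} x *\<^sub>R (cis (- (x * \<xi>)) * complex_of_real (h x)))"
    by (subst Bochner_Integration.integral_add) (intro integrable_mult_right int f h, intro integrable_mult_right int f h, simp only: integral_mult_right_zero)
  finally show ?thesis
    unfolding truncated_fourier_def set_lebesgue_integral_def by (simp only: add_divide_distrib times_divide_eq_right)
qed

text \<open>From (a + b)^2 <= 2 a^2 + 2 b^2. The crude factor 2 replaces Minkowski's inequality,
  which is good enough for distances that tend to 0; extended integrals allow these distances to be
  infinite.\<close>

lemma nn_integral_lincomb_square_le:
  fixes f g :: "real \<Rightarrow> complex"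
  assumes [measurable]: "f \<in> borel_measurable borel" "g \<in> borel_measurable borel"
  shows "(\<integral>\<^sup>+x. ennreal ((norm (complex_of_real a * f x + complex_of_real c * g x))\<^sup>2) \<partial>lborel)
    \<le> ennreal (2 * a\<^sup>2) * (\<integral>\<^sup>+x. ennreal ((norm (f x))\<^sup>2) \<partial>lborel)
      + ennreal (2 * c\<^sup>2) * (\<integral>\<^sup>+x. ennreal ((norm (g x))\<^sup>2) \<partial>lborel)"
proof -
  have le: "(norm (complex_of_real a * f x + complex_of_real c * g x))\<^sup>2
      \<le> 2 * a\<^sup>2 * (norm (f x))\<^sup>2 + 2 * c\<^sup>2 * (norm (g x))\<^sup>2" for x
  proof -
    have "norm (complex_of_real a * f x + complex_of_real c * g x)
        \<le> \<bar>a\<bar> * norm (f x) + \<bar>c\<bar> * norm (g x)"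
      by (intro norm_triangle_le) (simp add: norm_mult)
    then have "(norm (complex_of_real a * f x + complex_of_real c * g x))\<^sup>2
        \<le> (\<bar>a\<bar> * norm (f x) + \<bar>c\<bar> * norm (g x))\<^sup>2"
      by (simp add: power_mono)
    also have "\<dots> \<le> 2 * (\<bar>a\<bar> * norm (f x))\<^sup>2 + 2 * (\<bar>c\<bar> * norm (g x))\<^sup>2"
      using sum_squares_bound[of "\<bar>a\<bar> * norm (f x)" "\<bar>c\<bar> * norm (g x)"] by (simp add: power2_sum)
    finally show ?thesis by (simp add: power_mult_distrib)
  qed
  have "(\<integral>\<^sup>+x. ennreal ((norm (complex_of_real a * f x + complex_of_real c * g x))\<^sup>2) \<partial>lborel)
    \<le> (\<integral>\<^sup>+x. ennreal (2 * a\<^sup>2) * ennreal ((norm (f x))\<^sup>2) + ennreal (2 * c\<^sup>2) * ennreal ((norm (g x))\<^sup>2) \<partial>lborel)"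
    using le by (intro nn_integral_mono) (simp flip: ennreal_mult ennreal_plus)
  also have "\<dots> = ennreal (2 * a\<^sup>2) * (\<integral>\<^sup>+x. ennreal ((norm (f x))\<^sup>2) \<partial>lborel)
      + ennreal (2 * c\<^sup>2) * (\<integral>\<^sup>+x. ennreal ((norm (g x))\<^sup>2) \<partial>lborel)"
    by (subst nn_integral_add) (auto simp: nn_integral_cmult)
  finally show ?thesis .
qed

lemma lincomb_tendsto_zero:
  fixes f g :: "'b \<Rightarrow> ennreal"
  assumes "(f \<longlongrightarrow> 0) F" "(g \<longlongrightarrow> 0) F"
  shows "((\<lambda>x. ennreal a * f x + ennreal c * g x) \<longlongrightarrow> 0) F"
proof -
  have "((\<lambda>x. ennreal a * f x + ennreal c * g x) \<longlongrightarrow> ennreal a * 0 + ennreal c * 0) F"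
    using assms by (intro tendsto_add ennreal_tendsto_cmult) auto
  then show ?thesis by simp
qed

lemma has_fourier_transform_measurable:
  assumes "has_fourier_transform f g"
  shows "f \<in> borel_measurable borel" "g \<in> borel_measurable borel"
    "square_integrable f" "square_integrable g"
  using assms by (auto simp: has_fourier_transform_def intro: square_integrable_measurable)

lemma has_fourier_transform_lincomb:
  assumes f: "has_fourier_transform f g" and h: "has_fourier_transform h k"
  shows "has_fourier_transform (\<lambda>x. a * f x + c * h x)
    (\<lambda>x. complex_of_real a * g x + complex_of_real c * k x)"
proof -
  note [measurable] = has_fourier_transform_measurable(1,2)[OF f] has_fourier_transform_measurable(1,2)[OF h]
  note sq = has_fourier_transform_measurable(3,4)[OF f] has_fourier_transform_measurable(3,4)[OF h]
  have 1: "square_integrable (\<lambda>x. a * f x + c * h x)"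
    using square_integrable_add[OF square_integrable_scaleR(1)[OF sq(1), of a] square_integrable_scaleR(1)[OF sq(3), of c]]
    by simp
  have 2: "square_integrable (\<lambda>x. complex_of_real a * g x + complex_of_real c * k x)"
    using square_integrable_add[OF square_integrable_scaleR(1)[OF sq(2), of a] square_integrable_scaleR(1)[OF sq(4), of c]]
    by (simp add: scaleR_conv_of_real)
  have "((\<lambda>R. \<integral>\<^sup>+ \<xi>. ennreal ((norm (truncated_fourier R (\<lambda>x. a * f x + c * h x) \<xi>
      - (complex_of_real a * g \<xi> + complex_of_real c * k \<xi>)))\<^sup>2) \<partial>lborel) \<longlongrightarrow> 0) at_top"
  proof (rule tendsto_sandwich[OF _ _ tendsto_const])
    show "((\<lambda>R. ennreal (2 * a\<^sup>2) * (\<integral>\<^sup>+ \<xi>. ennreal ((norm (truncated_fourier R f \<xi> - g \<xi>))\<^sup>2) \<partial>lborel)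
      + ennreal (2 * c\<^sup>2) * (\<integral>\<^sup>+ \<xi>. ennreal ((norm (truncated_fourier R h \<xi> - k \<xi>))\<^sup>2) \<partial>lborel)) \<longlongrightarrow> 0) at_top"
      using f h by (intro lincomb_tendsto_zero) (auto simp: has_fourier_transform_def)
    show "\<forall>\<^sub>F R in at_top. (\<integral>\<^sup>+ \<xi>. ennreal ((norm (truncated_fourier R (\<lambda>x. a * f x + c * h x) \<xi>
      - (complex_of_real a * g \<xi> + complex_of_real c * k \<xi>)))\<^sup>2) \<partial>lborel) \<le>
      ennreal (2 * a\<^sup>2) * (\<integral>\<^sup>+ \<xi>. ennreal ((norm (truncated_fourier R f \<xi> - g \<xi>))\<^sup>2) \<partial>lborel)
      + ennreal (2 * c\<^sup>2) * (\<integral>\<^sup>+ \<xi>. ennreal ((norm (truncated_fourier R h \<xi> - k \<xi>))\<^sup>2) \<partial>lborel)"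
    proof (intro always_eventually allI, goal_cases)
      case (1 R)
      have "(truncated_fourier R (\<lambda>x. a * f x + c * h x) \<xi> - (complex_of_real a * g \<xi> + complex_of_real c * k \<xi>))
        = complex_of_real a * (truncated_fourier R f \<xi> - g \<xi>) + complex_of_real c * (truncated_fourier R h \<xi> - k \<xi>)" for \<xi>
        by (simp add: truncated_fourier_lincomb[OF sq(1,3)] algebra_simps)
      then show ?case
        using nn_integral_lincomb_square_le[of "\<lambda>\<xi>. truncated_fourier R f \<xi> - g \<xi>" "\<lambda>\<xi>. truncated_fourier R h \<xi> - k \<xi>" a c]
        by simp
    qed
  qed auto
  with 1 2 show ?thesis by (simp add: has_fourier_transform_def)
qed

text \<open>Both functions are L2 limits of the same truncated transforms. Their mutual distance
  does not depend on R but is dominated by a quantity tending to 0 as R grows.\<close>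

lemma has_fourier_transform_unique:
  assumes g: "has_fourier_transform f g" and h: "has_fourier_transform f h"
  shows "AE x in lborel. g x = h x"
proof -
  note [measurable] = has_fourier_transform_measurable(1,2)[OF g] has_fourier_transform_measurable(1,2)[OF h]
  let ?I = "\<integral>\<^sup>+ \<xi>. ennreal ((norm (h \<xi> - g \<xi>))\<^sup>2) \<partial>lborel"
  have "((\<lambda>R. ?I) \<longlongrightarrow> 0) (at_top :: real filter)"
  proof (rule tendsto_sandwich[OF _ _ tendsto_const])
    show "((\<lambda>R. ennreal (2 * 1\<^sup>2) * (\<integral>\<^sup>+ \<xi>. ennreal ((norm (truncated_fourier R f \<xi> - g \<xi>))\<^sup>2) \<partial>lborel)
      + ennreal (2 * (-1)\<^sup>2) * (\<integral>\<^sup>+ \<xi>. ennreal ((norm (truncated_fourier R f \<xi> - h \<xi>))\<^sup>2) \<partial>lborel)) \<longlongrightarrow> 0) at_top"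
      using g h by (intro lincomb_tendsto_zero) (auto simp: has_fourier_transform_def)
    show "\<forall>\<^sub>F R in at_top. ?I \<le>
      ennreal (2 * 1\<^sup>2) * (\<integral>\<^sup>+ \<xi>. ennreal ((norm (truncated_fourier R f \<xi> - g \<xi>))\<^sup>2) \<partial>lborel)
      + ennreal (2 * (-1)\<^sup>2) * (\<integral>\<^sup>+ \<xi>. ennreal ((norm (truncated_fourier R f \<xi> - h \<xi>))\<^sup>2) \<partial>lborel)"
    proof (intro always_eventually allI, goal_cases)
      case (1 R)
      show ?case
        using nn_integral_lincomb_square_le[of "\<lambda>\<xi>. truncated_fourier R f \<xi> - g \<xi>" "\<lambda>\<xi>. truncated_fourier R f \<xi> - h \<xi>" 1 "-1"]
        by simp
    qed
  qed auto
  then have "?I = 0"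
    by (simp add: tendsto_const_iff)
  then have "AE x in lborel. ennreal ((norm (h x - g x))\<^sup>2) = 0"
    by (subst (asm) nn_integral_0_iff_AE) auto
  then show ?thesis
    by eventually_elim (simp add: ennreal_eq_0_iff)
qed

lemma sobolev_weight_measurable [measurable]:
  "g \<in> borel_measurable borel \<Longrightarrow> sobolev_weight s g \<in> borel_measurable borel"
  unfolding sobolev_weight_def[abs_def] by measurable

text \<open>Two transforms of \<open>f\<close> agree almost everywhere, so the choice made by
  \<open>SOME\<close> in \<open>fourier\<close> does not affect the norm.\<close>

lemma sobolev_norm_eq:
  assumes "has_fourier_transform f g"
  shows "sobolev_norm s f = L2norm (sobolev_weight s g)"
proof -
  have f: "has_fourier_transform f (fourier f)"
    unfolding fourier_def by (rule someI[of "has_fourier_transform f", OF assms])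
  note [measurable] = has_fourier_transform_measurable(1,2)[OF assms] has_fourier_transform_measurable(1,2)[OF f]
  have "AE x in lborel. g x = fourier f x"
    by (rule has_fourier_transform_unique[OF assms f])
  then show ?thesis
    unfolding sobolev_norm_def L2norm_def sobolev_weight_def
    by (intro arg_cong[where f = sqrt] integral_cong_AE) auto
qed

lemma sobolev_lincomb:
  assumes "f \<in> sobolev s" "h \<in> sobolev s"
  shows "(\<lambda>x. a * f x + c * h x) \<in> sobolev s"
proof -
  from assms obtain g k where g: "has_fourier_transform f g" "square_integrable (sobolev_weight s g)"
    and k: "has_fourier_transform h k" "square_integrable (sobolev_weight s k)"
    by (auto simp: sobolev_def)
  have "square_integrable (sobolev_weight s (\<lambda>x. complex_of_real a * g x + complex_of_real c * k x))"
    using square_integrable_add[OF square_integrable_scaleR(1)[OF g(2), of a] square_integrable_scaleR(1)[OF k(2), of c]]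
    by (simp add: sobolev_weight_def[abs_def] scaleR_conv_of_real algebra_simps)
  then show ?thesis
    using has_fourier_transform_lincomb[OF g(1) k(1)] by (auto simp: sobolev_def)
qed

section \<open>Fourier inversion tested on intervals\<close>

text \<open>Sign and normalization are those of a characteristic function, so that Levy's theorem
  applies directly; factors sqrt(2 pi) and reflections appear wherever the unitary transform comes
  in.\<close>

definition fourier_integral :: "(real \<Rightarrow> complex) \<Rightarrow> real \<Rightarrow> complex" where
  "fourier_integral g x = (LINT \<xi>|lborel. iexp (x * \<xi>) * g \<xi>)"

(* The integral of exp(-itx) over [a,b], except at t = 0, where division by zero gives 0. *)
definition box_kernel :: "real \<Rightarrow> real \<Rightarrow> real \<Rightarrow> complex" where
  "box_kernel a b t = (iexp (- (t * a)) - iexp (- (t * b))) / (\<i> * t)"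

lemma integrable_iexp_mult:
  assumes g: "integrable lborel g"
  shows "integrable lborel (\<lambda>\<xi>. iexp (x * \<xi>) * g \<xi> :: complex)"
  by (rule Bochner_Integration.integrable_bound[OF g]) (use g in \<open>auto simp: norm_mult\<close>)

lemma norm_fourier_integral_le: "norm (fourier_integral g x) \<le> (LINT \<xi>|lborel. norm (g \<xi>))"
  unfolding fourier_integral_def
  by (rule order_trans[OF integral_norm_bound]) (simp add: norm_mult)

lemma fourier_integral_measurable [measurable]:
  assumes [measurable]: "g \<in> borel_measurable borel"
  shows "fourier_integral g \<in> borel_measurable borel"
proof -
  have "(\<lambda>(x, \<xi>). iexp (x * \<xi>) * g \<xi>) \<in> borel_measurable (borel \<Otimes>\<^sub>M lborel)"
    by measurable
  then show ?thesis
    unfolding fourier_integral_def[abs_def]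
    by (intro lborel.borel_measurable_lebesgue_integral) auto
qed

lemma box_kernel_measurable [measurable]: "box_kernel a b \<in> borel_measurable borel"
  unfolding box_kernel_def[abs_def] by measurable

text \<open>The first bound is used near t = 0 and the second for large t; together they give decay
  like 1/(1 + t^2) of the square.\<close>

lemma norm_box_kernel_le:
  assumes "a \<le> b"
  shows "norm (box_kernel a b t) \<le> b - a" "\<bar>t\<bar> * norm (box_kernel a b t) \<le> 2"
proof -
  show "norm (box_kernel a b t) \<le> b - a"
    using Levy_Inversion_aux2[of "-b" "-a" t] assms
    by (cases "t = 0") (auto simp: box_kernel_def)
  have "norm (iexp (- (t * a)) - iexp (- (t * b))) \<le> 2"
    using norm_triangle_ineq4[of "iexp (- (t * a))" "iexp (- (t * b))"] by (simp del: of_real_mult of_real_minus)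
  then show "\<bar>t\<bar> * norm (box_kernel a b t) \<le> 2"
    by (auto simp: box_kernel_def norm_divide norm_mult)
qed

lemma has_bochner_integral_inverse_square:
  "has_bochner_integral lborel (\<lambda>x::real. inverse (1 + x\<^sup>2)) pi"
  using integrable_inverse_1_plus_square LBINT_inverse_1_plus_square
  by (simp add: has_bochner_integral_iff set_integrable_def interval_lebesgue_integral_def
      set_lebesgue_integral_def)

lemma square_integrable_box_kernel:
  assumes "a \<le> b"
  shows "square_integrable (box_kernel a b)"
proof -
  have le: "(norm (box_kernel a b t))\<^sup>2 \<le> ((b - a)\<^sup>2 + 4) * inverse (1 + t\<^sup>2)" for t
  proof -
    have "(norm (box_kernel a b t))\<^sup>2 \<le> (b - a)\<^sup>2"
      using norm_box_kernel_le(1)[OF assms] by (intro power_mono) auto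
    moreover have "(\<bar>t\<bar> * norm (box_kernel a b t))\<^sup>2 \<le> 2\<^sup>2"
      using norm_box_kernel_le(2)[OF assms] by (intro power_mono) auto
    ultimately have "(norm (box_kernel a b t))\<^sup>2 * (1 + t\<^sup>2) \<le> (b - a)\<^sup>2 + 4"
      by (simp add: power_mult_distrib algebra_simps)
    moreover have "0 < 1 + t\<^sup>2"
      by (simp add: add_pos_nonneg)
    ultimately show ?thesis
      by (simp add: field_simps)
  qed
  have "integrable lborel (\<lambda>t::real. ((b - a)\<^sup>2 + 4) * inverse (1 + t\<^sup>2))"
    using has_bochner_integral_inverse_square by (auto simp: has_bochner_integral_iff)
  then have "integrable lborel (\<lambda>t. (norm (box_kernel a b t))\<^sup>2)"
    by (rule Bochner_Integration.integrable_bound) (use le in \<open>auto intro: order_trans[OF _ abs_ge_self]\<close>)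
  then show ?thesis
    by (simp add: square_integrable_def)
qed

lemma box_kernel_eq_integral:
  assumes "a \<le> b" "t \<noteq> 0"
  shows "(LINT x|lborel. indicator {a..b} x *\<^sub>R iexp (- (t * x))) = box_kernel a b t"
proof -
  have "(LINT x|lborel. indicator {a..b} x *\<^sub>R iexp (- (t * x)))
    = (\<i> / t) * iexp (- (t * b)) - (\<i> / t) * iexp (- (t * a))"
  proof (rule integral_FTC_atLeastAtMost[OF \<open>a \<le> b\<close>])
    show "((\<lambda>x. \<i> / t * iexp (- (t * x))) has_vector_derivative iexp (- (t * x))) (at x within {a..b})" for x
    proof -
      have "((\<lambda>z. \<i> / t * exp (\<i> * (- (t * z)))) has_field_derivative iexp (- (t * x))) (at (complex_of_real x))"
        using \<open>t \<noteq> 0\<close> by (auto intro!: derivative_eq_intros simp: field_simps)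
      then show ?thesis
        using has_vector_derivative_real_field by fastforce
    qed
  qed (intro continuous_intros)
  also have "\<dots> = box_kernel a b t"
    using \<open>t \<noteq> 0\<close> by (simp add: box_kernel_def field_simps)
  finally show ?thesis .
qed

text \<open>Divided by its total mass \<open>c\<close>, \<open>f\<close> is a probability density
  and its transform a characteristic function, so this is Levy's theorem multiplied by
  \<open>c\<close>. If the mass is 0 no normalization is possible, but then \<open>f\<close>
  vanishes almost everywhere and both sides are 0.\<close>

lemma levy_inversion_nonneg:
  fixes f :: "real \<Rightarrow> real"
  assumes f: "integrable lborel f" and nn: "\<And>x. 0 \<le> f x" and ab: "a \<le> b"
  shows "(\<lambda>n::nat. LINT t|lborel. indicator {- real n<..<real n} t *\<^sub>R
      (box_kernel a b t * fourier_integral (\<lambda>x. complex_of_real (f x)) t))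
    \<longlonglongrightarrow> complex_of_real (2 * pi * (LINT x|lborel. indicator {a..b} x * f x))"
proof (cases "(LINT x|lborel. f x) = 0")
  case True
  then have ae: "AE x in lborel. f x = 0"
    using f nn by (subst (asm) integral_nonneg_eq_0_iff_AE) auto
  note [measurable] = borel_measurable_integrable[OF f]
  have 1: "fourier_integral (\<lambda>x. complex_of_real (f x)) t = 0" for t
    unfolding fourier_integral_def
    by (rule integral_eq_zero_AE) (use ae in eventually_elim, simp)
  have 2: "(LINT x|lborel. indicator {a..b} x * f x) = 0"
    by (rule integral_eq_zero_AE) (use ae in eventually_elim, simp)
  show ?thesis by (simp add: 1 2)
next
  case False
  define c where "c = (LINT x|lborel. f x)"
  have c: "0 < c" using False nn by (simp add: c_def less_le)
  note [measurable] = borel_measurable_integrable[OF f]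
  define M where "M = density lborel (\<lambda>x. ennreal (f x / c))"
  have [simp]: "sets M = sets borel" "space M = UNIV" by (auto simp: M_def)
  have em: "emeasure M A = ennreal ((LINT x|lborel. indicator A x * f x) / c)" if [measurable]: "A \<in> sets borel" for A
  proof -
    have int: "integrable lborel (\<lambda>x. f x / c * indicator A x)"
      using integrable_mult_indicator[OF _ f, of A] by (simp add: mult.commute[of "f _"])
    have "emeasure M A = (\<integral>\<^sup>+x. ennreal (f x / c * indicator A x) \<partial>lborel)"
      unfolding M_def by (subst emeasure_density) (auto intro!: nn_integral_cong simp: indicator_def)
    also have "\<dots> = ennreal (LINT x|lborel. f x / c * indicator A x)"
      using int nn c by (intro nn_integral_eq_integral) auto
    finally show ?thesis by (simp add: mult.commute)
  qed
  interpret M: prob_space M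
    by (rule prob_spaceI) (use em[of UNIV] c in \<open>simp add: c_def\<close>)
  interpret M: real_distribution M
    by unfold_locales simp_all
  have char: "char M t = fourier_integral (\<lambda>x. complex_of_real (f x)) t / c" for t
    unfolding char_def M_def fourier_integral_def using nn c
    by (subst integral_density) (auto simp: scaleR_conv_of_real mult.commute simp flip: integral_divide_zero)
  \<comment> \<open>Levy's theorem wants the end points of the interval to carry no mass; a measure
    with a density has no atoms.\<close>
  have mz: "measure M {x} = 0" for x
  proof -
    have "(LINT y|lborel. indicator {x} y * f y) = 0"
      by (rule integral_eq_zero_AE, rule AE_I'[of "{x}"]) (auto simp: indicator_def)
    then show ?thesis using em[of "{x}"] by (simp add: measure_def)
  qed
  have "(LINT x|lborel. indicator {a<..b} x * f x) = (LINT x|lborel. indicator {a..b} x * f x)"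
    by (rule integral_cong_AE, auto, rule AE_I'[of "{a}"]) (auto simp: indicator_def)
  then have mab: "measure M {a<..b} = (LINT x|lborel. indicator {a..b} x * f x) / c"
    using em[of "{a<..b}"] nn c by (simp add: measure_def)
  have I: "(CLBINT t=-real n..real n. (iexp (-(t * a)) - iexp (-(t * b))) / (\<i> * t) * char M t)
    = (LINT t|lborel. indicator {- real n<..<real n} t *\<^sub>R
      (box_kernel a b t * fourier_integral (\<lambda>x. complex_of_real (f x)) t)) / c" for n :: nat
    by (simp add: char interval_lebesgue_integral_def set_lebesgue_integral_def
        box_kernel_def scaleR_conv_of_real mult.assoc flip: integral_divide_zero)
  have "(\<lambda>n::nat. complex_of_real (2 * pi * c) * (1 / (2 * pi) * (CLBINT t=-real n..real n. (iexp (-(t * a)) - iexp (-(t * b))) / (\<i> * t) * char M t)))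
    \<longlonglongrightarrow> complex_of_real (2 * pi * c) * complex_of_real (measure M {a<..b})"
    using M.Levy_Inversion[OF ab mz mz] by (intro tendsto_mult tendsto_const) simp
  then show ?thesis
    unfolding I using c by (simp add: mab mult.assoc)
qed


lemma levy_inversion:
  fixes f :: "real \<Rightarrow> real"
  assumes f: "integrable lborel f" and ab: "a \<le> b"
  shows "(\<lambda>n::nat. LINT t|lborel. indicator {- real n<..<real n} t *\<^sub>R
      (box_kernel a b t * fourier_integral (\<lambda>x. complex_of_real (f x)) t))
    \<longlonglongrightarrow> complex_of_real (2 * pi * (LINT x|lborel. indicator {a..b} x * f x))"
proof -
  define f1 f2 where "f1 = (\<lambda>x. max (f x) 0)" and "f2 = (\<lambda>x. max (- f x) 0)"
  have f1: "integrable lborel f1" "\<And>x. 0 \<le> f1 x" and f2: "integrable lborel f2" "\<And>x. 0 \<le> f2 x"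
    using f by (auto simp: f1_def f2_def)
  have split: "f x = f1 x - f2 x" for x
    by (simp add: f1_def f2_def)
  have four: "fourier_integral (\<lambda>x. complex_of_real (f x)) t
    = fourier_integral (\<lambda>x. complex_of_real (f1 x)) t - fourier_integral (\<lambda>x. complex_of_real (f2 x)) t" for t
    unfolding fourier_integral_def split of_real_diff right_diff_distrib
    using f1 f2 by (intro Bochner_Integration.integral_diff integrable_iexp_mult integrable_of_real)
  \<comment> \<open>On a bounded window the kernel is at most b - a and the transform at most the L1
    norm, so the window integrals of the two parts may be subtracted.\<close>
  have int: "integrable lborel (\<lambda>t. indicator {- real n<..<real n} t *\<^sub>R
      (box_kernel a b t * fourier_integral (\<lambda>x. complex_of_real (h x)) t))" 
    if h: "integrable lborel h" for h and n :: nat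
  proof (rule integrableI_bounded_set_indicator[where B = "(b - a) * (LINT x|lborel. norm (h x))"])
    note [measurable] = borel_measurable_integrable[OF h]
    show "(\<lambda>t. box_kernel a b t * fourier_integral (\<lambda>x. complex_of_real (h x)) t) \<in> borel_measurable lborel"
      by measurable
    show "AE x in lborel. x \<in> {- real n<..<real n} \<longrightarrow>
        norm (box_kernel a b x * fourier_integral (\<lambda>x. complex_of_real (h x)) x) \<le> (b - a) * (LINT x|lborel. norm (h x))"
      using norm_box_kernel_le(1)[OF ab] norm_fourier_integral_le[of "\<lambda>x. complex_of_real (h x)"] ab
      by (auto simp: norm_mult intro!: mult_mono)
  qed auto
  have box: "integrable lborel (\<lambda>x. indicator {a..b} x * h x)" if "integrable lborel h" for h :: "real \<Rightarrow> real"
    using integrable_mult_indicator[OF _ that, of "{a..b}"] by simp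
  have "(LINT x|lborel. indicator {a..b} x * f x)
    = (LINT x|lborel. indicator {a..b} x * f1 x) - (LINT x|lborel. indicator {a..b} x * f2 x)"
    unfolding split right_diff_distrib
    using f1 f2 by (intro Bochner_Integration.integral_diff box)
  then have lim: "complex_of_real (2 * pi * (LINT x|lborel. indicator {a..b} x * f x))
    = complex_of_real (2 * pi * (LINT x|lborel. indicator {a..b} x * f1 x))
      - complex_of_real (2 * pi * (LINT x|lborel. indicator {a..b} x * f2 x))"
    by (simp only: of_real_diff right_diff_distrib)
  show ?thesis
    unfolding lim four right_diff_distrib scaleR_right_diff_distrib
    using tendsto_diff[OF levy_inversion_nonneg[OF f1 ab] levy_inversion_nonneg[OF f2 ab]]
    by (simp add: Bochner_Integration.integral_diff[OF int int] f1 f2)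
qed

section \<open>Parseval's identity against indicators of intervals\<close>

lemma truncated_fourier_eq:
  "truncated_fourier R f \<xi>
    = fourier_integral (\<lambda>x. complex_of_real (indicator {-R..R} x * f x)) (- \<xi>) / sqrt (2 * pi)"
  unfolding truncated_fourier_def fourier_integral_def set_lebesgue_integral_def
  by (intro arg_cong2[where f = "(/)"] Bochner_Integration.integral_cong)
    (auto simp: cis_conv_exp scaleR_conv_of_real indicator_def mult.commute[of \<xi>])

lemma integral_lborel_uminus:
  fixes f :: "real \<Rightarrow> 'a::euclidean_space"
  shows "(LINT x|lborel. f (- x)) = (LINT x|lborel. f x)"
  using lborel_integral_real_affine[of "-1" f 0] by simp

lemma square_integrable_uminus:
  fixes f :: "real \<Rightarrow> 'a::{banach, second_countable_topology}"
  assumes f: "square_integrable f"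
  shows "square_integrable (\<lambda>x. f (- x))" "L2norm (\<lambda>x. f (- x)) = L2norm f"
proof -
  note [measurable] = square_integrable_measurable[OF f]
  show "square_integrable (\<lambda>x. f (- x))"
    using f lborel_integrable_real_affine[of "\<lambda>x. (norm (f x))\<^sup>2" "-1" 0]
    by (simp add: square_integrable_def)
  show "L2norm (\<lambda>x. f (- x)) = L2norm f"
    unfolding L2norm_def by (subst (2) integral_lborel_uminus[symmetric]) simp
qed

text \<open>\<open>box_kernel\<close> is the transform of the indicator of [a,b], so this is
  Parseval's identity for that indicator. For \<open>f\<close> cut off to [-R,R] it comes from
  Levy's theorem. It survives the limit in R because the kernel is in L2 and the truncated
  transforms converge to \<open>g\<close> in L2.\<close>

lemma fourier_parseval_box:
  assumes fg: "has_fourier_transform f g" and ab: "a \<le> b"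
  shows "(LINT t|lborel. box_kernel a b t * g (- t)) = sqrt (2 * pi) * (LINT x|lborel. indicator {a..b} x * f x)"
proof -
  note m [measurable] = has_fourier_transform_measurable(1,2)[OF fg]
  note sq = has_fourier_transform_measurable(3,4)[OF fg]
  define S where "S = complex_of_real (sqrt (2 * pi))"
  have [simp]: "S \<noteq> 0" "S * S = 2 * pi" by (auto simp: S_def simp flip: of_real_mult)
  define c where "c = (LINT x|lborel. indicator {a..b} x * f x)"
  let ?N = "\<lambda>R. \<integral>\<^sup>+ \<xi>. ennreal ((norm (truncated_fourier R f \<xi> - g \<xi>))\<^sup>2) \<partial>lborel"
  have N: "(?N \<longlongrightarrow> 0) at_top"
    using fg by (simp add: has_fourier_transform_def)
  note ksq = square_integrable_box_kernel[OF ab]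
  have le: "norm ((LINT t|lborel. box_kernel a b t * g (- t)) - S * c) \<le> L2norm (box_kernel a b) * e"
    if e: "0 < e" for e
  proof -
    have "\<forall>\<^sub>F R in at_top. ?N R < ennreal (e\<^sup>2)"
      using N e by (intro order_tendstoD(2)) auto
    moreover have "\<forall>\<^sub>F R in at_top. \<bar>a\<bar> \<le> R \<and> \<bar>b\<bar> \<le> R"
      by (intro eventually_conj eventually_ge_at_top)
    ultimately have "\<forall>\<^sub>F R in at_top. ?N R < ennreal (e\<^sup>2) \<and> \<bar>a\<bar> \<le> R \<and> \<bar>b\<bar> \<le> R"
      by (rule eventually_conj)
    \<comment> \<open>For this R the interval [a,b] lies in [-R,R], so the cut-off does not change
      the integral of \<open>f\<close> over [a,b], while the transform is within e of
      \<open>g\<close> in L2.\<close>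
    then obtain R where R: "?N R < ennreal (e\<^sup>2)" "\<bar>a\<bar> \<le> R" "\<bar>b\<bar> \<le> R"
      by (metis (no_types, lifting) eventually_at_top_linorder order_refl)
    let ?T = "truncated_fourier R f"
    let ?fR = "\<lambda>x. indicator {-R..R} x * f x"
    \<comment> \<open>A finite distance to the square-integrable \<open>g\<close> is what puts the
      truncated transform into L2, ahead of any form of Plancherel's theorem.\<close>
    have Dsq: "square_integrable (\<lambda>\<xi>. ?T \<xi> - g \<xi>)"
      using R(1) by (auto simp: square_integrable_iff_nn intro: order_less_trans)
    have "ennreal ((L2norm (\<lambda>\<xi>. ?T \<xi> - g \<xi>))\<^sup>2) < ennreal (e\<^sup>2)"
      using R(1) by (simp add: nn_integral_L2norm[OF Dsq])
    then have "(L2norm (\<lambda>\<xi>. ?T \<xi> - g \<xi>))\<^sup>2 < e\<^sup>2"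
      by (simp add: ennreal_less_iff)
    then have De: "L2norm (\<lambda>\<xi>. ?T \<xi> - g \<xi>) \<le> e"
      using e by (simp add: power2_less_imp_less less_imp_le)
    have Tsq: "square_integrable ?T"
      using square_integrable_add[OF Dsq sq(2)] by simp
    have F: "fourier_integral (\<lambda>x. complex_of_real (?fR x)) t = S * ?T (- t)" for t
      by (simp add: truncated_fourier_eq S_def)
    have int: "integrable lborel (\<lambda>t. box_kernel a b t * ?T (- t))"
      by (intro L2norm_mult_bound ksq square_integrable_uminus Tsq)
    have intg: "integrable lborel (\<lambda>t. box_kernel a b t * g (- t))"
      by (intro L2norm_mult_bound ksq square_integrable_uminus sq)
    have "(\<lambda>n::nat. LINT t|lborel. indicator {- real n<..<real n} t *\<^sub>R (box_kernel a b t * (S * ?T (- t))))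
      \<longlonglongrightarrow> complex_of_real (2 * pi * (LINT x|lborel. indicator {a..b} x * ?fR x))"
      using levy_inversion[OF square_integrable_truncate[OF sq(1)] ab, of R] by (simp only: F)
    moreover have "(\<lambda>n::nat. LINT t|lborel. indicator {- real n<..<real n} t *\<^sub>R (box_kernel a b t * (S * ?T (- t))))
      \<longlonglongrightarrow> (LINT t|lborel. box_kernel a b t * (S * ?T (- t)))"
    \<comment> \<open>The whole integrand is its own majorant: as a product of two L2 functions it
      is integrable over the line, so the symmetric limit in Levy's theorem is an ordinary
      integral.\<close>
    proof (rule integral_dominated_convergence[where w = "\<lambda>t. norm (box_kernel a b t * (S * ?T (- t)))"])
      show "integrable lborel (\<lambda>t. norm (box_kernel a b t * (S * ?T (- t))))"
        using integrable_mult_right[OF int, of S] by (simp add: mult.left_commute)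
      show "AE t in lborel. (\<lambda>n. indicator {- real n<..<real n} t *\<^sub>R (box_kernel a b t * (S * ?T (- t))))
        \<longlonglongrightarrow> box_kernel a b t * (S * ?T (- t))"
      proof (intro AE_I2 tendsto_eventually)
        fix t :: real
        have "\<forall>\<^sub>F n in sequentially. \<bar>t\<bar> < real n"
          using filterlim_real_sequentially by (rule filterlim_at_top_dense[THEN iffD1, rule_format])
        then show "\<forall>\<^sub>F n in sequentially. indicator {- real n<..<real n} t *\<^sub>R (box_kernel a b t * (S * ?T (- t)))
          = box_kernel a b t * (S * ?T (- t))"
          by eventually_elim (auto simp: indicator_def)
      qed
    qed (auto simp: indicator_def)
    ultimately have "(LINT t|lborel. box_kernel a b t * (S * ?T (- t)))
        = complex_of_real (2 * pi * (LINT x|lborel. indicator {a..b} x * ?fR x))"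
      using LIMSEQ_unique by blast
    also have "(LINT x|lborel. indicator {a..b} x * ?fR x) = c"
      unfolding c_def by (intro Bochner_Integration.integral_cong) (use R in \<open>auto simp: indicator_def\<close>)
    also have "(LINT t|lborel. box_kernel a b t * (S * ?T (- t))) = S * (LINT t|lborel. box_kernel a b t * ?T (- t))"
      by (simp add: mult.left_commute)
    also have "complex_of_real (2 * pi * c) = S * (S * c)"
      by (simp flip: mult.assoc)
    finally have "(LINT t|lborel. box_kernel a b t * ?T (- t)) = S * c"
      by simp
    then have "(LINT t|lborel. box_kernel a b t * g (- t)) - S * c
        = - (LINT t|lborel. box_kernel a b t * (?T (- t) - g (- t)))"
      unfolding right_diff_distrib by (subst Bochner_Integration.integral_diff[OF int intg]) simp
    then have "norm ((LINT t|lborel. box_kernel a b t * g (- t)) - S * c)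
        \<le> L2norm (box_kernel a b) * L2norm (\<lambda>t. ?T (- t) - g (- t))"
      using L2norm_mult_bound(2)[OF ksq square_integrable_uminus(1)[OF Dsq]] by simp
    also have "\<dots> \<le> L2norm (box_kernel a b) * e"
      using De square_integrable_uminus(2)[OF Dsq] by (intro mult_left_mono) auto
    finally show ?thesis .
  qed
  have "norm ((LINT t|lborel. box_kernel a b t * g (- t)) - S * c) \<le> 0"
  proof (rule field_le_epsilon)
    fix e :: real assume e: "0 < e"
    \<comment> \<open>The summand 1 avoids a division by zero when the kernel vanishes, as for a =
      b.\<close>
    let ?L = "L2norm (box_kernel a b) + 1"
    have L: "0 < ?L" by (simp add: add_nonneg_pos)
    have "norm ((LINT t|lborel. box_kernel a b t * g (- t)) - S * c) \<le> L2norm (box_kernel a b) * (e / ?L)"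
      using le[of "e / ?L"] e L by simp
    also have "\<dots> \<le> ?L * (e / ?L)"
      using e L by (intro mult_right_mono) auto
    also have "\<dots> = 0 + e" using L by simp
    finally show "norm ((LINT t|lborel. box_kernel a b t * g (- t)) - S * c) \<le> 0 + e" .
  qed
  then show ?thesis
    by (simp add: S_def c_def)
qed

text \<open>Fubini moves the integral over [a,b] onto the exponential, which turns it into
  \<open>box_kernel\<close> at -t, except on the null set t = 0; the rest is
  \<open>fourier_parseval_box\<close> after a reflection.\<close>

lemma fourier_inversion_box:
  assumes fg: "has_fourier_transform f g" and g: "integrable lborel g" and ab: "a \<le> b"
  shows "(LINT x|lborel. indicator {a..b} x *\<^sub>R fourier_integral g x)
    = sqrt (2 * pi) * (LINT x|lborel. indicator {a..b} x * f x)"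
proof -
  note [measurable] = borel_measurable_integrable[OF g]
  have nint: "integrable lborel (\<lambda>t. norm (g t))" using g by simp
  have "integrable (lborel \<Otimes>\<^sub>M lborel) (\<lambda>(x, t). indicator {a..b} x *\<^sub>R (iexp (x * t) * g t))"
  proof (rule Bochner_Integration.integrable_bound)
    have "integrable lborel (indicator {a..b} :: real \<Rightarrow> real)"
      by (intro integrable_real_indicator) (auto simp: emeasure_lborel_Icc_eq)
    then show "integrable (lborel \<Otimes>\<^sub>M lborel) (\<lambda>(x, t). indicator {a..b} x * norm (g t) :: real)"
      using nint by (intro lborel_pair.Fubini_integrable) (auto simp: abs_mult)
  qed (auto simp: norm_mult)
  then have "(LINT x|lborel. LINT t|lborel. indicator {a..b} x *\<^sub>R (iexp (x * t) * g t))
    = (LINT t|lborel. LINT x|lborel. indicator {a..b} x *\<^sub>R (iexp (x * t) * g t))"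
    by (rule lborel_pair.Fubini_integral[symmetric])
  also have "\<dots> = (LINT t|lborel. box_kernel a b (- t) * g t)"
  proof (rule integral_cong_AE)
    have "AE t in lborel. t \<noteq> (0::real)"
      by (rule AE_lborel_singleton)
    then show "AE t in lborel. (LINT x|lborel. indicator {a..b} x *\<^sub>R (iexp (x * t) * g t)) = box_kernel a b (- t) * g t"
    proof eventually_elim
      case (elim t)
      show ?case
        using box_kernel_eq_integral[OF ab, of "- t"] elim
        by (simp add: mult_scaleR_left[symmetric] mult.commute[of "of_real t"] del: mult_scaleR_left)
    qed
  qed auto
  also have "\<dots> = (LINT t|lborel. box_kernel a b t * g (- t))"
    using integral_lborel_uminus[of "\<lambda>t. box_kernel a b (- t) * g t"] by simp
  finally show ?thesis
    by (simp add: fourier_parseval_box[OF fg ab] fourier_integral_def)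
qed

section \<open>The Plancherel inequality\<close>

lemma nn_integral_lborel_translate:
  assumes [measurable]: "f \<in> borel_measurable borel"
  shows "(\<integral>\<^sup>+y. f (x - y) \<partial>lborel) = (\<integral>\<^sup>+y. f (y :: real) \<partial>lborel)"
    "(\<integral>\<^sup>+y. f (y - x) \<partial>lborel) = (\<integral>\<^sup>+y. f (y :: real) \<partial>lborel)"
  using nn_integral_real_affine[of f "-1" x] nn_integral_real_affine[of f 1 "-x"]
  by (auto simp: one_ennreal_def[symmetric])

text \<open>A special case of Young's inequality: bound f(x) f(y) by half the sum of the squares,
  and each of the two terms gives half of the right-hand side by translation invariance. It serves
  for the Gaussian in the Plancherel inequality and for the exponential kernel in the energy
  identity.\<close>

lemma nn_integral_convolution_form_le:
  fixes f K :: "real \<Rightarrow> real"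
  assumes [measurable]: "f \<in> borel_measurable borel" "K \<in> borel_measurable borel"
    and f: "\<And>x. 0 \<le> f x" and K: "\<And>x. 0 \<le> K x"
  shows "(\<integral>\<^sup>+x. \<integral>\<^sup>+y. ennreal (f x * f y * K (x - y)) \<partial>lborel \<partial>lborel)
    \<le> (\<integral>\<^sup>+x. ennreal ((f x)\<^sup>2) \<partial>lborel) * (\<integral>\<^sup>+x. ennreal (K x) \<partial>lborel)"
proof -
  let ?E = "\<integral>\<^sup>+x. ennreal ((f x)\<^sup>2) \<partial>lborel" and ?K = "\<integral>\<^sup>+x. ennreal (K x) \<partial>lborel"
  have le: "f x * f y * K z \<le> (f x)\<^sup>2 / 2 * K z + (f y)\<^sup>2 / 2 * K z" for x y z
  proof -
    have "f x * f y \<le> (f x)\<^sup>2 / 2 + (f y)\<^sup>2 / 2"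
      using sum_squares_bound[of "f x" "f y"] by simp
    from mult_right_mono[OF this K[of z]] show ?thesis by (simp add: algebra_simps)
  qed
  have "(\<integral>\<^sup>+x. \<integral>\<^sup>+y. ennreal (f x * f y * K (x - y)) \<partial>lborel \<partial>lborel)
    \<le> (\<integral>\<^sup>+x. \<integral>\<^sup>+y. ennreal ((f x)\<^sup>2 / 2) * ennreal (K (x - y)) + ennreal ((f y)\<^sup>2 / 2) * ennreal (K (x - y)) \<partial>lborel \<partial>lborel)"
    using le K by (intro nn_integral_mono) (simp flip: ennreal_mult ennreal_plus)
  also have "\<dots> = (\<integral>\<^sup>+x. \<integral>\<^sup>+y. ennreal ((f x)\<^sup>2 / 2) * ennreal (K (x - y)) \<partial>lborel \<partial>lborel)
      + (\<integral>\<^sup>+x. \<integral>\<^sup>+y. ennreal ((f y)\<^sup>2 / 2) * ennreal (K (x - y)) \<partial>lborel \<partial>lborel)"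
    by (subst nn_integral_add[symmetric]) (auto intro!: nn_integral_cong nn_integral_add)
  also have "(\<integral>\<^sup>+x. \<integral>\<^sup>+y. ennreal ((f x)\<^sup>2 / 2) * ennreal (K (x - y)) \<partial>lborel \<partial>lborel)
      = (\<integral>\<^sup>+x. ennreal ((f x)\<^sup>2 / 2) \<partial>lborel) * ?K"
    by (simp add: nn_integral_cmult nn_integral_multc nn_integral_lborel_translate[where f = "\<lambda>x. ennreal (K x)"])
  also have "(\<integral>\<^sup>+x. \<integral>\<^sup>+y. ennreal ((f y)\<^sup>2 / 2) * ennreal (K (x - y)) \<partial>lborel \<partial>lborel)
      = (\<integral>\<^sup>+y. \<integral>\<^sup>+x. ennreal ((f y)\<^sup>2 / 2) * ennreal (K (x - y)) \<partial>lborel \<partial>lborel)"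
    by (rule lborel_pair.Fubini') simp
  also have "\<dots> = (\<integral>\<^sup>+x. ennreal ((f x)\<^sup>2 / 2) \<partial>lborel) * ?K"
    by (simp add: nn_integral_cmult nn_integral_multc nn_integral_lborel_translate[where f = "\<lambda>x. ennreal (K x)"])
  also have "(\<integral>\<^sup>+x. ennreal ((f x)\<^sup>2 / 2) \<partial>lborel) * ?K + (\<integral>\<^sup>+x. ennreal ((f x)\<^sup>2 / 2) \<partial>lborel) * ?K
    = (\<integral>\<^sup>+x. ennreal ((f x)\<^sup>2 / 2) + ennreal ((f x)\<^sup>2 / 2) \<partial>lborel) * ?K"
    by (subst nn_integral_add) (auto simp: distrib_right)
  also have "\<dots> = ?E * ?K"
    by (simp flip: ennreal_plus)
  finally show ?thesis .
qed

text \<open>If \<open>f\<close> is not integrable, its Bochner integral is 0 by convention and the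
  bound is trivial.\<close>

lemma norm_integral_le_nn_integral:
  fixes f :: "'a \<Rightarrow> 'b::{banach, second_countable_topology}"
  shows "ennreal (norm (integral\<^sup>L M f)) \<le> (\<integral>\<^sup>+x. ennreal (norm (f x)) \<partial>M)"
  by (cases "integrable M f") (auto simp: integral_norm_bound_ennreal not_integrable_integral_eq)

text \<open>The characteristic function of the standard normal distribution, after the substitution
  y = c x.\<close>

lemma integral_gaussian_iexp:
  assumes c: "0 < c"
  shows "(LINT x|lborel. iexp (x * \<tau>) * complex_of_real (std_normal_density (c * x)))
    = complex_of_real (sqrt (2 * pi) / c * std_normal_density (\<tau> / c))"
proof -
  have "complex_of_real (exp (- ((\<tau> / c)\<^sup>2) / 2)) = (LINT y|std_normal_distribution. iexp (\<tau> / c * y))"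
    by (simp only: char_std_normal_distribution[THEN fun_cong, symmetric] char_def)
  also have "\<dots> = (LINT y|lborel. std_normal_density y *\<^sub>R iexp (\<tau> / c * y))"
    by (rule integral_density) auto
  also have "\<dots> = \<bar>c\<bar> *\<^sub>R (LINT x|lborel. std_normal_density (0 + c * x) *\<^sub>R iexp (\<tau> / c * (0 + c * x)))"
    using c by (intro lborel_integral_real_affine) simp
  also have "\<dots> = c * (LINT x|lborel. iexp (x * \<tau>) * complex_of_real (std_normal_density (c * x)))"
    using c by (simp add: scaleR_conv_of_real mult.commute)
  finally show ?thesis
    using c by (simp add: normal_density_def field_simps)
qed

lemma integrable_std_normal_density_scaled:
  assumes "0 < c"
  shows "integrable lborel (\<lambda>x. std_normal_density (c * x))"
    "(\<integral>\<^sup>+x. ennreal (std_normal_density (c * x)) \<partial>lborel) = ennreal (1 / c)"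
proof -
  show int: "integrable lborel (\<lambda>x. std_normal_density (c * x))"
    using lborel_integrable_real_affine[of std_normal_density c 0] assms by simp
  have "1 = c * (LINT x|lborel. std_normal_density (c * x))"
    using lborel_integral_real_affine[of c std_normal_density 0] assms by simp
  then show "(\<integral>\<^sup>+x. ennreal (std_normal_density (c * x)) \<partial>lborel) = ennreal (1 / c)"
    using assms by (subst nn_integral_eq_integral[OF int]) (auto simp: field_simps)
qed

(* The transform h of g is bounded, so two applications of Fubini in the plane turn the integral of
   |h|^2 against a Gaussian into a double integral of g against the transformed Gaussian. *)
lemma plancherel_gaussian_le:
  assumes g: "integrable lborel g" and g2: "square_integrable g" and c: "0 < c"
  shows "(\<integral>\<^sup>+x. ennreal ((norm (fourier_integral g x))\<^sup>2 * std_normal_density (c * x)) \<partial>lborel)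
    \<le> ennreal (sqrt (2 * pi) * (L2norm g)\<^sup>2)"
proof -
  note [measurable] = borel_measurable_integrable[OF g]
  define h where "h = fourier_integral g"
  define w where "w x = std_normal_density (c * x)" for x
  \<comment> \<open>\<open>W\<close> is the transform of the weight \<open>w\<close>. As c shrinks
    it concentrates at 0, but its mass is sqrt(2 pi) for every c; this makes the final bound
    independent of c.\<close>
  define W where "W x = sqrt (2 * pi) / c * std_normal_density (inverse c * x)" for x
  define C where "C = (LINT \<xi>|lborel. norm (g \<xi>))"
  have h_le: "norm (h x) \<le> C" for x
    unfolding h_def C_def by (rule norm_fourier_integral_le)
  have C0: "0 \<le> C" by (simp add: C_def)
  have [measurable]: "h \<in> borel_measurable borel" "w \<in> borel_measurable borel" "W \<in> borel_measurable borel"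
    by (auto simp: h_def w_def[abs_def] W_def[abs_def])
  have [measurable]: "(\<lambda>x. cnj (h x)) \<in> borel_measurable borel"
    by (rule measurable_compose[OF _ borel_measurable_continuous_onI]) (auto intro!: continuous_intros)
  have w: "integrable lborel w" "\<And>x. 0 \<le> w x"
    using integrable_std_normal_density_scaled(1)[OF c] by (auto simp: w_def[abs_def])
  have W0: "0 \<le> W x" for x using c by (simp add: W_def)
  have WI: "(LINT x|lborel. iexp (x * \<tau>) * complex_of_real (w x)) = complex_of_real (W \<tau>)" for \<tau>
    using integral_gaussian_iexp[OF c, of \<tau>] by (simp add: W_def w_def field_simps)
  have gC: "integrable lborel (\<lambda>x. norm (g x))" using g by simp
  \<comment> \<open>One exchange of integrals, applied twice: with \<open>k\<close> equal to 1 and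
    \<open>q\<close> the reflected conjugate of \<open>g\<close>, and with \<open>k\<close> the
    conjugate of \<open>h\<close> and \<open>q\<close> equal to \<open>g\<close>. The integrable
    Gaussian and the bound on \<open>k\<close> give absolute convergence.\<close>
  have step: "(LINT x|lborel. k x * complex_of_real (w x) * fourier_integral q x)
      = (LINT \<xi>|lborel. q \<xi> * (LINT x|lborel. iexp (x * \<xi>) * (k x * complex_of_real (w x))))"
    if [measurable]: "k \<in> borel_measurable borel" and k: "\<And>x. norm (k x) \<le> D" and q: "integrable lborel q" for k q D
  proof -
    note [measurable] = borel_measurable_integrable[OF q]
    have D: "0 \<le> D" using order_trans[OF norm_ge_zero k] .
    have "integrable (lborel \<Otimes>\<^sub>M lborel) (\<lambda>(x, \<xi>). k x * complex_of_real (w x) * (iexp (x * \<xi>) * q \<xi>))"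
    proof (rule Bochner_Integration.integrable_bound)
      show "integrable (lborel \<Otimes>\<^sub>M lborel) (\<lambda>(x, t). (D * w x) * norm (q t))"
        using w q by (intro lborel_pair.Fubini_integrable) (auto simp: abs_mult D)
      show "AE p in lborel \<Otimes>\<^sub>M lborel. norm (case p of (x, \<xi>) \<Rightarrow> k x * complex_of_real (w x) * (iexp (x * \<xi>) * q \<xi>))
          \<le> norm (case p of (x, t) \<Rightarrow> (D * w x) * norm (q t))"
        using k w D by (intro AE_I2) (auto simp: split_beta norm_mult abs_mult intro!: mult_right_mono)
    qed auto
    from lborel_pair.Fubini_integral[OF this]
    have "(LINT x|lborel. LINT \<xi>|lborel. k x * complex_of_real (w x) * (iexp (x * \<xi>) * q \<xi>))
       = (LINT \<xi>|lborel. LINT x|lborel. q \<xi> * (iexp (x * \<xi>) * (k x * complex_of_real (w x))))"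
      by (simp add: mult_ac)
    then show ?thesis
      by (simp add: fourier_integral_def)
  qed
  have inner: "(LINT x|lborel. iexp (x * \<xi>) * (cnj (h x) * complex_of_real (w x)))
      = (LINT \<eta>|lborel. cnj (g \<eta>) * complex_of_real (W (\<xi> - \<eta>)))" for \<xi>
  proof -
    have hc: "cnj (h x) = fourier_integral (\<lambda>\<eta>. cnj (g (- \<eta>))) x" for x
    proof -
      have "cnj (h x) = (LINT \<eta>|lborel. cnj (iexp (x * \<eta>) * g \<eta>))"
        unfolding h_def fourier_integral_def
        by (rule integral_bounded_linear[OF bounded_linear_cnj integrable_iexp_mult[OF g], symmetric])
      also have "\<dots> = (LINT \<eta>|lborel. cnj (iexp (x * - \<eta>) * g (- \<eta>)))"
        by (rule integral_lborel_uminus[symmetric])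
      finally show ?thesis by (simp add: fourier_integral_def exp_cnj)
    qed
    have shift: "iexp (x * \<eta>) * (iexp (x * \<xi>) * z) = iexp (x * (\<xi> + \<eta>)) * z" for x \<eta> z
      by (simp add: distrib_left exp_add mult_ac)
    have "(LINT x|lborel. iexp (x * \<xi>) * (cnj (h x) * complex_of_real (w x)))
      = (LINT x|lborel. iexp (x * \<xi>) * complex_of_real (w x) * fourier_integral (\<lambda>\<eta>. cnj (g (- \<eta>))) x)"
      by (simp add: hc mult_ac)
    also have "\<dots> = (LINT \<eta>|lborel. cnj (g (- \<eta>)) * (LINT x|lborel. iexp (x * \<eta>) * (iexp (x * \<xi>) * complex_of_real (w x))))"
      using lborel_integrable_real_affine[of "\<lambda>x. cnj (g x)" "-1" 0] g
      by (intro step[where D = 1]) auto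
    also have "\<dots> = (LINT \<eta>|lborel. cnj (g (- \<eta>)) * complex_of_real (W (\<xi> + \<eta>)))"
      by (simp only: shift WI)
    also have "\<dots> = (LINT \<eta>|lborel. cnj (g \<eta>) * complex_of_real (W (\<xi> - \<eta>)))"
      by (subst integral_lborel_uminus[symmetric]) simp
    finally show ?thesis .
  qed
  have int: "integrable lborel (\<lambda>x. (norm (h x))\<^sup>2 * w x)"
  proof (rule Bochner_Integration.integrable_bound)
    show "integrable lborel (\<lambda>x. C\<^sup>2 * w x)" using w by simp
  qed (use h_le w C0 in \<open>auto intro!: mult_right_mono power_mono\<close>)
  have "complex_of_real (LINT x|lborel. (norm (h x))\<^sup>2 * w x) = (LINT x|lborel. cnj (h x) * complex_of_real (w x) * fourier_integral g x)"
    unfolding integral_complex_of_real[symmetric]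
    by (intro Bochner_Integration.integral_cong) (auto simp: h_def complex_norm_square mult_ac simp del: of_real_power)
  also have "\<dots> = (LINT \<xi>|lborel. g \<xi> * (LINT x|lborel. iexp (x * \<xi>) * (cnj (h x) * complex_of_real (w x))))"
    using h_le g by (intro step[where D = C]) auto
  also have "\<dots> = (LINT \<xi>|lborel. g \<xi> * (LINT \<eta>|lborel. cnj (g \<eta>) * complex_of_real (W (\<xi> - \<eta>))))"
    by (simp only: inner)
  finally have eq: "complex_of_real (LINT x|lborel. (norm (h x))\<^sup>2 * w x)
    = (LINT \<xi>|lborel. g \<xi> * (LINT \<eta>|lborel. cnj (g \<eta>) * complex_of_real (W (\<xi> - \<eta>))))" .
  have A0: "0 \<le> (LINT x|lborel. (norm (h x))\<^sup>2 * w x)"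
    using w by (intro integral_nonneg_AE) auto
  have "(\<integral>\<^sup>+x. ennreal ((norm (h x))\<^sup>2 * w x) \<partial>lborel) = ennreal (LINT x|lborel. (norm (h x))\<^sup>2 * w x)"
    using w by (intro nn_integral_eq_integral int) auto
  also have "\<dots> = ennreal (norm (complex_of_real (LINT x|lborel. (norm (h x))\<^sup>2 * w x)))"
    using A0 by simp
  \<comment> \<open>From here on only absolute values matter: \<open>W\<close> is nonnegative, so
    the double integral is a convolution form in the modulus of \<open>g\<close>.\<close>
  also have "\<dots> \<le> (\<integral>\<^sup>+\<xi>. ennreal (norm (g \<xi> * (LINT \<eta>|lborel. cnj (g \<eta>) * complex_of_real (W (\<xi> - \<eta>))))) \<partial>lborel)"
    unfolding eq by (rule norm_integral_le_nn_integral)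
  also have "\<dots> \<le> (\<integral>\<^sup>+\<xi>. ennreal (norm (g \<xi>)) * (\<integral>\<^sup>+\<eta>. ennreal (norm (cnj (g \<eta>) * complex_of_real (W (\<xi> - \<eta>)))) \<partial>lborel) \<partial>lborel)"
    by (rule nn_integral_mono, subst norm_mult, subst ennreal_mult)
      (simp_all only: norm_ge_zero mult_left_mono norm_integral_le_nn_integral zero_le)
  also have "\<dots> = (\<integral>\<^sup>+\<xi>. \<integral>\<^sup>+\<eta>. ennreal (norm (g \<xi>) * norm (g \<eta>) * W (\<xi> - \<eta>)) \<partial>lborel \<partial>lborel)"
    using W0 by (simp add: norm_mult ennreal_mult mult.assoc flip: nn_integral_cmult)
  also have "\<dots> \<le> (\<integral>\<^sup>+x. ennreal ((norm (g x))\<^sup>2) \<partial>lborel) * (\<integral>\<^sup>+x. ennreal (W x) \<partial>lborel)"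
    by (rule nn_integral_convolution_form_le) (auto simp: W0)
  also have "(\<integral>\<^sup>+x. ennreal (W x) \<partial>lborel) = ennreal (sqrt (2 * pi) / c) * ennreal (1 / inverse c)"
  proof -
    have "(\<integral>\<^sup>+x. ennreal (W x) \<partial>lborel)
      = (\<integral>\<^sup>+x. ennreal (sqrt (2 * pi) / c) * ennreal (std_normal_density (inverse c * x)) \<partial>lborel)"
      unfolding W_def using c by (intro nn_integral_cong ennreal_mult) auto
    also have "\<dots> = ennreal (sqrt (2 * pi) / c) * (\<integral>\<^sup>+x. ennreal (std_normal_density (inverse c * x)) \<partial>lborel)"
      by (rule nn_integral_cmult) measurable
    finally show ?thesis
      using c integrable_std_normal_density_scaled(2)[of "inverse c"] by simp
  qed
  also have "\<dots> = ennreal (sqrt (2 * pi))"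
    using c by (simp flip: ennreal_mult)
  also have "(\<integral>\<^sup>+x. ennreal ((norm (g x))\<^sup>2) \<partial>lborel) * ennreal (sqrt (2 * pi)) = ennreal (sqrt (2 * pi) * (L2norm g)\<^sup>2)"
    by (simp add: nn_integral_L2norm[OF g2] mult.commute flip: ennreal_mult)
  finally show ?thesis by (simp add: h_def w_def)
qed

text \<open>As c tends to 0 the Gaussian weights tend pointwise to 1/sqrt(2 pi). Fatou's lemma then
  carries the uniform bound of \<open>plancherel_gaussian_le\<close> over to the unweighted
  integral, and so yields square integrability together with the estimate.\<close>

lemma plancherel_le:
  assumes g: "integrable lborel g" and g2: "square_integrable g"
  shows "square_integrable (fourier_integral g)" "L2norm (fourier_integral g) \<le> sqrt (2 * pi) * L2norm g"
proof -
  note [measurable] = borel_measurable_integrable[OF g]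
  let ?h = "fourier_integral g"
  let ?c = "\<lambda>n. inverse (real (Suc n))"
  let ?u = "\<lambda>n x. ennreal ((norm (?h x))\<^sup>2 * std_normal_density (?c n * x))"
  have lim: "(\<lambda>n. ?u n x) \<longlonglongrightarrow> ennreal ((norm (?h x))\<^sup>2 / sqrt (2 * pi))" for x
  proof -
    have "(\<lambda>n. (norm (?h x))\<^sup>2 * std_normal_density (?c n * x)) \<longlonglongrightarrow> (norm (?h x))\<^sup>2 * (1 / sqrt (2 * pi) * exp (- (0 * x)\<^sup>2 / 2))"
      unfolding std_normal_density_def by (intro tendsto_intros LIMSEQ_inverse_real_of_nat) auto
    then show ?thesis by (intro tendsto_ennrealI) simp
  qed
  have "(\<integral>\<^sup>+x. ennreal ((norm (?h x))\<^sup>2 / sqrt (2 * pi)) \<partial>lborel) = (\<integral>\<^sup>+x. liminf (\<lambda>n. ?u n x) \<partial>lborel)"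
    using lim by (intro nn_integral_cong) (auto intro!: lim_imp_Liminf[symmetric] simp del: of_nat_Suc)
  also have "\<dots> \<le> liminf (\<lambda>n. \<integral>\<^sup>+x. ?u n x \<partial>lborel)"
    by (rule nn_integral_liminf) simp
  also have "\<dots> \<le> ennreal (sqrt (2 * pi) * (L2norm g)\<^sup>2)"
    using plancherel_gaussian_le[OF g g2, of "?c _"]
    by (intro Liminf_le) auto
  also have "sqrt (2 * pi) * (L2norm g)\<^sup>2 = 1 / sqrt (2 * pi) * (2 * pi * (L2norm g)\<^sup>2)"
    using real_div_sqrt[of "2 * pi"] by (simp add: field_simps)
  finally have "(\<integral>\<^sup>+x. ennreal (1 / sqrt (2 * pi)) * ennreal ((norm (?h x))\<^sup>2) \<partial>lborel)
    \<le> ennreal (1 / sqrt (2 * pi)) * ennreal (2 * pi * (L2norm g)\<^sup>2)"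
    by (simp flip: ennreal_mult)
  then have le: "(\<integral>\<^sup>+x. ennreal ((norm (?h x))\<^sup>2) \<partial>lborel) \<le> ennreal (2 * pi * (L2norm g)\<^sup>2)"
    by (subst (asm) nn_integral_cmult) (auto simp: ennreal_mult_le_mult_iff)
  then show sq: "square_integrable ?h"
    by (auto simp: square_integrable_iff_nn intro: le_less_trans)
  have "(L2norm ?h)\<^sup>2 \<le> (sqrt (2 * pi) * L2norm g)\<^sup>2"
    using le by (simp add: nn_integral_L2norm[OF sq] power_mult_distrib)
  then show "L2norm ?h \<le> sqrt (2 * pi) * L2norm g"
    by (rule power2_le_imp_le) simp
qed

section \<open>Classical regularity of Sobolev functions\<close>

lemma norm_iexp_diff_le: "norm (iexp u - iexp v) \<le> \<bar>u - v\<bar>"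
proof -
  have "iexp u - iexp v = iexp v * (iexp (u - v) - 1)"
    by (simp add: exp_diff right_diff_distrib)
  then have "norm (iexp u - iexp v) = norm (iexp (u - v) - 1)"
    by (simp add: norm_mult)
  also have "\<dots> \<le> \<bar>u - v\<bar>"
    using iexp_approx1[of "u - v" 0] by simp
  finally show ?thesis .
qed

lemma continuous_on_fourier_integral:
  assumes g: "integrable lborel g"
  shows "continuous_on UNIV (fourier_integral g)"
proof (rule continuous_at_imp_continuous_on, intro ballI, unfold continuous_at_sequentially comp_def, intro allI impI)
  fix x and X :: "nat \<Rightarrow> real" assume X: "X \<longlonglongrightarrow> x"
  note [measurable] = borel_measurable_integrable[OF g]
  show "(\<lambda>n. fourier_integral g (X n)) \<longlonglongrightarrow> fourier_integral g x"
    unfolding fourier_integral_def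
  proof (rule integral_dominated_convergence[where w = "\<lambda>\<xi>. norm (g \<xi>)"])
    show "AE \<xi> in lborel. (\<lambda>n. iexp (X n * \<xi>) * g \<xi>) \<longlonglongrightarrow> iexp (x * \<xi>) * g \<xi>"
      by (intro AE_I2 tendsto_intros X)
  qed (use g in \<open>auto simp: norm_mult\<close>)
qed

text \<open>Difference quotients of the exponential in x are bounded by the modulus of the
  frequency, so the integrable first moment of \<open>g\<close> is a majorant and dominated
  convergence applies.\<close>

lemma fourier_integral_difference_quotient:
  assumes g: "integrable lborel g" and g': "integrable lborel (\<lambda>\<xi>. complex_of_real \<xi> * g \<xi>)"
  shows "((\<lambda>y. (fourier_integral g y - fourier_integral g x) / complex_of_real (y - x))
    \<longlongrightarrow> fourier_integral (\<lambda>\<xi>. \<i> * \<xi> * g \<xi>) x) (at x)"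
  unfolding tendsto_at_iff_sequentially comp_def
proof (intro allI impI)
  fix X :: "nat \<Rightarrow> real" assume X: "\<forall>n. X n \<in> UNIV - {x}" "X \<longlonglongrightarrow> x"
  then have Xn: "X n \<noteq> x" for n by auto
  note [measurable] = borel_measurable_integrable[OF g]
  have eq: "(fourier_integral g (X n) - fourier_integral g x) / complex_of_real (X n - x)
    = (LINT \<xi>|lborel. (iexp (X n * \<xi>) - iexp (x * \<xi>)) / complex_of_real (X n - x) * g \<xi>)" for n
    unfolding fourier_integral_def
    by (subst Bochner_Integration.integral_diff[symmetric])
      (use integrable_iexp_mult[OF g] in \<open>auto simp: left_diff_distrib simp flip: integral_divide_zero intro!: Bochner_Integration.integral_cong\<close>)
  show "(\<lambda>n. (fourier_integral g (X n) - fourier_integral g x) / complex_of_real (X n - x))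
    \<longlonglongrightarrow> fourier_integral (\<lambda>\<xi>. \<i> * \<xi> * g \<xi>) x"
    unfolding eq unfolding fourier_integral_def
  proof (rule integral_dominated_convergence[where w = "\<lambda>\<xi>. norm (complex_of_real \<xi> * g \<xi>)"])
    show "AE \<xi> in lborel. (\<lambda>n. (iexp (X n * \<xi>) - iexp (x * \<xi>)) / complex_of_real (X n - x) * g \<xi>)
      \<longlonglongrightarrow> iexp (x * \<xi>) * (\<i> * \<xi> * g \<xi>)"
    proof (intro AE_I2)
      fix \<xi> :: real
      have "((\<lambda>z. exp (\<i> * (z * \<xi>))) has_field_derivative \<i> * \<xi> * iexp (x * \<xi>)) (at (complex_of_real x))"
        by (auto intro!: derivative_eq_intros)
      then have "((\<lambda>z. (exp (\<i> * (z * \<xi>)) - iexp (x * \<xi>)) / (z - x)) \<longlongrightarrow> \<i> * \<xi> * iexp (x * \<xi>)) (at (complex_of_real x))"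
        by (simp add: has_field_derivative_iff)
      moreover have "(\<lambda>n. complex_of_real (X n)) \<longlonglongrightarrow> x"
        using X(2) by (intro tendsto_of_real)
      ultimately have "(\<lambda>n. (exp (\<i> * (complex_of_real (X n) * \<xi>)) - iexp (x * \<xi>)) / (complex_of_real (X n) - x)) \<longlonglongrightarrow> \<i> * \<xi> * iexp (x * \<xi>)"
        using Xn unfolding tendsto_at_iff_sequentially comp_def by auto
      from tendsto_mult[OF this tendsto_const[of "g \<xi>"]]
      show "(\<lambda>n. (iexp (X n * \<xi>) - iexp (x * \<xi>)) / complex_of_real (X n - x) * g \<xi>)
        \<longlonglongrightarrow> iexp (x * \<xi>) * (\<i> * \<xi> * g \<xi>)"
        by (simp add: mult_ac)
    qed
    show "AE \<xi> in lborel. norm ((iexp (X n * \<xi>) - iexp (x * \<xi>)) / complex_of_real (X n - x) * g \<xi>)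
        \<le> norm (complex_of_real \<xi> * g \<xi>)" for n
    proof (intro AE_I2)
      fix \<xi> :: real
      have "norm (iexp (X n * \<xi>) - iexp (x * \<xi>)) \<le> \<bar>X n * \<xi> - x * \<xi>\<bar>"
        by (rule norm_iexp_diff_le)
      also have "\<dots> = \<bar>X n - x\<bar> * \<bar>\<xi>\<bar>"
        by (simp add: abs_mult flip: left_diff_distrib)
      finally have "norm (iexp (X n * \<xi>) - iexp (x * \<xi>)) / \<bar>X n - x\<bar> \<le> \<bar>\<xi>\<bar>"
        using Xn[of n] by (simp add: pos_divide_le_eq mult.commute)
      from mult_right_mono[OF this norm_ge_zero[of "g \<xi>"]]
      show "norm ((iexp (X n * \<xi>) - iexp (x * \<xi>)) / complex_of_real (X n - x) * g \<xi>)
        \<le> norm (complex_of_real \<xi> * g \<xi>)"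
        unfolding norm_mult norm_divide norm_of_real .
    qed
    show "integrable lborel (\<lambda>\<xi>. norm (complex_of_real \<xi> * g \<xi>))"
      using g' by (rule integrable_norm)
  qed measurable
qed

text \<open>Taking the real part by definition replaces a proof that the transform of a real
  function has Hermitian symmetry.\<close>

definition inverse_fourier :: "(real \<Rightarrow> complex) \<Rightarrow> real \<Rightarrow> real" where
  "inverse_fourier g x = Re (fourier_integral g x) / sqrt (2 * pi)"

lemma has_field_derivative_inverse_fourier:
  assumes g: "integrable lborel g" and g': "integrable lborel (\<lambda>\<xi>. complex_of_real \<xi> * g \<xi>)"
  shows "(inverse_fourier g has_field_derivative inverse_fourier (\<lambda>\<xi>. \<i> * \<xi> * g \<xi>) x) (at x)"
proof -
  have "((\<lambda>y. Re ((fourier_integral g y - fourier_integral g x) / complex_of_real (y - x)) / sqrt (2 * pi))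
    \<longlongrightarrow> inverse_fourier (\<lambda>\<xi>. \<i> * \<xi> * g \<xi>) x) (at x)"
    unfolding inverse_fourier_def
    by (intro tendsto_intros fourier_integral_difference_quotient assms) auto
  then show ?thesis
    unfolding has_field_derivative_iff Re_divide_of_real minus_complex.sel
    by (simp add: inverse_fourier_def diff_divide_distrib mult.commute)
qed

lemma continuous_on_inverse_fourier:
  "integrable lborel g \<Longrightarrow> continuous_on UNIV (inverse_fourier g)"
  unfolding inverse_fourier_def[abs_def]
  by (intro continuous_intros continuous_on_fourier_integral) auto

lemma abs_inverse_fourier_le: "\<bar>inverse_fourier g x\<bar> \<le> (LINT \<xi>|lborel. norm (g \<xi>)) / sqrt (2 * pi)"
proof -
  have "\<bar>Re (fourier_integral g x)\<bar> \<le> (LINT \<xi>|lborel. norm (g \<xi>))"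
    using abs_Re_le_cmod norm_fourier_integral_le by (rule order_trans)
  then show ?thesis
    by (simp add: inverse_fourier_def divide_right_mono)
qed

lemma L2norm_inverse_fourier_le:
  assumes g: "integrable lborel g" and g2: "square_integrable g"
  shows "square_integrable (inverse_fourier g)" "L2norm (inverse_fourier g) \<le> L2norm g"
proof -
  note [measurable] = borel_measurable_integrable[OF g]
  note sq = square_integrable_scaleR[OF plancherel_le(1)[OF g g2], of "1 / sqrt (2 * pi)"]
  have meas: "inverse_fourier g \<in> borel_measurable borel"
    unfolding inverse_fourier_def[abs_def] by measurable
  have le: "AE x in lborel. norm (inverse_fourier g x) \<le> norm ((1 / sqrt (2 * pi)) *\<^sub>R fourier_integral g x)"
    by (intro AE_I2) (auto simp: inverse_fourier_def intro!: divide_right_mono abs_Re_le_cmod)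
  show "square_integrable (inverse_fourier g)"
    by (rule square_integrable_bound(1)[OF sq(1) meas le])
  have "L2norm (inverse_fourier g) \<le> \<bar>1 / sqrt (2 * pi)\<bar> * L2norm (fourier_integral g)"
    using square_integrable_bound(2)[OF sq(1) meas le] by (simp only: sq(2))
  also have "\<dots> \<le> \<bar>1 / sqrt (2 * pi)\<bar> * (sqrt (2 * pi) * L2norm g)"
    by (intro mult_left_mono plancherel_le(2) g g2) auto
  finally show "L2norm (inverse_fourier g) \<le> L2norm g"
    by simp
qed

text \<open>Cauchy-Schwarz against \<open>J\<close>, the weight to the power -1/2. It is in L2 with
  norm sqrt(pi), and this is why one extra power is demanded of the Sobolev index.\<close>

lemma weighted_integrable:
  assumes g: "g \<in> borel_measurable borel" and sq: "square_integrable (sobolev_weight \<sigma> g)" and k: "k + 1 \<le> \<sigma>"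
  shows "integrable lborel (\<lambda>\<xi>. (1 + \<xi>\<^sup>2) powr (k / 2) * norm (g \<xi>))"
    "(LINT \<xi>|lborel. (1 + \<xi>\<^sup>2) powr (k / 2) * norm (g \<xi>)) \<le> sqrt pi * L2norm (sobolev_weight \<sigma> g)"
proof -
  note [measurable] = g
  define J where "J \<xi> = (1 + \<xi>\<^sup>2) powr (- 1 / 2)" for \<xi> :: real
  have pos: "1 \<le> 1 + \<xi>\<^sup>2" for \<xi> :: real by simp
  have J2: "(norm (J \<xi>))\<^sup>2 = inverse (1 + \<xi>\<^sup>2)" for \<xi>
  proof -
    have "(norm (J \<xi>))\<^sup>2 = (1 + \<xi>\<^sup>2) powr (- 1 / 2 + - 1 / 2)"
      unfolding powr_add by (simp add: J_def power2_eq_square)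
    also have "\<dots> = inverse (1 + \<xi>\<^sup>2)"
      using pos[of \<xi>] by (simp add: powr_minus powr_one)
    finally show ?thesis .
  qed
  have [measurable]: "J \<in> borel_measurable borel"
    unfolding J_def[abs_def] by measurable
  have J: "square_integrable J" "L2norm J = sqrt pi"
    using has_bochner_integral_inverse_square
    by (auto simp: square_integrable_def L2norm_def J2 has_bochner_integral_iff simp del: real_norm_def)
  have le: "(1 + \<xi>\<^sup>2) powr (k / 2) * norm (g \<xi>) \<le> norm (J \<xi>) * norm (sobolev_weight \<sigma> g \<xi>)" for \<xi>
  proof -
    have "(1 + \<xi>\<^sup>2) powr (k / 2) = J \<xi> * (1 + \<xi>\<^sup>2) powr ((k + 1) / 2)"
      using pos[of \<xi>] by (simp add: J_def add_divide_distrib flip: powr_add)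
    also have "\<dots> \<le> J \<xi> * (1 + \<xi>\<^sup>2) powr (\<sigma> / 2)"
      using pos[of \<xi>] k by (intro mult_left_mono powr_mono) (auto simp: J_def)
    finally have "(1 + \<xi>\<^sup>2) powr (k / 2) * norm (g \<xi>) \<le> J \<xi> * (1 + \<xi>\<^sup>2) powr (\<sigma> / 2) * norm (g \<xi>)"
      by (intro mult_right_mono) auto
    then show ?thesis
      by (simp add: sobolev_weight_def norm_mult J_def)
  qed
  note prod = square_integrable_mult[OF J(1) sq]
  show int: "integrable lborel (\<lambda>\<xi>. (1 + \<xi>\<^sup>2) powr (k / 2) * norm (g \<xi>))"
    by (rule Bochner_Integration.integrable_bound[OF prod(1)]) (use le in \<open>auto simp: abs_mult\<close>)
  have "(LINT \<xi>|lborel. (1 + \<xi>\<^sup>2) powr (k / 2) * norm (g \<xi>)) \<le> (LINT \<xi>|lborel. norm (J \<xi>) * norm (sobolev_weight \<sigma> g \<xi>))"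
    by (intro integral_mono int prod(1) le)
  also have "\<dots> \<le> sqrt pi * L2norm (sobolev_weight \<sigma> g)"
    using prod(2) J(2) by simp
  finally show "(LINT \<xi>|lborel. (1 + \<xi>\<^sup>2) powr (k / 2) * norm (g \<xi>)) \<le> sqrt pi * L2norm (sobolev_weight \<sigma> g)" .
qed

lemma moment_integrable:
  assumes g: "g \<in> borel_measurable borel" and sq: "square_integrable (sobolev_weight \<sigma> g)" and k: "real k + 1 \<le> \<sigma>"
  shows "integrable lborel (\<lambda>\<xi>. complex_of_real \<xi> ^ k * g \<xi>)"
    "(LINT \<xi>|lborel. norm (complex_of_real \<xi> ^ k * g \<xi>)) \<le> sqrt pi * L2norm (sobolev_weight \<sigma> g)"
proof -
  note [measurable] = g
  note w = weighted_integrable[OF g sq k]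
  have le: "norm (complex_of_real \<xi> ^ k * g \<xi>) \<le> (1 + \<xi>\<^sup>2) powr (k / 2) * norm (g \<xi>)" for \<xi>
  proof -
    have "\<bar>\<xi>\<bar> \<le> (1 + \<xi>\<^sup>2) powr (1 / 2)"
      by (simp add: powr_half_sqrt real_le_rsqrt)
    then have "\<bar>\<xi>\<bar> ^ k \<le> ((1 + \<xi>\<^sup>2) powr (1 / 2)) ^ k"
      by (intro power_mono) auto
    also have "\<dots> = (1 + \<xi>\<^sup>2) powr (k / 2)"
      by (subst powr_power) (auto simp: add_nonneg_eq_0_iff)
    finally show ?thesis
      by (simp add: norm_mult norm_power mult_right_mono)
  qed
  show int: "integrable lborel (\<lambda>\<xi>. complex_of_real \<xi> ^ k * g \<xi>)"
    by (rule Bochner_Integration.integrable_bound[OF w(1)]) (use le in auto)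
  show "(LINT \<xi>|lborel. norm (complex_of_real \<xi> ^ k * g \<xi>)) \<le> sqrt pi * L2norm (sobolev_weight \<sigma> g)"
    by (rule order_trans[OF integral_mono w(2)]) (use w(1) int le in auto)
qed

text \<open>\<open>F\<close> is the inverse transform of the Fourier transform of \<open>f\<close>.
  The moments of order 0 and 1 need index 2, and the moment of order 2 for the last item needs index
  3. Agreement with \<open>f\<close> is recorded through integrals over intervals, the form in which
  the inversion theorem is available.\<close>

lemma sobolev_C1_representative:
  assumes f: "f \<in> sobolev \<sigma>" and \<sigma>: "2 \<le> \<sigma>"
  obtains F F' where
    "\<And>a b. a \<le> b \<Longrightarrow> (LINT x|lborel. indicator {a..b} x * F x) = (LINT x|lborel. indicator {a..b} x * f x)"
    "\<And>x. (F has_field_derivative F' x) (at x)" "continuous_on UNIV F'"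
    "\<And>x. \<bar>F x\<bar> \<le> sobolev_norm \<sigma> f" "\<And>x. \<bar>F' x\<bar> \<le> sobolev_norm \<sigma> f"
    "square_integrable F" "L2norm F \<le> sobolev_norm \<sigma> f"
    "3 \<le> \<sigma> \<Longrightarrow> \<exists>F''. \<forall>x. (F' has_field_derivative F'' x) (at x)"
proof -
  from f obtain g where fg: "has_fourier_transform f g" and sq: "square_integrable (sobolev_weight \<sigma> g)"
    by (auto simp: sobolev_def)
  note m [measurable] = has_fourier_transform_measurable(1,2)[OF fg]
  note g2 = has_fourier_transform_measurable(4)[OF fg]
  define N where "N = L2norm (sobolev_weight \<sigma> g)"
  have N: "sobolev_norm \<sigma> f = N"
    unfolding N_def by (rule sobolev_norm_eq[OF fg])
  have N0: "0 \<le> N" by (simp add: N_def)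
  have g0: "integrable lborel g" "(LINT \<xi>|lborel. norm (g \<xi>)) \<le> sqrt pi * N"
    using moment_integrable[OF m(2) sq, of 0] \<sigma> by (auto simp: N_def)
  have g1: "integrable lborel (\<lambda>\<xi>. complex_of_real \<xi> * g \<xi>)" "(LINT \<xi>|lborel. norm (complex_of_real \<xi> * g \<xi>)) \<le> sqrt pi * N"
    using moment_integrable[OF m(2) sq, of 1] \<sigma> by (auto simp: N_def)
  let ?g1 = "\<lambda>\<xi>. \<i> * complex_of_real \<xi> * g \<xi>"
  have ig1: "integrable lborel ?g1"
    using integrable_mult_right[OF g1(1), of \<i>] by (simp add: mult.assoc)
  \<comment> \<open>The embedding constant is 1/sqrt 2, below 1, so the Sobolev norm itself bounds
    the values of \<open>F\<close> and \<open>F'\<close>.\<close>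
  have half: "sqrt pi * N / sqrt (2 * pi) \<le> N"
    using N0 mult_left_mono[of 1 "sqrt 2" N] by (simp add: real_sqrt_mult pos_divide_le_eq)
  show thesis
  proof
    show "(LINT x|lborel. indicator {a..b} x * inverse_fourier g x) = (LINT x|lborel. indicator {a..b} x * f x)"
      if "a \<le> b" for a b
    proof -
      have "complex_of_real (LINT x|lborel. indicator {a..b} x * f x)
        = (LINT x|lborel. indicator {a..b} x *\<^sub>R fourier_integral g x) / sqrt (2 * pi)"
        by (simp add: fourier_inversion_box[OF fg g0(1) that])
      then have "(LINT x|lborel. indicator {a..b} x * f x)
        = Re (LINT x|lborel. indicator {a..b} x *\<^sub>R fourier_integral g x) / sqrt (2 * pi)"
        by (metis Re_complex_of_real Re_divide_of_real)
      also have "Re (LINT x|lborel. indicator {a..b} x *\<^sub>R fourier_integral g x)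
        = (LINT x|lborel. Re (indicator {a..b} x *\<^sub>R fourier_integral g x))"
      proof (rule integral_Re[symmetric])
        show "integrable lborel (\<lambda>x. indicator {a..b} x *\<^sub>R fourier_integral g x)"
          using borel_integrable_compact[of "{a..b}" "fourier_integral g"] continuous_on_subset[OF continuous_on_fourier_integral[OF g0(1)]]
          by (simp add: indicator_scaleR_eq_if)
      qed
      also have "(LINT x|lborel. Re (indicator {a..b} x *\<^sub>R fourier_integral g x)) / sqrt (2 * pi) 
          = (LINT x|lborel. indicator {a..b} x * inverse_fourier g x)"
        by (simp add: inverse_fourier_def flip: integral_divide_zero)
      finally show ?thesis by simp
    qed
    show "(inverse_fourier g has_field_derivative inverse_fourier ?g1 x) (at x)" for x
      by (rule has_field_derivative_inverse_fourier[OF g0(1) g1(1)])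
    show "continuous_on UNIV (inverse_fourier ?g1)"
      by (rule continuous_on_inverse_fourier[OF ig1])
    show "\<bar>inverse_fourier g x\<bar> \<le> sobolev_norm \<sigma> f" for x
      unfolding N using half divide_right_mono[OF g0(2), of "sqrt (2 * pi)"]
      by (intro order_trans[OF abs_inverse_fourier_le]) simp
    show "\<bar>inverse_fourier ?g1 x\<bar> \<le> sobolev_norm \<sigma> f" for x
      unfolding N using half divide_right_mono[OF g1(2), of "sqrt (2 * pi)"]
      by (intro order_trans[OF abs_inverse_fourier_le]) (simp add: norm_mult)
    show "square_integrable (inverse_fourier g)"
      by (rule L2norm_inverse_fourier_le[OF g0(1) g2])
    have "L2norm g \<le> L2norm (sobolev_weight \<sigma> g)"
    proof (rule square_integrable_bound(2)[OF sq])
      have "1 \<le> (1 + \<xi>\<^sup>2) powr (\<sigma> / 2)" for \<xi> :: real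
        using \<sigma> by (intro ge_one_powr_ge_zero) auto
      then show "AE \<xi> in lborel. norm (g \<xi>) \<le> norm (sobolev_weight \<sigma> g \<xi>)"
        by (auto simp: sobolev_weight_def norm_mult mult_le_cancel_right1 not_le intro!: AE_I2)
    qed auto
    then show "L2norm (inverse_fourier g) \<le> sobolev_norm \<sigma> f"
      unfolding N N_def using L2norm_inverse_fourier_le(2)[OF g0(1) g2] by simp
    show "\<exists>F''. \<forall>x. (inverse_fourier ?g1 has_field_derivative F'' x) (at x)" if "3 \<le> \<sigma>"
    proof -
      have "integrable lborel (\<lambda>\<xi>. complex_of_real \<xi> ^ 2 * g \<xi>)"
        using moment_integrable[OF m(2) sq, of 2] that by auto
      from integrable_mult_right[OF this, of \<i>]
      have "integrable lborel (\<lambda>\<xi>. complex_of_real \<xi> * ?g1 \<xi>)"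
        by (simp add: power2_eq_square mult_ac)
      then show ?thesis
        using has_field_derivative_inverse_fourier[OF ig1] by blast
    qed
  qed
qed

section \<open>The exponential kernel\<close>

(* The convolution of f with exp(-b|x|) is half_conv b f + half_conv' b f; each half solves a
   first-order linear differential equation. *)
definition half_conv :: "real \<Rightarrow> (real \<Rightarrow> real) \<Rightarrow> real \<Rightarrow> real" where
  "half_conv b f x = (LINT y|lborel. indicator {..x} y * exp (- b * (x - y)) * f y)"

definition half_conv' :: "real \<Rightarrow> (real \<Rightarrow> real) \<Rightarrow> real \<Rightarrow> real" where
  "half_conv' b f x = (LINT y|lborel. indicator {x..} y * exp (- b * (y - x)) * f y)"

text \<open>This reflection reduces statements about the right half to those about the left
  half.\<close>

lemma half_conv'_eq: "half_conv' b f x = half_conv b (\<lambda>y. f (- y)) (- x)"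
  unfolding half_conv'_def half_conv_def
  by (subst integral_lborel_uminus[symmetric]) (auto intro!: Bochner_Integration.integral_cong simp: indicator_def)

lemma has_bochner_integral_exp_half:
  assumes b: "0 < (b::real)"
  shows "has_bochner_integral lborel (\<lambda>y. indicator {..x} y * exp (- b * (x - y))) (1 / b)"
proof -
  have lim: "((\<lambda>z. - exp (- (b * z)) / b) \<longlongrightarrow> 0) at_top"
  proof -
    have "filterlim (\<lambda>z. - (b * z)) at_bot at_top"
      using b by (simp add: filterlim_uminus_at_bot filterlim_tendsto_pos_mult_at_top[OF tendsto_const] filterlim_ident)
    from tendsto_mult[OF filterlim_compose[OF exp_at_bot this] tendsto_const[of "- 1 / b"]]
    show ?thesis by simp
  qed
  have "(\<integral>\<^sup>+z. ennreal (exp (- (b * z))) * indicator {0..} z \<partial>lborel) = ennreal (0 - (- exp (- (b * 0)) / b))"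
    by (rule nn_integral_FTC_atLeast[OF _ _ _ lim]) (use b in \<open>auto intro!: derivative_eq_intros\<close>)
  then have "has_bochner_integral lborel (\<lambda>z. indicator {0..} z * exp (- (b * z))) (1 / b)"
    using b by (intro has_bochner_integral_nn_integral)
      (auto intro!: nn_integral_cong simp: indicator_def elim!: trans[rotated])
  then have "has_bochner_integral lborel (\<lambda>y. indicator {0..} (x + -1 * y) * exp (- (b * (x + -1 * y)))) ((1 / b) /\<^sub>R \<bar>-1\<bar>)"
    by (subst (asm) lborel_has_bochner_integral_real_affine_iff[of "-1" _ _ x]) auto
  moreover have "indicator {0..} (x + -1 * y) * exp (- (b * (x + -1 * y))) = indicator {..x} y * exp (- b * (x - y))" for y
    by (auto simp: indicator_def)
  ultimately show ?thesis by simp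
qed

lemma integrable_half_conv:
  fixes f :: "real \<Rightarrow> real"
  assumes b: "0 < b" and [measurable]: "f \<in> borel_measurable borel" and f: "\<And>y. \<bar>f y\<bar> \<le> M"
  shows "integrable lborel (\<lambda>y. indicator {..x} y * exp (- b * (x - y)) * f y)"
    "integrable lborel (\<lambda>y. indicator {x..} y * exp (- b * (y - x)) * f y)"
proof -
  have *: "integrable lborel (\<lambda>y. indicator {..x} y * exp (- b * (x - y)) * f y)"
    if [measurable]: "f \<in> borel_measurable borel" and f: "\<And>y. \<bar>f y\<bar> \<le> M" for f x
  proof (rule Bochner_Integration.integrable_bound)
    show "integrable lborel (\<lambda>y. indicator {..x} y * exp (- b * (x - y)) * M)"
      using has_bochner_integral_exp_half[OF b, of x] by (auto simp: has_bochner_integral_iff)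
  qed (use f in \<open>auto simp: abs_mult indicator_def intro: order_trans[OF _ abs_ge_self]\<close>)
  show "integrable lborel (\<lambda>y. indicator {..x} y * exp (- b * (x - y)) * f y)"
    by (rule *) (use f in auto)
  have "integrable lborel (\<lambda>y. indicator {..-x} y * exp (- b * (-x - y)) * f (- y))"
    by (rule *) (use f in auto)
  from lborel_integrable_real_affine[OF this, of "-1" 0]
  show "integrable lborel (\<lambda>y. indicator {x..} y * exp (- b * (y - x)) * f y)"
    by (simp add: indicator_def algebra_simps)
qed

text \<open>Multiplication by the integrating factor exp(b z) turns the left half into the primitive
  \<open>G\<close> of exp(b y) f(y), to which the fundamental theorem of calculus applies.\<close>

lemma half_conv_has_derivative:
  assumes b: "0 < b" and cf: "continuous_on UNIV f" and f: "\<And>y. \<bar>f y\<bar> \<le> M"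
  shows "(half_conv b f has_field_derivative f x - b * half_conv b f x) (at x)"
proof -
  have [measurable]: "f \<in> borel_measurable borel"
    using cf by (rule borel_measurable_continuous_onI)
  define k where "k y = exp (b * y) * f y" for y
  have ck: "continuous_on UNIV k"
    unfolding k_def by (intro continuous_intros cf)
  define G where "G z = exp (b * z) * half_conv b f z" for z
  have Geq: "G z = (LINT y|lborel. indicator {..z} y * k y)" for z
    unfolding G_def half_conv_def k_def
    by (subst integral_mult_right_zero[symmetric])
      (auto intro!: Bochner_Integration.integral_cong simp: indicator_def algebra_simps exp_diff exp_minus field_simps)
  have kint: "integrable lborel (\<lambda>y. indicator {..z} y * k y)" for z
  proof -
    have "integrable lborel (\<lambda>y. exp (b * z) * (indicator {..z} y * exp (- b * (z - y)) * f y))"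
      using integrable_half_conv(1)[OF b _ f, where x = z] by simp
    moreover have "exp (b * z) * (indicator {..z} y * exp (- b * (z - y)) * f y) = indicator {..z} y * k y" for y
      by (auto simp: indicator_def k_def algebra_simps exp_diff exp_minus field_simps)
    ultimately show ?thesis by (simp only:)
  qed
  \<comment> \<open>Splitting the integral at a finite point left of x leaves a constant plus an
    integral over a compact interval with x in its interior.\<close>
  define a where "a = x - 1"
  have "((\<lambda>z. integral {a..z} k) has_vector_derivative k x) (at x within {a..x+1})"
    by (rule integral_has_vector_derivative) (auto simp: a_def intro: continuous_on_subset[OF ck])
  moreover have "at x within {a..x+1} = at x"
    by (rule at_within_interior) (auto simp: a_def)
  ultimately have D: "((\<lambda>z. G a + integral {a..z} k) has_field_derivative k x) (at x)"
    by (auto simp: has_real_derivative_iff_has_vector_derivative intro!: derivative_eq_intros)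
  have GD: "(G has_field_derivative k x) (at x)"
  proof (rule has_field_derivative_transform_within_open[OF D, of "{a<..}"])
    fix z assume z: "z \<in> {a<..}"
    have k_on: "set_integrable lborel {a..z} k"
      unfolding set_integrable_def
      using borel_integrable_compact[of "{a..z}" k] continuous_on_subset[OF ck]
      by (simp add: indicator_scaleR_eq_if)
    have "G z = (LINT y|lborel. indicator {..a} y * k y + indicator {a..z} y * k y)"
      unfolding Geq
    proof (rule integral_cong_AE)
      have "AE y in lborel. y \<noteq> a" by (rule AE_lborel_singleton)
      then show "AE y in lborel. indicator {..z} y * k y = indicator {..a} y * k y + indicator {a..z} y * k y"
        by eventually_elim (use z in \<open>auto simp: indicator_def\<close>)
    qed (auto simp: k_def[abs_def])
    also have "\<dots> = G a + (LINT y|lborel. indicator {a..z} y * k y)"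
      unfolding Geq using kint k_on by (intro Bochner_Integration.integral_add) (auto simp: set_integrable_def)
    also have "(LINT y|lborel. indicator {a..z} y * k y) = integral {a..z} k"
      using set_borel_integral_eq_integral(2)[OF k_on] by (simp add: set_lebesgue_integral_def)
    finally show "G a + integral {a..z} k = G z" by simp
  qed (auto simp: a_def)
  have "((\<lambda>z. exp (- (b * z)) * G z) has_field_derivative f x - b * half_conv b f x) (at x)"
    by (rule derivative_eq_intros GD refl | simp)+ (simp add: G_def k_def exp_minus field_simps)
  moreover have "(\<lambda>z. exp (- (b * z)) * G z) = half_conv b f"
    by (auto simp: G_def exp_minus)
  ultimately show ?thesis by simp
qed

text \<open>Integration by parts on the half-line: the boundary term at x is f(x), and the one at
  minus infinity vanishes because \<open>f\<close> is bounded and the exponential decays.\<close>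

lemma half_conv_deriv:
  assumes b: "0 < b" and f': "\<And>y. (f has_field_derivative f' y) (at y)" and cf': "continuous_on UNIV f'"
    and f: "\<And>y. \<bar>f y\<bar> \<le> M" and fM: "\<And>y. \<bar>f' y\<bar> \<le> M'"
  shows "half_conv b f' x = f x - b * half_conv b f x"
proof -
  have cf: "continuous_on UNIV f"
    using f' by (auto intro!: DERIV_isCont simp: continuous_on_eq_continuous_at)
  have [measurable]: "f \<in> borel_measurable borel" "f' \<in> borel_measurable borel"
    using cf cf' by (auto intro: borel_measurable_continuous_onI)
  define F where "F y = exp (- b * (x - y)) * f y" for y
  define k where "k y = exp (- b * (x - y)) * f' y + b * (exp (- b * (x - y)) * f y)" for y
  have int: "integrable lborel (\<lambda>y. indicator {..x} y * exp (- b * (x - y)) * f' y)"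
    "integrable lborel (\<lambda>y. b * (indicator {..x} y * exp (- b * (x - y)) * f y))"
    using integrable_half_conv(1)[OF b _ f] integrable_half_conv(1)[OF b _ fM] by auto
  have "half_conv b f' x + b * half_conv b f x = (LINT y|lborel. indicator {..x} y * exp (- b * (x - y)) * f' y
      + b * (indicator {..x} y * exp (- b * (x - y)) * f y))"
    using int by (subst Bochner_Integration.integral_add) (auto simp: half_conv_def)
  also have "\<dots> = (LINT y|lborel. indicator {..x} y *\<^sub>R k y)"
    by (intro Bochner_Integration.integral_cong) (auto simp: k_def indicator_def)
  also have "\<dots> = (LINT y|lborel. indicator {..<x} y *\<^sub>R k y)"
  proof (rule integral_cong_AE)
    have "AE y in lborel. y \<noteq> x" by (rule AE_lborel_singleton)
    then show "AE y in lborel. indicator {..x} y *\<^sub>R k y = indicator {..<x} y *\<^sub>R k y"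
      by eventually_elim (auto simp: indicator_def)
  qed (auto simp: k_def[abs_def])
  also have "\<dots> = (LBINT y=-\<infinity>..x. k y)"
    by (simp add: interval_lebesgue_integral_def set_lebesgue_integral_def)
  also have "\<dots> = f x - 0"
  proof (rule interval_integral_FTC_integrable)
    show "(F has_vector_derivative k y) (at y)" for y
      unfolding F_def k_def has_real_derivative_iff_has_vector_derivative[symmetric]
      by (rule derivative_eq_intros f' refl | simp)+
    show "isCont k y" for y
      using cf cf' unfolding k_def by (intro continuous_intros) (auto simp: continuous_on_eq_continuous_at)
    have "integrable lborel (\<lambda>y. indicator {..x} y *\<^sub>R k y)"
      using Bochner_Integration.integrable_add[OF int] by (simp add: k_def algebra_simps)
    then have "set_integrable lborel {..x} k"
      by (simp add: set_integrable_def)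
    then have "set_integrable lborel {..<x} k"
      by (rule set_integrable_subset) auto
    then show "set_integrable lborel (einterval (-\<infinity>) (ereal x)) k"
      by simp
    have "isCont F x"
      using cf unfolding F_def by (intro continuous_intros) (auto simp: continuous_on_eq_continuous_at)
    then have "(F \<longlongrightarrow> F x) (at_left x)"
      by (auto simp: isCont_def intro: tendsto_within_subset)
    then show "((F \<circ> real_of_ereal) \<longlongrightarrow> f x) (at_left (ereal x))"
      by (simp add: ereal_tendsto_simps F_def)
    have "((\<lambda>y. exp (- b * (x - y)) * M) \<longlongrightarrow> 0) at_bot"
    proof -
      have "((\<lambda>y. exp (- b * x + b * y)) \<longlongrightarrow> 0) at_bot"
        using b by (intro filterlim_compose[OF exp_at_bot] filterlim_tendsto_add_at_bot_iff[OF tendsto_const, THEN iffD2]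
          filterlim_tendsto_pos_mult_at_bot[OF tendsto_const] filterlim_ident)
      from tendsto_mult[OF this tendsto_const[of M]] show ?thesis
        by (simp add: algebra_simps)
    qed
    then have "(F \<longlongrightarrow> 0) at_bot"
      by (rule Lim_null_comparison[rotated]) (use f in \<open>auto simp: F_def abs_mult intro!: always_eventually\<close>)
    then show "((F \<circ> real_of_ereal) \<longlongrightarrow> 0) (at_right (-\<infinity>))"
      by (simp add: ereal_tendsto_simps)
  qed simp
  finally show ?thesis by simp
qed

lemma half_conv'_has_derivative:
  assumes b: "0 < b" and cf: "continuous_on UNIV f" and f: "\<And>y. \<bar>f y\<bar> \<le> M"
  shows "(half_conv' b f has_field_derivative - f x + b * half_conv' b f x) (at x)"
proof -
  have cg: "continuous_on UNIV (\<lambda>y. f (- y))"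
    by (rule continuous_on_compose2[OF cf]) (auto intro!: continuous_intros)
  have "((\<lambda>x. half_conv b (\<lambda>y. f (- y)) (- x)) has_field_derivative
      (f (- (- x)) - b * half_conv b (\<lambda>y. f (- y)) (- x)) * (- 1)) (at x)"
    by (rule DERIV_chain2[OF half_conv_has_derivative[OF b cg f]]) (auto intro!: derivative_eq_intros)
  then show ?thesis
    by (simp add: half_conv'_eq[abs_def])
qed

lemma half_conv'_deriv:
  assumes b: "0 < b" and f': "\<And>y. (f has_field_derivative f' y) (at y)" and cf': "continuous_on UNIV f'"
    and f: "\<And>y. \<bar>f y\<bar> \<le> M" and fM: "\<And>y. \<bar>f' y\<bar> \<le> M'"
  shows "half_conv' b f' x = - f x + b * half_conv' b f x"
proof -
  have "half_conv b (\<lambda>y. - f' (- y)) (- x) = f (- (- x)) - b * half_conv b (\<lambda>y. f (- y)) (- x)"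
  proof (rule half_conv_deriv[OF b])
    show "((\<lambda>y. f (- y)) has_field_derivative - f' (- y)) (at y)" for y
    proof -
      have "((\<lambda>y. f (- y)) has_field_derivative f' (- y) * - 1) (at y)"
        by (rule DERIV_chain2[of f, OF f']) (auto intro!: derivative_eq_intros)
      then show ?thesis by simp
    qed
    show "continuous_on UNIV (\<lambda>y. - f' (- y))"
      by (intro continuous_intros continuous_on_compose2[OF cf']) auto
  qed (use f fM in auto)
  then show ?thesis
    by (simp add: half_conv'_eq half_conv_def)
qed

section \<open>The two-sided kernel: splitting, L2 bounds and symmetry\<close>

lemma exp_kernel_split:
  fixes f :: "real \<Rightarrow> real"
  assumes b: "0 < b" and [measurable]: "f \<in> borel_measurable borel" and f: "\<And>y. \<bar>f y\<bar> \<le> M"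
  shows "has_bochner_integral lborel (\<lambda>y. exp (- b * \<bar>x - y\<bar>) * f y) (half_conv b f x + half_conv' b f x)"
proof -
  have "has_bochner_integral lborel (\<lambda>y. indicator {..x} y * exp (- b * (x - y)) * f y
      + indicator {x..} y * exp (- b * (y - x)) * f y) (half_conv b f x + half_conv' b f x)"
    unfolding half_conv_def half_conv'_def
    using integrable_half_conv[OF b _ f]
    by (intro has_bochner_integral_add has_bochner_integral_integrable) auto
  moreover have "AE y in lborel. indicator {..x} y * exp (- b * (x - y)) * f y
      + indicator {x..} y * exp (- b * (y - x)) * f y = exp (- b * \<bar>x - y\<bar>) * f y"
  proof -
    have "AE y in lborel. y \<noteq> x" by (rule AE_lborel_singleton)
    then show ?thesis by eventually_elim (auto simp: indicator_def)
  qed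
  ultimately show ?thesis
    by (subst (asm) has_bochner_integral_cong_AE) auto
qed

text \<open>The square of the kernel is the kernel with 2 b in place of b, and each of its halves
  has integral 1/(2 b).\<close>

lemma L2norm_exp_kernel:
  assumes b: "0 < b"
  shows "square_integrable (\<lambda>y. exp (- b * \<bar>x - y\<bar>))" "L2norm (\<lambda>y. exp (- b * \<bar>x - y\<bar>)) = 1 / sqrt b"
proof -
  have 2: "0 < 2 * b" using b by simp
  have h1: "half_conv (2 * b) (\<lambda>y. 1) z = 1 / (2 * b)" for z
    using has_bochner_integral_exp_half[OF 2, of z] by (simp add: half_conv_def has_bochner_integral_iff)
  have "has_bochner_integral lborel (\<lambda>y. exp (- (2 * b) * \<bar>x - y\<bar>) * 1) (half_conv (2 * b) (\<lambda>y. 1) x + half_conv' (2 * b) (\<lambda>y. 1) x)"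
    by (rule exp_kernel_split[OF 2, where M = 1]) auto
  then have *: "has_bochner_integral lborel (\<lambda>y. (norm (exp (- b * \<bar>x - y\<bar>)))\<^sup>2) (1 / b)"
    by (simp add: h1 half_conv'_eq power2_eq_square mult.assoc flip: exp_add)
  then show "square_integrable (\<lambda>y. exp (- b * \<bar>x - y\<bar>))"
    by (simp add: square_integrable_def has_bochner_integral_iff)
  show "L2norm (\<lambda>y. exp (- b * \<bar>x - y\<bar>)) = 1 / sqrt b"
    using * by (simp add: L2norm_def has_bochner_integral_iff real_sqrt_divide del: real_norm_def)
qed

text \<open>Cauchy-Schwarz for the absolute value of \<open>f\<close>. Bounding the sum of the
  absolute values controls the difference of the halves, which drives u along a characteristic, and
  also their sum, which enters the slope equation, with the same constant.\<close>

lemma abs_half_conv_le: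
  assumes b: "0 < b" and sq: "square_integrable f" and f: "\<And>y. \<bar>f y\<bar> \<le> M"
  shows "\<bar>half_conv b f x\<bar> + \<bar>half_conv' b f x\<bar> \<le> L2norm f / sqrt b"
proof -
  note [measurable] = square_integrable_measurable[OF sq]
  have "\<bar>half_conv b f x\<bar> \<le> half_conv b (\<lambda>y. \<bar>f y\<bar>) x" "\<bar>half_conv' b f x\<bar> \<le> half_conv' b (\<lambda>y. \<bar>f y\<bar>) x"
    unfolding half_conv_def half_conv'_def
    by (rule order_trans[OF integral_abs_bound], simp add: abs_mult)+
  then have "\<bar>half_conv b f x\<bar> + \<bar>half_conv' b f x\<bar> \<le> half_conv b (\<lambda>y. \<bar>f y\<bar>) x + half_conv' b (\<lambda>y. \<bar>f y\<bar>) x"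
    by simp
  also have "\<dots> = (LINT y|lborel. norm (exp (- b * \<bar>x - y\<bar>)) * norm (f y))"
    using exp_kernel_split[OF b, of "\<lambda>y. \<bar>f y\<bar>" M x] f by (auto simp: has_bochner_integral_iff)
  also have "\<dots> \<le> L2norm f / sqrt b"
    using square_integrable_mult(2)[OF L2norm_exp_kernel(1)[OF b, of x] sq] by (simp add: L2norm_exp_kernel(2)[OF b, simplified] del: norm_exp)
  finally show ?thesis .
qed

text \<open>With the one-sided kernel \<open>K\<close> the halves have kernels K(x - y) and K(y -
  x), hence are adjoint to each other; Fubini is justified by
  \<open>nn_integral_convolution_form_le\<close>. Consequently the nonlocal term drops out of the
  energy balance.\<close>

lemma half_conv_symmetric:
  assumes b: "0 < b" and sq: "square_integrable f"
  shows "integrable lborel (\<lambda>x. f x * half_conv b f x)" "integrable lborel (\<lambda>x. f x * half_conv' b f x)"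
    "(LINT x|lborel. f x * half_conv b f x) = (LINT x|lborel. f x * half_conv' b f x)"
proof -
  note [measurable] = square_integrable_measurable[OF sq]
  define K where "K z = indicator {0..} z * exp (- b * z)" for z :: real
  have [measurable]: "K \<in> borel_measurable borel"
    unfolding K_def[abs_def] by measurable
  have K0: "0 \<le> K z" for z by (simp add: K_def)
  have K: "indicator {..x} y * exp (- b * (x - y)) = K (x - y)" for x y :: real
    by (auto simp: K_def indicator_def)
  have K': "indicator {x..} y * exp (- b * (y - x)) = K (y - x)" for x y :: real
    by (auto simp: K_def indicator_def)
  have "(\<integral>\<^sup>+z. ennreal (K z) \<partial>lborel) = (\<integral>\<^sup>+y. ennreal (K (0 - y)) \<partial>lborel)"
    by (rule nn_integral_lborel_translate(1)[symmetric]) simp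
  also have "\<dots> = ennreal (1 / b)"
    unfolding K[symmetric] using has_bochner_integral_exp_half[OF b, of 0] nn_integral_eq_integral
    by (subst nn_integral_eq_integral) (auto simp: has_bochner_integral_iff)
  finally have KI: "(\<integral>\<^sup>+z. ennreal (K z) \<partial>lborel) < \<infinity>" by simp
  have int: "integrable (lborel \<Otimes>\<^sub>M lborel) (\<lambda>(x, y). f x * (K (x - y) * f y))"
  proof (subst integrable_iff_bounded, intro conjI)
    have "(\<integral>\<^sup>+p. ennreal (norm (case p of (x, y) \<Rightarrow> f x * (K (x - y) * f y))) \<partial>(lborel \<Otimes>\<^sub>M lborel))
      = (\<integral>\<^sup>+x. \<integral>\<^sup>+y. ennreal (\<bar>f x\<bar> * \<bar>f y\<bar> * K (x - y)) \<partial>lborel \<partial>lborel)"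
      by (subst lborel.nn_integral_fst[symmetric]) (auto simp: abs_mult K0 mult_ac)
    also have "\<dots> \<le> (\<integral>\<^sup>+x. ennreal (\<bar>f x\<bar>\<^sup>2) \<partial>lborel) * (\<integral>\<^sup>+x. ennreal (K x) \<partial>lborel)"
      by (rule nn_integral_convolution_form_le) (auto simp: K0)
    also have "\<dots> < \<infinity>"
      using sq KI by (simp add: square_integrable_iff_nn ennreal_mult_less_top)
    finally show "(\<integral>\<^sup>+p. ennreal (norm (case p of (x, y) \<Rightarrow> f x * (K (x - y) * f y))) \<partial>(lborel \<Otimes>\<^sub>M lborel)) < \<infinity>" .
  qed measurable
  have 1: "f x * half_conv b f x = (LINT y|lborel. f x * (K (x - y) * f y))" for x
    unfolding half_conv_def K by simp
  have 2: "f y * half_conv' b f y = (LINT x|lborel. f x * (K (x - y) * f y))" for y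
    unfolding half_conv'_def K' by (subst integral_mult_right_zero[symmetric]) (simp add: mult_ac)
  show "integrable lborel (\<lambda>x. f x * half_conv b f x)"
    unfolding 1 using lborel_pair.integrable_fst'[OF int] by simp
  show "integrable lborel (\<lambda>x. f x * half_conv' b f x)"
    unfolding 2 using lborel_pair.integrable_snd[OF int] by simp
  show "(LINT x|lborel. f x * half_conv b f x) = (LINT x|lborel. f x * half_conv' b f x)"
    unfolding 1 2 using lborel_pair.Fubini_integral[OF int] by simp
qed

(* Tested against exp(-b|y|), the integral of f' is of order b; let b tend to 0. *)
lemma integral_derivative_eq_0:
  fixes f f' :: "real \<Rightarrow> real"
  assumes f': "\<And>y. (f has_field_derivative f' y) (at y)" and cf': "continuous_on UNIV f'"
    and f: "\<And>y. \<bar>f y\<bar> \<le> M" and fM: "\<And>y. \<bar>f' y\<bar> \<le> M'"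
    and int: "integrable lborel f" and int': "integrable lborel f'"
  shows "(LINT x|lborel. f' x) = 0"
proof -
  note [measurable] = borel_measurable_integrable[OF int] borel_measurable_integrable[OF int']
  let ?b = "\<lambda>n. inverse (real (Suc n))"
  define I where "I n = (LINT y|lborel. exp (- ?b n * \<bar>0 - y\<bar>) * f' y)" for n
  have "I \<longlonglongrightarrow> (LINT y|lborel. f' y)"
    unfolding I_def
  proof (rule integral_dominated_convergence[where w = "\<lambda>y. norm (f' y)"])
    show "AE y in lborel. (\<lambda>n. exp (- ?b n * \<bar>0 - y\<bar>) * f' y) \<longlonglongrightarrow> f' y"
    proof (intro AE_I2)
      fix y
      have "(\<lambda>n. exp (- ?b n * \<bar>0 - y\<bar>) * f' y) \<longlonglongrightarrow> exp (- 0 * \<bar>0 - y\<bar>) * f' y"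
        by (intro tendsto_intros LIMSEQ_inverse_real_of_nat)
      then show "(\<lambda>n. exp (- ?b n * \<bar>0 - y\<bar>) * f' y) \<longlonglongrightarrow> f' y" by simp
    qed
  qed (use int' in \<open>auto simp: abs_mult mult_left_le_one_le\<close>)
  moreover have "I \<longlonglongrightarrow> 0"
  proof (rule Lim_null_comparison)
    show "(\<lambda>n. ?b n * (2 * (LINT y|lborel. norm (f y)))) \<longlonglongrightarrow> 0"
      using tendsto_mult[OF LIMSEQ_inverse_real_of_nat tendsto_const] by simp
    show "\<forall>\<^sub>F n in sequentially. norm (I n) \<le> ?b n * (2 * (LINT y|lborel. norm (f y)))"
    proof (intro always_eventually allI)
      fix n
      have b: "0 < ?b n" by simp
      have "I n = half_conv (?b n) f' 0 + half_conv' (?b n) f' 0"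
        using exp_kernel_split[OF b _ fM, where x = 0] by (simp add: I_def has_bochner_integral_iff)
      \<comment> \<open>Integrating by parts on both half-lines, the boundary values f(0) cancel and
        the small factor comes out; what remains is bounded by the L1 norm of \<open>f\<close>, as
        the kernel is at most 1.\<close>
      also have "\<dots> = ?b n * (half_conv' (?b n) f 0 - half_conv (?b n) f 0)"
        by (simp add: half_conv_deriv[OF b f' cf' f fM] half_conv'_deriv[OF b f' cf' f fM] right_diff_distrib del: of_nat_Suc)
      finally have "norm (I n) = ?b n * \<bar>half_conv' (?b n) f 0 - half_conv (?b n) f 0\<bar>"
        by (simp add: abs_mult)
      also have "\<dots> \<le> ?b n * (\<bar>half_conv' (?b n) f 0\<bar> + \<bar>half_conv (?b n) f 0\<bar>)"
        by (intro mult_left_mono abs_triangle_ineq4) auto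
      also have "\<bar>half_conv' (?b n) f 0\<bar> \<le> (LINT y|lborel. norm (f y))"
        unfolding half_conv'_def real_norm_def[symmetric]
        using integrable_half_conv(2)[of "?b n" f M 0] b f int
        by (intro order_trans[OF integral_norm_bound integral_mono] integrable_norm)
          (auto simp: abs_mult indicator_def mult_left_le_one_le simp del: of_nat_Suc)
      also have "\<bar>half_conv (?b n) f 0\<bar> \<le> (LINT y|lborel. norm (f y))"
        unfolding half_conv_def real_norm_def[symmetric]
        using integrable_half_conv(1)[of "?b n" f M 0] b f int
        by (intro order_trans[OF integral_norm_bound integral_mono] integrable_norm)
          (auto simp: abs_mult indicator_def mult_left_le_one_le mult_nonneg_nonpos simp del: of_nat_Suc)
      finally show "norm (I n) \<le> ?b n * (2 * (LINT y|lborel. norm (f y)))"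
        by simp
    qed
  qed
  ultimately show ?thesis
    using LIMSEQ_unique by blast
qed

section \<open>Characteristics and the Riccati inequality\<close>

text \<open>The chain rule without joint differentiability. The increment is split into a change of
  time at the point X(r) and a change of place at the time t; since X(r) moves with r, the first
  part calls for a quotient limit uniform in x and for continuity of \<open>z\<close>.\<close>

lemma moving_derivative:
  fixes w :: "real \<Rightarrow> real \<Rightarrow> real"
  assumes X: "(X has_field_derivative Y) (at t within S)"
    and D: "(w t has_field_derivative D) (at (X t))"
    and z: "isCont z (X t)"
    and unif: "\<And>e. 0 < e \<Longrightarrow> \<forall>\<^sub>F r in at t within S. \<forall>x. \<bar>(w r x - w t x) / (r - t) - z x\<bar> \<le> e"
  shows "((\<lambda>r. w r (X r)) has_field_derivative z (X t) + D * Y) (at t within S)"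
proof -
  have "((\<lambda>r. w t (X r)) has_field_derivative D * Y) (at t within S)"
    by (rule DERIV_chain2[OF D X])
  then have 1: "((\<lambda>r. (w t (X r) - w t (X t)) / (r - t)) \<longlongrightarrow> D * Y) (at t within S)"
    by (simp add: has_field_derivative_iff)
  have "(X \<longlongrightarrow> X t) (at t within S)"
    using has_field_derivative_imp_has_derivative[OF X] has_derivative_continuous
    by (auto simp: continuous_within)
  with z have 2: "((\<lambda>r. z (X r)) \<longlongrightarrow> z (X t)) (at t within S)"
    by (rule isCont_tendsto_compose)
  have 3: "((\<lambda>r. (w r (X r) - w t (X r)) / (r - t) - z (X r)) \<longlongrightarrow> 0) (at t within S)"
  proof (rule tendstoI)
    fix e :: real assume "0 < e"
    then have "0 < e / 2" by simp
    from unif[OF this]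
    show "\<forall>\<^sub>F r in at t within S. dist ((w r (X r) - w t (X r)) / (r - t) - z (X r)) 0 < e"
    proof eventually_elim
      case (elim r)
      show ?case
        using le_less_trans[OF spec[OF elim, of "X r"], of e] \<open>0 < e\<close> by (simp add: dist_real_def)
    qed
  qed
  have "((\<lambda>r. ((w r (X r) - w t (X r)) / (r - t) - z (X r)) + z (X r) + (w t (X r) - w t (X t)) / (r - t))
    \<longlongrightarrow> 0 + z (X t) + D * Y) (at t within S)"
    by (intro tendsto_add 1 2 3)
  then show ?thesis
    unfolding has_field_derivative_iff by (simp add: diff_divide_distrib)
qed

text \<open>For w = -m - q the inequality reads w' >= w (w + 2 q). It dominates w^2 only while w is
  nonnegative, so positivity is secured before the comparison.\<close>

lemma riccati_lifespan:
  fixes m m' :: "real \<Rightarrow> real"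
  assumes T: "0 < T" and q: "0 \<le> q"
    and m: "\<And>t. t \<in> {0..T} \<Longrightarrow> (m has_field_derivative m' t) (at t within {0..T})"
    and ineq: "\<And>t. 0 < t \<Longrightarrow> t < T \<Longrightarrow> m' t \<le> - (m t)\<^sup>2 + q\<^sup>2"
    and m0: "m 0 < - q"
  shows "T < 1 / (- m 0 - q)"
proof -
  define w where "w t = - m t - q" for t
  have at: "at t within {0..T} = at t" if "0 < t" "t < T" for t
    using that by (intro at_within_interior) auto
  have w': "(w has_field_derivative - m' t) (at t)" if "0 < t" "t < T" for t
    using m[of t] that unfolding w_def at[OF that] by (auto intro!: derivative_eq_intros)
  have wge: "w t * (w t + 2 * q) \<le> - m' t" if "0 < t" "t < T" for t
    using ineq[OF that] by (simp add: w_def algebra_simps power2_eq_square)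
  have cm: "continuous_on {0..T} m"
    using m by (meson DERIV_continuous_on)
  then have cw: "continuous_on {0..T} w"
    unfolding w_def by (intro continuous_intros)
  have w0: "0 < w 0" using m0 by (simp add: w_def)
  have wpos: "0 < w t" if t: "0 \<le> t" "t \<le> T" for t
  proof -
    \<comment> \<open>Reading w + 2 q as the coefficient of a linear inequality, exp(-A) is an
      integrating factor: w exp(-A) is nondecreasing, so w keeps its initial sign.\<close>
    define A where "A s = integral {0..s} (\<lambda>s. w s + 2 * q)" for s
    have cA: "continuous_on {0..T} (\<lambda>s. w s + 2 * q)"
      by (intro continuous_intros cw)
    have A': "(A has_field_derivative w s + 2 * q) (at s within {0..T})" if "s \<in> {0..T}" for s
      unfolding A_def has_real_derivative_iff_has_vector_derivative
      by (rule integral_has_vector_derivative[OF cA that])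
    then have cont: "continuous_on {0..T} A"
      by (meson DERIV_continuous_on)
    have "w 0 * exp (- A 0) \<le> w t * exp (- A t)"
    proof (rule DERIV_nonneg_imp_increasing_open[of 0 t "\<lambda>s. w s * exp (- A s)"])
      show "0 \<le> t" by (rule t)
      show "continuous_on {0..t} (\<lambda>s. w s * exp (- A s))"
        using t by (intro continuous_intros continuous_on_subset[OF cw] continuous_on_subset[OF cont]) auto
      fix s assume s: "0 < s" "s < t"
      then have s': "0 < s" "s < T" using t by auto
      have "((\<lambda>s. w s * exp (- A s)) has_field_derivative (- m' s - w s * (w s + 2 * q)) * exp (- A s)) (at s)"
      proof -
        have "(A has_field_derivative w s + 2 * q) (at s)"
          using A'[of s] s' by (simp add: at)
        from DERIV_mult[OF w'[OF s'] DERIV_fun_exp[OF DERIV_minus[OF this]]] show ?thesis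
          by (rule DERIV_cong) (simp add: algebra_simps)
      qed
      moreover have "0 \<le> (- m' s - w s * (w s + 2 * q)) * exp (- A s)"
        using wge[OF s'] by simp
      ultimately show "\<exists>y. ((\<lambda>s. w s * exp (- A s)) has_real_derivative y) (at s) \<and> 0 \<le> y"
        by blast
    qed
    moreover have "0 < w 0 * exp (- A 0)" using w0 by simp
    ultimately have "0 < w t * exp (- A t)" by linarith
    then show ?thesis by (simp add: zero_less_mult_iff)
  qed
  \<comment> \<open>Since w' >= w^2 with w positive, -1/w - t is nondecreasing; the positive term
    1/w(T) makes the resulting bound on T strict.\<close>
  have "- (1 / w 0) - 0 \<le> - (1 / w T) - T"
  proof (rule DERIV_nonneg_imp_increasing_open[of 0 T "\<lambda>t. - (1 / w t) - t"])
    show "0 \<le> T" using T by simp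
    show "continuous_on {0..T} (\<lambda>t. - (1 / w t) - t)"
      using wpos by (intro continuous_intros cw) force
    fix t assume t: "0 < t" "t < T"
    have "((\<lambda>t. - (1 / w t) - t) has_field_derivative (- m' t) / (w t)\<^sup>2 - 1) (at t)"
      using wpos[of t] t by (auto intro!: derivative_eq_intros w'[OF t] simp: power2_eq_square)
    moreover have "(w t)\<^sup>2 \<le> - m' t"
    proof -
      have "(w t)\<^sup>2 \<le> w t * (w t + 2 * q)"
        using wpos[of t] t q by (simp add: power2_eq_square algebra_simps)
      with wge[OF t] show ?thesis by simp
    qed
    then have "1 \<le> (- m' t) / (w t)\<^sup>2"
      using wpos[of t] t by (subst pos_le_divide_eq) auto
    then have "0 \<le> (- m' t) / (w t)\<^sup>2 - 1"
      by simp
    ultimately show "\<exists>y. ((\<lambda>t. - (1 / w t) - t) has_real_derivative y) (at t) \<and> 0 \<le> y"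
      by blast
  qed
  moreover have "0 < 1 / w T" using wpos[of T] T by (intro divide_pos_pos) auto
  ultimately have "T < 1 / w 0" by linarith
  then show ?thesis by (simp add: w_def)
qed

text \<open>The Lipschitz constant is the same for all times and places, so Picard's iteration
  converges on the whole interval and no local solutions have to be glued.\<close>

lemma picard_characteristic:
  fixes u :: "real \<Rightarrow> real \<Rightarrow> real"
  assumes T: "0 \<le> T" and L: "0 < L"
    and lip: "\<And>t x y. t \<in> {0..T} \<Longrightarrow> \<bar>u t x - u t y\<bar> \<le> L * \<bar>x - y\<bar>"
    and cont: "\<And>x. continuous_on {0..T} (\<lambda>t. u t x)"
  obtains X where "X 0 = x0" "\<And>t. t \<in> {0..T} \<Longrightarrow> (X has_field_derivative u t (X t)) (at t within {0..T})"
proof -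
  \<comment> \<open>Continuity in time at a fixed place and the uniform Lipschitz bound in space
    combine to continuity along any continuous curve.\<close>
  have cu: "continuous_on {0..T} (\<lambda>t. u t (Y t))" if Y: "continuous_on {0..T} Y" for Y
    unfolding continuous_on_def
  proof
    fix t assume t: "t \<in> {0..T}"
    have "((\<lambda>s. L * \<bar>Y s - Y t\<bar> + \<bar>u s (Y t) - u t (Y t)\<bar>) \<longlongrightarrow> L * \<bar>Y t - Y t\<bar> + \<bar>u t (Y t) - u t (Y t)\<bar>) (at t within {0..T})"
      using Y cont t by (intro tendsto_intros) (auto simp: continuous_on_def)
    then have lim: "((\<lambda>s. L * \<bar>Y s - Y t\<bar> + \<bar>u s (Y t) - u t (Y t)\<bar>) \<longlongrightarrow> 0) (at t within {0..T})"
      by simp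
    have "((\<lambda>s. u s (Y s) - u t (Y t)) \<longlongrightarrow> 0) (at t within {0..T})"
    proof (rule Lim_null_comparison[OF _ lim])
      have "\<forall>\<^sub>F s in at t within {0..T}. s \<in> {0..T}"
        by (simp add: eventually_at_filter)
      then show "\<forall>\<^sub>F s in at t within {0..T}. norm (u s (Y s) - u t (Y t)) \<le> L * \<bar>Y s - Y t\<bar> + \<bar>u s (Y t) - u t (Y t)\<bar>"
      proof eventually_elim
        case (elim s)
        from lip[OF elim, of "Y s" "Y t"] show ?case by simp
      qed
    qed
    then show "((\<lambda>s. u s (Y s)) \<longlongrightarrow> u t (Y t)) (at t within {0..T})"
      by (rule LIM_zero_cancel)
  qed
  define \<Phi> where "\<Phi> Y t = x0 + integral {0..t} (\<lambda>s. u s (Y s))" for Y t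
  have \<Phi>': "(\<Phi> Y has_field_derivative u t (Y t)) (at t within {0..T})" if "continuous_on {0..T} Y" "t \<in> {0..T}" for Y t
    using integral_has_vector_derivative[OF cu[OF that(1)] that(2)]
    unfolding \<Phi>_def has_real_derivative_iff_has_vector_derivative by (auto intro!: derivative_eq_intros)
  have c\<Phi>: "continuous_on {0..T} (\<Phi> Y)" if "continuous_on {0..T} Y" for Y
    by (rule DERIV_continuous_on[OF \<Phi>'[OF that]])
  define Z where "Z n = (\<Phi> ^^ n) (\<lambda>t. x0)" for n
  have Z_Suc: "Z (Suc n) = \<Phi> (Z n)" for n by (simp add: Z_def)
  have cZ: "continuous_on {0..T} (Z n)" for n
  proof (induction n)
    case (Suc n) then show ?case unfolding Z_Suc by (rule c\<Phi>)
  qed (simp add: Z_def)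
  have int: "(\<lambda>s. u s (Y s)) integrable_on {0..t}" if "continuous_on {0..T} Y" "t \<le> T" for Y t
    by (intro integrable_continuous_real continuous_on_subset[OF cu[OF that(1)]]) (use that(2) in auto)
  have "bounded ((\<lambda>t. Z 1 t - Z 0 t) ` {0..T})"
    by (intro compact_imp_bounded compact_continuous_image continuous_intros cZ) simp
  then obtain C where "\<forall>y\<in>(\<lambda>t. Z 1 t - Z 0 t) ` {0..T}. norm y \<le> C"
    unfolding bounded_iff by blast
  then have C: "\<bar>Z 1 t - Z 0 t\<bar> \<le> C" if "t \<in> {0..T}" for t
    using that by auto
  have C0: "0 \<le> C" using C[of 0] T by simp
  (* The weight exp(2 L t) makes each Picard step a contraction by 1/2 on the whole interval. *)
  have diff: "\<bar>Z (Suc n) t - Z n t\<bar> \<le> C * (1/2) ^ n * exp (2 * L * t)" if "t \<in> {0..T}" for n t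
    using that
  proof (induction n arbitrary: t)
    case 0
    have "C * 1 \<le> C * exp (2 * L * t)"
      using 0 L C0 by (intro mult_left_mono) auto
    with C[OF 0] show ?case by simp
  next
    case (Suc n)
    let ?g = "\<lambda>s. L * (C * (1/2) ^ n * exp (2 * L * s))"
    have g: "(?g has_integral C * (1/2) ^ Suc n * exp (2 * L * t) - C * (1/2) ^ Suc n * exp (2 * L * 0)) {0..t}"
      using Suc.prems L
      by (intro fundamental_theorem_of_calculus)
        (auto simp: has_real_derivative_iff_has_vector_derivative[symmetric] intro!: derivative_eq_intros)
    have Zt: "Z (Suc k) t = x0 + integral {0..t} (\<lambda>s. u s (Z k s))" for k
      by (simp add: Z_Suc \<Phi>_def)
    have "Z (Suc (Suc n)) t - Z (Suc n) t = integral {0..t} (\<lambda>s. u s (Z (Suc n) s) - u s (Z n s))"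
      unfolding Zt[of "Suc n"] Zt[of n] using Suc.prems by (subst integral_diff) (auto intro!: int cZ)
    then have "\<bar>Z (Suc (Suc n)) t - Z (Suc n) t\<bar> = norm (integral {0..t} (\<lambda>s. u s (Z (Suc n) s) - u s (Z n s)))"
      by simp
    also have "\<dots> \<le> integral {0..t} ?g"
    proof (rule integral_norm_bound_integral)
      show "(\<lambda>s. u s (Z (Suc n) s) - u s (Z n s)) integrable_on {0..t}"
        using Suc.prems by (intro integrable_diff int cZ) auto
      show "?g integrable_on {0..t}"
        using g by blast
      fix s assume "s \<in> {0..t}"
      then have s: "s \<in> {0..T}" using Suc.prems by auto
      have "\<bar>u s (Z (Suc n) s) - u s (Z n s)\<bar> \<le> L * \<bar>Z (Suc n) s - Z n s\<bar>"
        by (rule lip[OF s])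
      also have "\<dots> \<le> ?g s"
        using Suc.IH[OF s] L by (intro mult_left_mono) auto
      finally show "norm (u s (Z (Suc n) s) - u s (Z n s)) \<le> ?g s" by simp
    qed
    also have "\<dots> = C * (1/2) ^ Suc n * exp (2 * L * t) - C * (1/2) ^ Suc n * exp (2 * L * 0)"
      using g by (rule integral_unique)
    also have "\<dots> \<le> C * (1/2) ^ Suc n * exp (2 * L * t)"
      using C0 by simp
    finally show ?case .
  qed
  \<comment> \<open>The iterates are the partial sums of their telescoping increments, which are
    dominated by a geometric series.\<close>
  have "uniform_limit {0..T} (\<lambda>n t. \<Sum>i<n. Z (Suc i) t - Z i t) (\<lambda>t. suminf (\<lambda>i. Z (Suc i) t - Z i t)) sequentially"
  proof (rule Weierstrass_m_test)
    show "norm (Z (Suc n) t - Z n t) \<le> C * exp (2 * L * T) * (1/2) ^ n" if "t \<in> {0..T}" for n t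
    proof -
      have "C * (1/2) ^ n * exp (2 * L * t) \<le> C * (1/2) ^ n * exp (2 * L * T)"
        using that L C0 by (intro mult_left_mono) auto
      with diff[OF that, of n] show ?thesis by (simp add: mult_ac)
    qed
    show "summable (\<lambda>n. C * exp (2 * L * T) * (1/2::real) ^ n)"
      by (intro summable_mult summable_geometric) simp
  qed
  then have "uniform_limit {0..T} (\<lambda>n t. Z 0 t + (\<Sum>i<n. Z (Suc i) t - Z i t)) (\<lambda>t. Z 0 t + suminf (\<lambda>i. Z (Suc i) t - Z i t)) sequentially"
    by (intro uniform_limit_intros)
  moreover have "Z 0 t + (\<Sum>i<n. Z (Suc i) t - Z i t) = Z n t" for n t
    using sum_lessThan_telescope[of "\<lambda>i. Z i t" n] by simp
  ultimately have "uniform_limit {0..T} Z (\<lambda>t. Z 0 t + suminf (\<lambda>i. Z (Suc i) t - Z i t)) sequentially"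
    by (simp only:)
  then obtain X where X: "uniform_limit {0..T} Z X sequentially"
    by blast
  have cX: "continuous_on {0..T} X"
    by (rule uniform_limit_theorem[OF _ X]) (auto intro!: always_eventually cZ)
  have ulim: "uniform_limit {0..T} (\<lambda>n s. u s (Z n s)) (\<lambda>s. u s (X s)) sequentially"
  proof (rule uniform_limitI)
    fix e :: real assume "0 < e"
    then have "0 < e / L" using L by simp
    from uniform_limitD[OF X this]
    show "\<forall>\<^sub>F n in sequentially. \<forall>s\<in>{0..T}. dist (u s (Z n s)) (u s (X s)) < e"
    proof eventually_elim
      case (elim n)
      show ?case
      proof
        fix s assume s: "s \<in> {0..T}"
        have "\<bar>u s (Z n s) - u s (X s)\<bar> \<le> L * \<bar>Z n s - X s\<bar>" by (rule lip[OF s])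
        also have "\<dots> < e" using elim s L by (auto simp: dist_real_def pos_less_divide_eq mult.commute)
        finally show "dist (u s (Z n s)) (u s (X s)) < e" by (simp add: dist_real_def)
      qed
    qed
  qed
  have fixpt: "X t = \<Phi> X t" if t: "t \<in> {0..T}" for t
  proof (rule LIMSEQ_unique)
    show "(\<lambda>n. Z (Suc n) t) \<longlonglongrightarrow> X t"
      using tendsto_uniform_limitI[OF X t] by (rule LIMSEQ_Suc)
    obtain I J where IJ: "\<And>n. ((\<lambda>s. u s (Z n s)) has_integral I n) {0..t}"
      "((\<lambda>s. u s (X s)) has_integral J) {0..t}" "I \<longlonglongrightarrow> J"
    proof (rule uniform_limit_integral)
      show "uniform_limit {0..t} (\<lambda>n s. u s (Z n s)) (\<lambda>s. u s (X s)) sequentially"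
        by (rule uniform_limit_on_subset[OF ulim]) (use t in auto)
      show "continuous_on {0..t} (\<lambda>s. u s (Z n s))" for n
        by (rule continuous_on_subset[OF cu[OF cZ]]) (use t in auto)
    qed auto
    then have "(\<lambda>n. x0 + I n) \<longlonglongrightarrow> x0 + J"
      by (intro tendsto_intros)
    then show "(\<lambda>n. Z (Suc n) t) \<longlonglongrightarrow> \<Phi> X t"
      by (simp add: Z_Suc \<Phi>_def integral_unique[OF IJ(1)] integral_unique[OF IJ(2)])
  qed
  show thesis
  proof
    \<comment> \<open>The witness is the image of the limit under the Picard map: it is a primitive
      by construction, and it agrees with the limit on the interval.\<close>
    show "\<Phi> X 0 = x0" by (simp add: \<Phi>_def)
    show "(\<Phi> X has_field_derivative u t (\<Phi> X t)) (at t within {0..T})" if "t \<in> {0..T}" for t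
      using \<Phi>'[OF cX that] fixpt[OF that] by simp
  qed
qed

section \<open>Classical solutions\<close>

(* V is the C1 representative of the time derivative, and n t r is the Sobolev distance between the
   difference quotient of u at the times r and t and V t. *)
locale classical_solution =
  fixes B b \<tau> :: real and u ux uxx V V' n :: "real \<Rightarrow> real \<Rightarrow> real"
  assumes B: "0 < B" and b: "0 < b" and \<tau>: "0 < \<tau>"
    and ux: "t \<in> {0..\<tau>} \<Longrightarrow> (u t has_field_derivative ux t x) (at x)"
    and cux: "t \<in> {0..\<tau>} \<Longrightarrow> continuous_on UNIV (ux t)"
    and uxx: "t \<in> {0..\<tau>} \<Longrightarrow> (ux t has_field_derivative uxx t x) (at x)"
    and bounded: "t \<in> {0..\<tau>} \<Longrightarrow> \<exists>M. \<forall>x. \<bar>u t x\<bar> \<le> M \<and> \<bar>ux t x\<bar> \<le> M"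
    and sq_u: "t \<in> {0..\<tau>} \<Longrightarrow> square_integrable (u t)"
    and V': "t \<in> {0..\<tau>} \<Longrightarrow> (V t has_field_derivative V' t x) (at x)"
    and cV': "t \<in> {0..\<tau>} \<Longrightarrow> continuous_on UNIV (V' t)"
    and bounded_V': "t \<in> {0..\<tau>} \<Longrightarrow> \<exists>M. \<forall>x. \<bar>V' t x\<bar> \<le> M"
    and sq_V: "t \<in> {0..\<tau>} \<Longrightarrow> square_integrable (V t)"
    and n: "t \<in> {0..\<tau>} \<Longrightarrow> (n t \<longlongrightarrow> 0) (at t within {0..\<tau>})"
    and quot: "t \<in> {0..\<tau>} \<Longrightarrow> r \<in> {0..\<tau>} \<Longrightarrow> r \<noteq> t \<Longrightarrow> \<bar>(u r x - u t x) / (r - t) - V t x\<bar> \<le> n t r"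
    and quot': "t \<in> {0..\<tau>} \<Longrightarrow> r \<in> {0..\<tau>} \<Longrightarrow> r \<noteq> t \<Longrightarrow> \<bar>(ux r x - ux t x) / (r - t) - V' t x\<bar> \<le> n t r"
    and quot_L2: "t \<in> {0..\<tau>} \<Longrightarrow> r \<in> {0..\<tau>} \<Longrightarrow> r \<noteq> t \<Longrightarrow> L2norm (\<lambda>x. (u r x - u t x) / (r - t) - V t x) \<le> n t r"
    and pde: "t \<in> {0..\<tau>} \<Longrightarrow> 0 < t \<Longrightarrow>
      V t x + u t x * ux t x + (LINT \<xi>|lborel. B * exp (- b * \<bar>x - \<xi>\<bar>) * ux t \<xi>) = 0"
begin

section \<open>The equation and its space derivative through half convolutions; energy\<close>

lemma continuous_u: "t \<in> {0..\<tau>} \<Longrightarrow> continuous_on UNIV (u t)"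
  using ux by (auto intro!: DERIV_isCont simp: continuous_on_eq_continuous_at)

text \<open>Integration by parts moves the derivative from u to the kernel; the boundary values at x
  from the two sides cancel, because the kernel is continuous there.\<close>

lemma nonlocal_term:
  assumes t: "t \<in> {0..\<tau>}"
  shows "(LINT \<xi>|lborel. B * exp (- b * \<bar>x - \<xi>\<bar>) * ux t \<xi>) = b * B * (half_conv' b (u t) x - half_conv b (u t) x)"
proof -
  obtain M where M: "\<And>x. \<bar>u t x\<bar> \<le> M" "\<And>x. \<bar>ux t x\<bar> \<le> M"
    using bounded[OF t] by auto
  have [measurable]: "ux t \<in> borel_measurable borel"
    using cux[OF t] by (rule borel_measurable_continuous_onI)
  have "(LINT \<xi>|lborel. B * exp (- b * \<bar>x - \<xi>\<bar>) * ux t \<xi>) = B * (half_conv b (ux t) x + half_conv' b (ux t) x)"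
    using exp_kernel_split[OF b _ M(2), where x = x] by (simp add: has_bochner_integral_iff mult.assoc)
  also have "half_conv b (ux t) x = u t x - b * half_conv b (u t) x"
    by (rule half_conv_deriv[OF b ux[OF t] cux[OF t] M])
  also have "half_conv' b (ux t) x = - u t x + b * half_conv' b (u t) x"
    by (rule half_conv'_deriv[OF b ux[OF t] cux[OF t] M])
  finally show ?thesis by (simp add: algebra_simps)
qed

lemma V_eq:
  assumes t: "t \<in> {0..\<tau>}" "0 < t"
  shows "V t x = - (u t x * ux t x) + b * B * (half_conv b (u t) x - half_conv' b (u t) x)"
  using pde[OF t, of x] unfolding nonlocal_term[OF t(1)] by (simp add: algebra_simps)

text \<open>The space derivative of \<open>V_eq\<close>. Here the boundary values of the two halves
  add up, since the derivative of the kernel jumps at 0, and this produces the term with 2 b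
  B.\<close>

lemma V'_eq:
  assumes t: "t \<in> {0..\<tau>}" "0 < t"
  shows "V' t x = - (ux t x)\<^sup>2 - u t x * uxx t x + 2 * b * B * u t x
    - b\<^sup>2 * B * (half_conv b (u t) x + half_conv' b (u t) x)"
proof -
  obtain M where M: "\<And>x. \<bar>u t x\<bar> \<le> M"
    using bounded[OF t(1)] by auto
  note cu = continuous_u[OF t(1)]
  have "((\<lambda>x. - (u t x * ux t x) + b * B * (half_conv b (u t) x - half_conv' b (u t) x)) has_field_derivative
     - (ux t x * ux t x + uxx t x * u t x) + b * B * ((u t x - b * half_conv b (u t) x) - (- u t x + b * half_conv' b (u t) x))) (at x)"
    by (intro DERIV_add DERIV_minus DERIV_mult DERIV_cmult DERIV_diff ux[OF t(1)] uxx[OF t(1)]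
        half_conv_has_derivative[OF b cu M] half_conv'_has_derivative[OF b cu M])
  moreover have "V t = (\<lambda>x. - (u t x * ux t x) + b * B * (half_conv b (u t) x - half_conv' b (u t) x))"
    using V_eq[OF t] by auto
  ultimately have "V' t x = - (ux t x * ux t x + uxx t x * u t x)
      + b * B * ((u t x - b * half_conv b (u t) x) - (- u t x + b * half_conv' b (u t) x))"
    using V'[OF t(1), of x] DERIV_unique by metis
  then show ?thesis by (simp add: algebra_simps power2_eq_square)
qed

lemma half_conv_bound:
  assumes t: "t \<in> {0..\<tau>}"
  shows "\<bar>half_conv b (u t) x\<bar> + \<bar>half_conv' b (u t) x\<bar> \<le> L2norm (u t) / sqrt b"
  using bounded[OF t] abs_half_conv_le[OF b sq_u[OF t]] by blast

text \<open>The local part u^2 u_x is a third of the derivative of the integrable function u^3,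
  hence integrates to 0; the nonlocal part cancels by \<open>half_conv_symmetric\<close>.\<close>

lemma energy_flux_zero:
  assumes t: "t \<in> {0..\<tau>}" "0 < t"
  shows "(LINT x|lborel. u t x * V t x) = 0"
proof -
  obtain M where M: "\<And>x. \<bar>u t x\<bar> \<le> M" "\<And>x. \<bar>ux t x\<bar> \<le> M"
    using bounded[OF t(1)] by auto
  have M0: "0 \<le> M" using M(1)[of 0] by simp
  note sq = sq_u[OF t(1)]
  note [measurable] = square_integrable_measurable[OF sq] borel_measurable_continuous_onI[OF cux[OF t(1)]]
  have u2: "integrable lborel (\<lambda>x. M * (u t x)\<^sup>2)"
    using sq by (simp add: square_integrable_def)
  have u3: "integrable lborel (\<lambda>x. (u t x)^3)"
  proof (rule Bochner_Integration.integrable_bound[OF u2])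
    have "\<bar>u t x\<bar> * (u t x)\<^sup>2 \<le> M * (u t x)\<^sup>2" for x
      using M by (intro mult_right_mono) auto
    moreover have "norm ((u t x)^3) = \<bar>u t x\<bar> * (u t x)\<^sup>2" "norm (M * (u t x)\<^sup>2) = M * (u t x)\<^sup>2" for x
      using M0 by (simp_all add: abs_mult power3_eq_cube power2_eq_square)
    ultimately show "AE x in lborel. norm ((u t x)^3) \<le> norm (M * (u t x)\<^sup>2)"
      by simp
  qed simp
  have u2x: "integrable lborel (\<lambda>x. (u t x)\<^sup>2 * ux t x)"
  proof (rule Bochner_Integration.integrable_bound[OF u2])
    have "(u t x)\<^sup>2 * \<bar>ux t x\<bar> \<le> (u t x)\<^sup>2 * M" for x
      using M by (intro mult_left_mono) auto
    then show "AE x in lborel. norm ((u t x)\<^sup>2 * ux t x) \<le> norm (M * (u t x)\<^sup>2)"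
      using M0 by (auto simp: abs_mult mult.commute)
  qed simp
  have "(LINT x|lborel. 3 * ((u t x)\<^sup>2 * ux t x)) = 0"
  proof (rule integral_derivative_eq_0)
    show "((\<lambda>x. (u t x)^3) has_field_derivative 3 * ((u t x)\<^sup>2 * ux t x)) (at x)" for x
      by (auto intro!: derivative_eq_intros ux[OF t(1)])
    show "continuous_on UNIV (\<lambda>x. 3 * ((u t x)\<^sup>2 * ux t x))"
      by (intro continuous_intros continuous_u cux t)
    show "\<bar>(u t x)^3\<bar> \<le> M^3" for x
      unfolding power_abs by (intro power_mono M) simp
    show "\<bar>3 * ((u t x)\<^sup>2 * ux t x)\<bar> \<le> 3 * (M\<^sup>2 * M)" for x
    proof -
      have "\<bar>u t x\<bar>\<^sup>2 * \<bar>ux t x\<bar> \<le> M\<^sup>2 * M"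
        by (intro mult_mono power_mono M) auto
      then show ?thesis by (simp add: abs_mult)
    qed
  qed (use u3 u2x in auto)
  then have 0: "(LINT x|lborel. (u t x)\<^sup>2 * ux t x) = 0" by simp
  note hc = half_conv_symmetric[OF b sq]
  have "(LINT x|lborel. u t x * V t x)
    = (LINT x|lborel. - ((u t x)\<^sup>2 * ux t x) + b * B * (u t x * half_conv b (u t) x - u t x * half_conv' b (u t) x))"
    by (intro Bochner_Integration.integral_cong) (auto simp: V_eq[OF t] power2_eq_square algebra_simps)
  also have "\<dots> = 0"
    using 0 hc u2x by simp
  finally show ?thesis .
qed

text \<open>Convergence of the difference quotients in L2 makes the energy differentiable in time,
  with derivative twice the flux.\<close>

lemma energy_conserved:
  assumes t: "t \<in> {0..\<tau>}"
  shows "L2norm (u t) = L2norm (u 0)"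
proof -
  define E where "E t = (LINT x|lborel. (u t x)\<^sup>2)" for t
  have E': "(E has_field_derivative 2 * (LINT x|lborel. u t x * V t x)) (at t within {0..\<tau>})"
    if t: "t \<in> {0..\<tau>}" for t
    unfolding has_field_derivative_iff
  proof (rule Lim_transform[OF tendsto_const], rule Lim_null_comparison)
    let ?D = "2 * (LINT x|lborel. u t x * V t x)"
    let ?R = "\<lambda>r. 2 * (L2norm (u t) * n t r) + \<bar>r - t\<bar> * (n t r + L2norm (V t))\<^sup>2"
    have "(?R \<longlongrightarrow> 2 * (L2norm (u t) * 0) + \<bar>t - t\<bar> * (0 + L2norm (V t))\<^sup>2) (at t within {0..\<tau>})"
      by (intro tendsto_intros n[OF t])
    then show "(?R \<longlongrightarrow> 0) (at t within {0..\<tau>})" by simp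
    have "\<forall>\<^sub>F r in at t within {0..\<tau>}. r \<in> {0..\<tau>} \<and> r \<noteq> t"
      by (simp add: eventually_at_filter)
    then show "\<forall>\<^sub>F r in at t within {0..\<tau>}. norm ((E r - E t) / (r - t) - ?D) \<le> ?R r"
    proof eventually_elim
      case (elim r)
      \<comment> \<open>\<open>d\<close> is the difference quotient and \<open>e\<close> its
        deviation from the time derivative; then u(r)^2 - u(t)^2 is (r - t) times 2 u V + 2 u e + (r
        - t) d^2.\<close>
      define e where "e = (\<lambda>x. (u r x - u t x) / (r - t) - V t x)"
      define d where "d = (\<lambda>x. e x + V t x)"
      have r: "r - t \<noteq> 0" using elim by simp
      have d: "u r x = u t x + (r - t) * d x" for x
        using r by (simp add: d_def e_def)
      have sqe: "square_integrable e"
        using square_integrable_add[OF square_integrable_scaleR(1)[OF square_integrable_add[OF sq_u square_integrable_scaleR(1)[OF sq_u[OF t], of "-1"]], of r "1 / (r - t)"]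
            square_integrable_scaleR(1)[OF sq_V[OF t], of "-1"]] elim
        by (simp add: e_def diff_divide_distrib)
      have sqd: "square_integrable d"
        unfolding d_def by (intro square_integrable_add sqe sq_V t)
      have int: "integrable lborel (\<lambda>x. u t x * V t x)" "integrable lborel (\<lambda>x. u t x * e x)" "integrable lborel (\<lambda>x. (d x)\<^sup>2)"
        using L2norm_mult_bound(1)[OF sq_u[OF t] sq_V[OF t]] L2norm_mult_bound(1)[OF sq_u[OF t] sqe] sqd
        by (auto simp: square_integrable_def)
      have "E r - E t = (LINT x|lborel. (u r x)\<^sup>2 - (u t x)\<^sup>2)"
        unfolding E_def using sq_u elim t
        by (intro Bochner_Integration.integral_diff[symmetric]) (auto simp: square_integrable_def)
      also have "\<dots> = (LINT x|lborel. (r - t) * (2 * (u t x * V t x) + 2 * (u t x * e x) + (r - t) * (d x)\<^sup>2))"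
        by (intro Bochner_Integration.integral_cong) (auto simp: d power2_eq_square algebra_simps d_def)
      also have "\<dots> = (r - t) * (?D + 2 * (LINT x|lborel. u t x * e x) + (r - t) * (LINT x|lborel. (d x)\<^sup>2))"
        using int by simp
      finally have "(E r - E t) / (r - t) - ?D = 2 * (LINT x|lborel. u t x * e x) + (r - t) * (LINT x|lborel. (d x)\<^sup>2)"
        using r by simp
      then have "norm ((E r - E t) / (r - t) - ?D) \<le> 2 * \<bar>LINT x|lborel. u t x * e x\<bar> + \<bar>r - t\<bar> * \<bar>LINT x|lborel. (d x)\<^sup>2\<bar>"
        by (simp only: real_norm_def) (intro order_trans[OF abs_triangle_ineq], simp add: abs_mult)
      also have "\<bar>LINT x|lborel. u t x * e x\<bar> \<le> L2norm (u t) * n t r"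
      proof -
        have "\<bar>LINT x|lborel. u t x * e x\<bar> \<le> L2norm (u t) * L2norm e"
          using L2norm_mult_bound(2)[OF sq_u[OF t] sqe] by simp
        also have "\<dots> \<le> L2norm (u t) * n t r"
          unfolding e_def using elim t by (intro mult_left_mono quot_L2) auto
        finally show ?thesis .
      qed
      also have "\<bar>LINT x|lborel. (d x)\<^sup>2\<bar> \<le> (n t r + L2norm (V t))\<^sup>2"
      proof -
        have ne: "L2norm e \<le> n t r"
          unfolding e_def using elim t by (intro quot_L2) auto
        have e2: "integrable lborel (\<lambda>x. (e x)\<^sup>2)" and V2: "integrable lborel (\<lambda>x. (V t x)\<^sup>2)"
          using sqe sq_V[OF t] by (auto simp: square_integrable_def)
        have eV: "integrable lborel (\<lambda>x. e x * V t x)" "\<bar>LINT x|lborel. e x * V t x\<bar> \<le> L2norm e * L2norm (V t)"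
          using L2norm_mult_bound[OF sqe sq_V[OF t]] by auto
        have "(LINT x|lborel. (d x)\<^sup>2) = (LINT x|lborel. (e x)\<^sup>2 + 2 * (e x * V t x) + (V t x)\<^sup>2)"
          by (intro Bochner_Integration.integral_cong) (auto simp: d_def power2_eq_square algebra_simps)
        also have "\<dots> = (L2norm e)\<^sup>2 + 2 * (LINT x|lborel. e x * V t x) + (L2norm (V t))\<^sup>2"
          using e2 V2 eV by (simp add: L2norm_power2)
        also have "\<dots> \<le> (L2norm e + L2norm (V t))\<^sup>2"
          using eV(2) by (simp add: power2_sum)
        also have "\<dots> \<le> (n t r + L2norm (V t))\<^sup>2"
          using ne by (intro power_mono) auto
        finally show ?thesis by simp
      qed
      finally show ?case by (simp add: mult_left_mono)
    qed
  qed
  \<comment> \<open>The equation is imposed for positive times only, so the flux is known to vanish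
    in the interior; continuity of \<open>E\<close> on the closed interval includes the time
    0.\<close>
  have "E t = E 0"
  proof (rule DERIV_isconst2[OF \<tau>])
    show "continuous_on {0..\<tau>} E"
      by (rule DERIV_continuous_on[OF E'])
    fix s assume s: "0 < s" "s < \<tau>"
    then have "at s within {0..\<tau>} = at s"
      by (intro at_within_interior) auto
    then show "(E has_field_derivative 0) (at s)"
      using E'[of s] energy_flux_zero[of s] s by simp
  qed (use t in auto)
  then show ?thesis by (simp add: L2norm_def E_def)
qed

section \<open>Estimates uniform in space, and the slope along a characteristic\<close>

lemma quot_uniform:
  assumes t: "t \<in> {0..\<tau>}" and e: "0 < e"
  shows "\<forall>\<^sub>F r in at t within {0..\<tau>}. \<forall>x. \<bar>(u r x - u t x) / (r - t) - V t x\<bar> \<le> e"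
    "\<forall>\<^sub>F r in at t within {0..\<tau>}. \<forall>x. \<bar>(ux r x - ux t x) / (r - t) - V' t x\<bar> \<le> e"
proof -
  have "\<forall>\<^sub>F r in at t within {0..\<tau>}. r \<in> {0..\<tau>} \<and> r \<noteq> t"
    by (simp add: eventually_at_filter)
  moreover have "\<forall>\<^sub>F r in at t within {0..\<tau>}. n t r < e"
    using n[OF t] e by (rule order_tendstoD)
  ultimately have ev: "\<forall>\<^sub>F r in at t within {0..\<tau>}. (r \<in> {0..\<tau>} \<and> r \<noteq> t) \<and> n t r < e"
    by (rule eventually_conj)
  show "\<forall>\<^sub>F r in at t within {0..\<tau>}. \<forall>x. \<bar>(u r x - u t x) / (r - t) - V t x\<bar> \<le> e"
    using ev by eventually_elim (use quot[OF t] in \<open>meson less_imp_le order_trans\<close>)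
  show "\<forall>\<^sub>F r in at t within {0..\<tau>}. \<forall>x. \<bar>(ux r x - ux t x) / (r - t) - V' t x\<bar> \<le> e"
    using ev by eventually_elim (use quot'[OF t] in \<open>meson less_imp_le order_trans\<close>)
qed

text \<open>Compactness of the time interval by bisection. Near a time t the slope differs from its
  value at t by at most the time distance multiplied by a bound on V' plus 1. The result is the
  Lipschitz constant for the characteristics.\<close>

lemma ux_bounded: "\<exists>L. \<forall>t\<in>{0..\<tau>}. \<forall>x. \<bar>ux t x\<bar> \<le> L"
proof -
  let ?P = "\<lambda>a c. \<exists>L. \<forall>t\<in>{a..c} \<inter> {0..\<tau>}. \<forall>x. \<bar>ux t x\<bar> \<le> L"
  have "?P 0 \<tau>"
  proof (rule Bolzano[of 0 \<tau> ?P])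
    show "0 \<le> \<tau>" using \<tau> by simp
  next
    fix a c d assume "?P a c" "?P c d" "a \<le> c" "c \<le> d"
    then obtain L1 L2 where L: "\<forall>t\<in>{a..c} \<inter> {0..\<tau>}. \<forall>x. \<bar>ux t x\<bar> \<le> L1" "\<forall>t\<in>{c..d} \<inter> {0..\<tau>}. \<forall>x. \<bar>ux t x\<bar> \<le> L2"
      by blast
    have "\<bar>ux t x\<bar> \<le> max L1 L2" if "t \<in> {a..d} \<inter> {0..\<tau>}" for t x
    proof (cases "t \<le> c")
      case True with L(1) that show ?thesis by (fastforce simp: le_max_iff_disj)
    next
      case False with L(2) that show ?thesis by (fastforce simp: le_max_iff_disj)
    qed
    then show "?P a d" by blast
  next
    fix t assume "0 \<le> t" "t \<le> \<tau>"
    then have t: "t \<in> {0..\<tau>}" by simp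
    from quot_uniform(2)[OF this zero_less_one] obtain \<delta> where \<delta>: "0 < \<delta>"
      "\<And>r. r \<in> {0..\<tau>} \<Longrightarrow> r \<noteq> t \<Longrightarrow> dist r t < \<delta> \<Longrightarrow> \<forall>x. \<bar>(ux r x - ux t x) / (r - t) - V' t x\<bar> \<le> 1"
      unfolding eventually_at by blast
    obtain M1 M2 where M: "\<And>x. \<bar>ux t x\<bar> \<le> M1" "\<And>x. \<bar>V' t x\<bar> \<le> M2"
      using bounded[OF t] bounded_V'[OF t] by blast
    have M2: "0 \<le> M2" using M(2)[of 0] by simp
    have near: "\<bar>ux r x\<bar> \<le> M1 + \<delta> * (M2 + 1)" if r: "r \<in> {0..\<tau>}" "dist r t < \<delta>" for r x
    proof (cases "r = t")
      case True
      then show ?thesis using M(1)[of x] \<delta>(1) M2 by (simp add: add_increasing2)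
    next
      case False
      have "\<bar>(ux r x - ux t x) / (r - t)\<bar> \<le> M2 + 1"
        using \<delta>(2)[OF r(1) False r(2)] M(2)[of x] by (smt (verit))
      then have "\<bar>ux r x - ux t x\<bar> \<le> \<bar>r - t\<bar> * (M2 + 1)"
        using False by (simp add: pos_divide_le_eq mult.commute)
      also have "\<dots> \<le> \<delta> * (M2 + 1)"
        using r(2) M2 by (intro mult_right_mono) (auto simp: dist_real_def)
      finally show ?thesis using M(1)[of x] by linarith
    qed
    show "\<exists>d>0. \<forall>a c. a \<le> t \<and> t \<le> c \<and> c - a < d \<longrightarrow> ?P a c"
    proof (rule exI[of _ \<delta>], intro conjI allI impI \<delta>(1))
      fix a c assume "a \<le> t \<and> t \<le> c \<and> c - a < \<delta>"
      then have "\<forall>r\<in>{a..c} \<inter> {0..\<tau>}. \<forall>x. \<bar>ux r x\<bar> \<le> M1 + \<delta> * (M2 + 1)"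
        using near by (auto simp: dist_real_def)
      then show "?P a c" by blast
    qed
  qed
  then show ?thesis by simp
qed

lemma lipschitz_u: "\<exists>L>0. \<forall>t\<in>{0..\<tau>}. \<forall>x y. \<bar>u t x - u t y\<bar> \<le> L * \<bar>x - y\<bar>"
proof -
  obtain L where L: "\<And>t x. t \<in> {0..\<tau>} \<Longrightarrow> \<bar>ux t x\<bar> \<le> L"
    using ux_bounded by blast
  have "\<bar>u t x - u t y\<bar> \<le> max L 1 * \<bar>x - y\<bar>" if t: "t \<in> {0..\<tau>}" for t x y
  proof -
    have "norm (u t x - u t y) \<le> max L 1 * norm (x - y)"
      by (rule field_differentiable_bound[of UNIV "u t" "ux t"]) (use ux[OF t] L[OF t] in \<open>auto simp: le_max_iff_disj\<close>)
    then show ?thesis by simp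
  qed
  then show ?thesis by (intro exI[of _ "max L 1"]) auto
qed

lemma lifespan_bound:
  assumes q: "0 \<le> q" and F: "\<And>t. 0 \<le> t \<Longrightarrow> t \<le> \<tau> \<Longrightarrow> F_bound B b (u 0) t x0 \<le> q\<^sup>2"
    and m0: "ux 0 x0 < - q"
  shows "\<tau> < 1 / (- ux 0 x0 - q)"
proof -
  obtain L where L: "0 < L" "\<And>t x y. t \<in> {0..\<tau>} \<Longrightarrow> \<bar>u t x - u t y\<bar> \<le> L * \<bar>x - y\<bar>"
    using lipschitz_u by blast
  \<comment> \<open>Along a constant curve the transport term is zero, which gives
    differentiability, and so continuity, in time at a fixed place.\<close>
  have ut: "((\<lambda>t. u t x) has_field_derivative V t x + ux t x * 0) (at t within {0..\<tau>})" if "t \<in> {0..\<tau>}" for t x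
    by (rule moving_derivative[where X = "\<lambda>_. x", OF _ ux[OF that] DERIV_isCont[OF V'[OF that]] quot_uniform(1)[OF that]])
      auto
  have "continuous_on {0..\<tau>} (\<lambda>t. u t x)" for x
    by (rule DERIV_continuous_on[OF ut])
  with \<tau> L obtain X where X0: "X 0 = x0" and X: "\<And>t. t \<in> {0..\<tau>} \<Longrightarrow> (X has_field_derivative u t (X t)) (at t within {0..\<tau>})"
    using picard_characteristic[of \<tau> L u x0] by (metis less_imp_le)
  define N where "N = L2norm (u 0)"
  have N0: "0 \<le> N" by (simp add: N_def)
  define y where "y t = u t (X t)" for t
  define m where "m t = ux t (X t)" for t
  have y': "(y has_field_derivative V t (X t) + ux t (X t) * u t (X t)) (at t within {0..\<tau>})" if "t \<in> {0..\<tau>}" for t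
    unfolding y_def[abs_def]
    by (rule moving_derivative[OF X[OF that] ux[OF that] DERIV_isCont[OF V'[OF that]] quot_uniform(1)[OF that]])
  \<comment> \<open>The transport term u u_xx cancels against its negative in \<open>V'_eq\<close>,
    so the slope equation closes without second derivatives.\<close>
  have m': "(m has_field_derivative V' t (X t) + uxx t (X t) * u t (X t)) (at t within {0..\<tau>})" if "t \<in> {0..\<tau>}" for t
    unfolding m_def[abs_def]
    by (rule moving_derivative[OF X[OF that] uxx[OF that] _ quot_uniform(2)[OF that]])
      (use cV'[OF that] in \<open>auto simp: continuous_on_eq_continuous_at\<close>)
  have hc: "\<bar>half_conv b (u t) x\<bar> + \<bar>half_conv' b (u t) x\<bar> \<le> N / sqrt b" if "t \<in> {0..\<tau>}" for t x
    using half_conv_bound[OF that] energy_conserved[OF that] by (simp add: N_def)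
  have sb: "b * (1 / sqrt b) = sqrt b" "b powr (3/2) = b * sqrt b"
    using b powr_add[of b 1 "1/2"] by (auto simp: real_div_sqrt powr_half_sqrt)
  \<comment> \<open>Along the characteristic u has derivative b B times the difference of the
    halves, at most b B N / sqrt b = B sqrt(b) N by energy conservation.\<close>
  have y_le: "y t \<le> u 0 x0 + B * sqrt b * N * t" if t: "t \<in> {0..\<tau>}" for t
  proof -
    have "B * sqrt b * N * 0 - y 0 \<le> B * sqrt b * N * t - y t"
    proof (rule DERIV_nonneg_imp_increasing_open[of 0 t "\<lambda>t. B * sqrt b * N * t - y t"])
      show "0 \<le> t" using t by simp
      have "continuous_on {0..\<tau>} y"
        by (rule DERIV_continuous_on[OF y'])
      then show "continuous_on {0..t} (\<lambda>t. B * sqrt b * N * t - y t)"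
        using t by (intro continuous_intros) (auto intro: continuous_on_subset)
      fix s assume "0 < s" "s < t"
      then have s: "0 < s" "s < \<tau>" "s \<in> {0..\<tau>}" using t by auto
      then have "at s within {0..\<tau>} = at s"
        by (intro at_within_interior) auto
      with y'[OF s(3)] have "(y has_field_derivative V s (X s) + ux s (X s) * u s (X s)) (at s)"
        by simp
      then have 1: "((\<lambda>t. B * sqrt b * N * t - y t) has_field_derivative B * sqrt b * N - (V s (X s) + ux s (X s) * u s (X s))) (at s)"
        by (auto intro!: derivative_eq_intros)
      have "V s (X s) + ux s (X s) * u s (X s) = b * B * (half_conv b (u s) (X s) - half_conv' b (u s) (X s))"
        unfolding V_eq[OF s(3,1)] by simp
      also have "\<dots> \<le> b * B * (N / sqrt b)"
        using hc[OF s(3), of "X s"] b B by (intro mult_left_mono) auto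
      also have "\<dots> = B * (b * (1 / sqrt b)) * N" by simp
      finally have "0 \<le> B * sqrt b * N - (V s (X s) + ux s (X s) * u s (X s))"
        unfolding sb by simp
      with 1 show "\<exists>D. ((\<lambda>t. B * sqrt b * N * t - y t) has_real_derivative D) (at s) \<and> 0 \<le> D"
        by blast
    qed
    then show ?thesis by (simp add: y_def X0)
  qed
  have "\<tau> < 1 / (- m 0 - q)"
  proof (rule riccati_lifespan[OF \<tau> q m'])
    show "m 0 < - q" using m0 by (simp add: m_def X0)
    fix t assume t: "0 < t" "t < \<tau>"
    then have tI: "t \<in> {0..\<tau>}" by simp
    define S where "S = half_conv b (u t) (X t) + half_conv' b (u t) (X t)"
    have "- S \<le> N / sqrt b"
      using hc[OF tI, of "X t"] unfolding S_def by linarith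
    then have "b\<^sup>2 * B * - S \<le> b\<^sup>2 * B * (N / sqrt b)"
      using b B by (intro mult_left_mono) auto
    also have "\<dots> = b * B * (b * (1 / sqrt b)) * N" by (simp add: power2_eq_square)
    finally have 1: "- (b\<^sup>2 * B * S) \<le> B * (b * sqrt b) * N"
      unfolding sb by (simp add: mult_ac)
    have "2 * b * B * u t (X t) \<le> 2 * b * B * (u 0 x0 + B * sqrt b * N * t)"
      using y_le[OF tI] b B unfolding y_def by (intro mult_left_mono) auto
    also have "\<dots> = 2 * B * b * u 0 x0 + 2 * B\<^sup>2 * (b * sqrt b) * N * t"
      by (simp add: power2_eq_square algebra_simps)
    \<comment> \<open>The terms of \<open>F_bound\<close> with u0(x0) and with t come from the
      growth of u along the characteristic, the remaining one from the bound on the sum of the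
      halves.\<close>
    finally have "V' t (X t) + uxx t (X t) * u t (X t) \<le> - (m t)\<^sup>2 + F_bound B b (u 0) t x0"
      using 1 unfolding V'_eq[OF tI t(1)] F_bound_def m_def sb N_def[symmetric] S_def[symmetric]
      by (simp add: mult.commute[of "uxx t (X t)"])
    also have "\<dots> \<le> - (m t)\<^sup>2 + q\<^sup>2"
      using F[of t] t by simp
    finally show "V' t (X t) + uxx t (X t) * u t (X t) \<le> - (m t)\<^sup>2 + q\<^sup>2" .
  qed
  then show ?thesis by (simp add: m_def X0)
qed

end

section \<open>Blow-up\<close>

text \<open>Differentiating the integral over [x,z] from the right at z = x recovers the value at x.
  This turns the inversion theorem, which speaks of integrals, into pointwise identities.\<close>

lemma continuous_eq_if_box_integrals_eq:
  fixes f g :: "real \<Rightarrow> real"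
  assumes f: "continuous_on UNIV f" and g: "continuous_on UNIV g"
    and eq: "\<And>a b. a \<le> b \<Longrightarrow> (LINT x|lborel. indicator {a..b} x * f x) = (LINT x|lborel. indicator {a..b} x * g x)"
  shows "f = g"
proof
  fix x
  have box: "(LINT y|lborel. indicator {a..b} y * h y) = integral {a..b} h"
    if h: "continuous_on UNIV h" for h :: "real \<Rightarrow> real" and a b
  proof -
    have "set_integrable lborel {a..b} h"
      unfolding set_integrable_def
      using borel_integrable_compact[of "{a..b}" h] continuous_on_subset[OF h]
      by (simp add: indicator_scaleR_eq_if)
    from set_borel_integral_eq_integral(2)[OF this] show ?thesis
      by (simp add: set_lebesgue_integral_def)
  qed
  have "((\<lambda>z. integral {x..z} f) has_vector_derivative f x) (at x within {x..x+1})"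
    by (rule integral_has_vector_derivative) (auto intro: continuous_on_subset[OF f])
  moreover have "((\<lambda>z. integral {x..z} g) has_vector_derivative g x) (at x within {x..x+1})"
    by (rule integral_has_vector_derivative) (auto intro: continuous_on_subset[OF g])
  then have "((\<lambda>z. integral {x..z} f) has_vector_derivative g x) (at x within {x..x+1})"
    by (rule has_vector_derivative_transform[rotated 2]) (use eq in \<open>auto simp: box f g\<close>)
  ultimately show "f x = g x"
    by (rule vector_derivative_unique_within[rotated]) (simp add: trivial_limit_within islimpt_Icc)
qed

section \<open>From Sobolev classes to classical functions\<close>

lemma box_integrable:
  fixes f :: "real \<Rightarrow> real"
  assumes "continuous_on UNIV f"
  shows "integrable lborel (\<lambda>x. indicator {a..b} x * f x)"
  using borel_integrable_compact[of "{a..b}" f] continuous_on_subset[OF assms]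
  by (simp add: indicator_times_eq_if)

lemma box_integrable_square:
  fixes f :: "real \<Rightarrow> real"
  assumes f: "square_integrable f"
  shows "integrable lborel (\<lambda>x. indicator {a..b} x * f x)"
proof (rule Bochner_Integration.integrable_bound[OF square_integrable_truncate[OF f, of "max \<bar>a\<bar> \<bar>b\<bar>"]])
  show "(\<lambda>x. indicator {a..b} x * f x) \<in> borel_measurable lborel"
    using square_integrable_measurable[OF f] by simp
qed (auto simp: indicator_def)

lemma sobolev_continuous_C1:
  assumes f: "f \<in> sobolev \<sigma>" and \<sigma>: "2 \<le> \<sigma>" and c: "continuous_on UNIV f"
  obtains f' where "\<And>x. (f has_field_derivative f' x) (at x)" "continuous_on UNIV f'"
    "\<And>x. \<bar>f x\<bar> \<le> sobolev_norm \<sigma> f" "\<And>x. \<bar>f' x\<bar> \<le> sobolev_norm \<sigma> f"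
    "square_integrable f" "L2norm f \<le> sobolev_norm \<sigma> f"
    "3 \<le> \<sigma> \<Longrightarrow> \<exists>f''. \<forall>x. (f' has_field_derivative f'' x) (at x)"
proof -
  obtain F F' where F: "\<And>a b. a \<le> b \<Longrightarrow> (LINT x|lborel. indicator {a..b} x * F x) = (LINT x|lborel. indicator {a..b} x * f x)"
    "\<And>x. (F has_field_derivative F' x) (at x)" "continuous_on UNIV F'"
    "\<And>x. \<bar>F x\<bar> \<le> sobolev_norm \<sigma> f" "\<And>x. \<bar>F' x\<bar> \<le> sobolev_norm \<sigma> f"
    "square_integrable F" "L2norm F \<le> sobolev_norm \<sigma> f"
    "3 \<le> \<sigma> \<Longrightarrow> \<exists>F''. \<forall>x. (F' has_field_derivative F'' x) (at x)"
    using sobolev_C1_representative[OF f \<sigma>] by blast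
  have "F = f"
    by (rule continuous_eq_if_box_integrals_eq[OF _ c F(1)])
      (use F(2) in \<open>auto intro!: DERIV_isCont simp: continuous_on_eq_continuous_at\<close>)
  with F that show thesis by blast
qed

text \<open>Each u(t) is continuous and therefore equals its C1 representative. The time derivative
  is only a class and has to be replaced by its representative \<open>V\<close>. As the embedding
  constants are at most 1, the one Sobolev distance \<open>n\<close> bounds the quotient errors of u
  and of its slope, in the supremum norm, and that of u in L2.\<close>

lemma solution_classical:
  assumes sol: "is_solution B b s u0 T0 u" and s: "3 \<le> s" and B: "0 < B" and b: "0 < b"
    and \<tau>: "0 < \<tau>" "ereal \<tau> < T0"
  obtains uxx V V' n where "classical_solution B b \<tau> u (\<lambda>t. deriv (u t)) uxx V V' n"
proof -
  define I where "I = time_interval T0"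
  have sub: "{0..\<tau>} \<subseteq> I"
    using \<tau>(2) by (auto simp: I_def time_interval_def intro: le_less_trans[of _ "ereal \<tau>"])
  from sol obtain v where cont: "\<And>t. t \<in> I \<Longrightarrow> continuous_on UNIV (u t)"
    and us: "sobolev_continuous_on I s u" and dv: "sobolev_derivative_on I (s - 1) u v"
    and eqn: "\<And>t. t \<in> I \<Longrightarrow> 0 < t \<Longrightarrow> AE x in lborel. v t x + u t x * deriv (u t) x
                  + (LINT \<xi>|lborel. B * exp (- b * \<bar>x - \<xi>\<bar>) * deriv (u t) \<xi>) = 0"
    unfolding is_solution_def I_def by blast
  have s2: "2 \<le> s" "2 \<le> s - 1" using s by auto
  have us: "u t \<in> sobolev s" if "t \<in> I" for t
    using us that by (auto simp: sobolev_continuous_on_def)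
  have us1: "u t \<in> sobolev (s - 1)" "v t \<in> sobolev (s - 1)" if "t \<in> I" for t
    using dv that by (auto simp: sobolev_derivative_on_def)
  define n where "n t r = sobolev_norm (s - 1) (\<lambda>x. (u r x - u t x) / (r - t) - v t x)" for t r
  have n: "(n t \<longlongrightarrow> 0) (at t within {0..\<tau>})" if "t \<in> {0..\<tau>}" for t
  proof -
    have "(n t \<longlongrightarrow> 0) (at t within I)"
      using dv that sub by (auto simp: sobolev_derivative_on_def n_def[abs_def])
    then show ?thesis by (rule tendsto_within_subset[OF _ sub])
  qed
  have ux: "(\<forall>x. (u t has_field_derivative deriv (u t) x) (at x)) \<and> continuous_on UNIV (deriv (u t))
      \<and> (\<exists>M. \<forall>x. \<bar>u t x\<bar> \<le> M \<and> \<bar>deriv (u t) x\<bar> \<le> M) \<and> square_integrable (u t)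
      \<and> (\<exists>f. \<forall>x. (deriv (u t) has_field_derivative f x) (at x))" if t: "t \<in> I" for t
  proof -
    obtain f' where f': "\<And>x. (u t has_field_derivative f' x) (at x)" "continuous_on UNIV f'"
      "\<And>x. \<bar>u t x\<bar> \<le> sobolev_norm s (u t)" "\<And>x. \<bar>f' x\<bar> \<le> sobolev_norm s (u t)"
      "square_integrable (u t)" "\<exists>f''. \<forall>x. (f' has_field_derivative f'' x) (at x)"
    proof -
      show thesis
        by (rule sobolev_continuous_C1[OF us[OF t] s2(1) cont[OF t]], rule that) (use s in auto)
    qed
    have "deriv (u t) = f'"
      using f'(1) by (auto intro!: DERIV_imp_deriv)
    with f' show ?thesis by blast
  qed
  have "\<exists>f. \<forall>x. (deriv (u t) has_field_derivative f x) (at x)" if "t \<in> I" for t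
    using ux[OF that] by blast
  then obtain uxx where uxx: "\<And>t x. t \<in> I \<Longrightarrow> (deriv (u t) has_field_derivative uxx t x) (at x)"
    by metis
  \<comment> \<open>All properties of a representative are bundled into one predicate, so that
    \<open>V\<close> and \<open>V'\<close> are chosen for all times at once.\<close>
  define P where "P t F F' \<longleftrightarrow>
      (\<forall>a b. a \<le> b \<longrightarrow> (LINT x|lborel. indicator {a..b} x * F x) = (LINT x|lborel. indicator {a..b} x * v t x))
      \<and> (\<forall>x. (F has_field_derivative F' x) (at x)) \<and> continuous_on UNIV F' \<and> (\<exists>M. \<forall>x. \<bar>F' x\<bar> \<le> M) \<and> square_integrable F"
    for t F F'
  have "\<exists>F F'. P t F F'" if t: "t \<in> I" for t
    unfolding P_def
    by (rule sobolev_C1_representative[OF us1(2)[OF t] s2(2)], intro exI conjI allI impI) assumption+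
  then obtain V V' where "\<And>t. t \<in> I \<Longrightarrow> P t (V t) (V' t)"
    by metis
  then have V: "\<And>t a b. t \<in> I \<Longrightarrow> a \<le> b \<Longrightarrow> (LINT x|lborel. indicator {a..b} x * V t x) = (LINT x|lborel. indicator {a..b} x * v t x)"
    "\<And>t x. t \<in> I \<Longrightarrow> (V t has_field_derivative V' t x) (at x)" "\<And>t. t \<in> I \<Longrightarrow> continuous_on UNIV (V' t)"
    "\<And>t. t \<in> I \<Longrightarrow> \<exists>M. \<forall>x. \<bar>V' t x\<bar> \<le> M" "\<And>t. t \<in> I \<Longrightarrow> square_integrable (V t)"
    unfolding P_def by blast+
  have cV: "continuous_on UNIV (V t)" if "t \<in> I" for t
    using V(2)[OF that] by (auto intro!: DERIV_isCont simp: continuous_on_eq_continuous_at)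
  have sqv: "square_integrable (v t)" if "t \<in> I" for t
    using us1(2)[OF that] has_fourier_transform_measurable(3) by (auto simp: sobolev_def)
  have quot: "(\<forall>x. \<bar>(u r x - u t x) / (r - t) - V t x\<bar> \<le> n t r) \<and>
     (\<forall>x. \<bar>(deriv (u r) x - deriv (u t) x) / (r - t) - V' t x\<bar> \<le> n t r) \<and>
     L2norm (\<lambda>x. (u r x - u t x) / (r - t) - V t x) \<le> n t r"
    if t: "t \<in> I" and r: "r \<in> I" for t r
  proof -
    let ?d = "\<lambda>x. (u r x - u t x) / (r - t) - v t x"
    let ?D = "\<lambda>x. (u r x - u t x) / (r - t) - V t x"
    have "?d = (\<lambda>x. 1 * (1 / (r - t) * u r x + (- 1 / (r - t)) * u t x) + (- 1) * v t x)"
      by (auto simp: diff_divide_distrib)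
    also have "\<dots> \<in> sobolev (s - 1)"
      by (intro sobolev_lincomb us1 t r)
    finally have "?d \<in> sobolev (s - 1)" .
    then obtain F F' where F: "\<And>a b. a \<le> b \<Longrightarrow> (LINT x|lborel. indicator {a..b} x * F x) = (LINT x|lborel. indicator {a..b} x * ?d x)"
      "\<And>x. (F has_field_derivative F' x) (at x)"
      "\<And>x. \<bar>F x\<bar> \<le> n t r" "\<And>x. \<bar>F' x\<bar> \<le> n t r" "L2norm F \<le> n t r"
    proof -
      assume d: "?d \<in> sobolev (s - 1)"
      show thesis
        by (rule sobolev_C1_representative[OF d s2(2)], rule that, unfold n_def) assumption+
    qed
    have cQ: "continuous_on UNIV (\<lambda>x. (u r x - u t x) / (r - t))"
      using cont[OF t] cont[OF r] unfolding divide_inverse by (intro continuous_intros)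
    \<comment> \<open>\<open>F\<close> represents the quotient minus \<open>v\<close>, and
      \<open>V\<close> has the same interval integrals as \<open>v\<close>; by continuity
      \<open>F\<close> is the quotient minus \<open>V\<close>, so the bounds on \<open>F\<close> and
      \<open>F'\<close> are the quotient bounds.\<close>
    have "F = ?D"
    proof (rule continuous_eq_if_box_integrals_eq)
      show "continuous_on UNIV F"
        using F(2) by (auto intro!: DERIV_isCont simp: continuous_on_eq_continuous_at)
      show "continuous_on UNIV ?D"
        by (intro continuous_on_diff cQ cV t)
      fix a b :: real assume ab: "a \<le> b"
      have "(LINT x|lborel. indicator {a..b} x * F x)
        = (LINT x|lborel. indicator {a..b} x * ((u r x - u t x) / (r - t))) - (LINT x|lborel. indicator {a..b} x * v t x)"
        unfolding F(1)[OF ab] right_diff_distrib[of "indicator _ _"]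
        by (intro Bochner_Integration.integral_diff box_integrable[OF cQ] box_integrable_square sqv t)
      also have "\<dots> = (LINT x|lborel. indicator {a..b} x * ?D x)"
        unfolding V(1)[OF t ab, symmetric] right_diff_distrib[of "indicator _ _"]
        by (intro Bochner_Integration.integral_diff[symmetric] box_integrable[OF cQ] box_integrable cV t)
      finally show "(LINT x|lborel. indicator {a..b} x * F x) = (LINT x|lborel. indicator {a..b} x * ?D x)" .
    qed
    moreover have "F' x = (deriv (u r) x - deriv (u t) x) / (r - t) - V' t x" for x
    proof (rule DERIV_unique)
      show "(F has_field_derivative F' x) (at x)" by (rule F)
      show "(F has_field_derivative (deriv (u r) x - deriv (u t) x) / (r - t) - V' t x) (at x)"
        unfolding \<open>F = ?D\<close> using ux[OF t] ux[OF r] V(2)[OF t]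
        by (intro DERIV_diff DERIV_cdivide) auto
    qed
    ultimately show ?thesis using F(3-5) by auto
  qed
  have pde: "V t x + u t x * deriv (u t) x + (LINT \<xi>|lborel. B * exp (- b * \<bar>x - \<xi>\<bar>) * deriv (u t) \<xi>) = 0"
    if t: "t \<in> I" "0 < t" for t x
  proof -
    let ?W = "\<lambda>x. LINT \<xi>|lborel. B * exp (- b * \<bar>x - \<xi>\<bar>) * deriv (u t) \<xi>"
    let ?R = "\<lambda>x. - (u t x * deriv (u t) x + ?W x)"
    obtain M where M: "\<And>x. \<bar>deriv (u t) x\<bar> \<le> M" using ux[OF t(1)] by blast
    have cd: "continuous_on UNIV (deriv (u t))" using ux[OF t(1)] by blast
    have [measurable]: "deriv (u t) \<in> borel_measurable borel"
      using cd by (rule borel_measurable_continuous_onI)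
    have W: "?W = (\<lambda>x. B * (half_conv b (deriv (u t)) x + half_conv' b (deriv (u t)) x))"
    proof
      fix x show "?W x = B * (half_conv b (deriv (u t)) x + half_conv' b (deriv (u t)) x)"
        using exp_kernel_split[OF b _ M, where x = x] by (simp add: has_bochner_integral_iff mult.assoc)
    qed
    have "continuous_on UNIV (half_conv b (deriv (u t)))" "continuous_on UNIV (half_conv' b (deriv (u t)))"
      using half_conv_has_derivative[OF b cd M] half_conv'_has_derivative[OF b cd M]
      by (auto intro!: DERIV_isCont simp: continuous_on_eq_continuous_at)
    then have "continuous_on UNIV ?W"
      unfolding W by (intro continuous_intros)
    then have cR: "continuous_on UNIV ?R"
      by (intro continuous_intros cont t cd)
    \<comment> \<open>The equation holds almost everywhere for \<open>v\<close>, hence in integrals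
      over intervals for \<open>V\<close>; both sides are continuous, so it holds at every
      x.\<close>
    have "V t = ?R"
    proof (rule continuous_eq_if_box_integrals_eq[OF cV[OF t(1)] cR])
      fix a c :: real assume "a \<le> c"
      have [measurable]: "v t \<in> borel_measurable borel" "?R \<in> borel_measurable borel"
        using square_integrable_measurable[OF sqv[OF t(1)]] borel_measurable_continuous_onI[OF cR] by auto
      have "(LINT x|lborel. indicator {a..c} x * V t x) = (LINT x|lborel. indicator {a..c} x * v t x)"
        by (rule V(1)[OF t(1) \<open>a \<le> c\<close>])
      also have "\<dots> = (LINT x|lborel. indicator {a..c} x * ?R x)"
      proof (rule integral_cong_AE)
        show "AE x in lborel. indicator {a..c} x * v t x = indicator {a..c} x * ?R x"
          using eqn[OF t] by eventually_elim (simp add: add_eq_0_iff2 add.assoc)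
      qed measurable
      finally show "(LINT x|lborel. indicator {a..c} x * V t x) = (LINT x|lborel. indicator {a..c} x * ?R x)" .
    qed
    then show ?thesis by (simp add: fun_eq_iff)
  qed
  show thesis
  proof (rule that, unfold_locales)
    show "0 < B" "0 < b" "0 < \<tau>" by fact+
  next
    fix t x assume "t \<in> {0..\<tau>}"
    then have t: "t \<in> I" using sub by blast
    show "(u t has_field_derivative deriv (u t) x) (at x)" "continuous_on UNIV (deriv (u t))"
      "\<exists>M. \<forall>x. \<bar>u t x\<bar> \<le> M \<and> \<bar>deriv (u t) x\<bar> \<le> M" "square_integrable (u t)"
      using ux[OF t] by auto
    show "(deriv (u t) has_field_derivative uxx t x) (at x)"
      by (rule uxx[OF t])
    show "(V t has_field_derivative V' t x) (at x)" "continuous_on UNIV (V' t)"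
      "\<exists>M. \<forall>x. \<bar>V' t x\<bar> \<le> M" "square_integrable (V t)"
      by (rule V[OF t])+
    show "V t x + u t x * deriv (u t) x + (LINT \<xi>|lborel. B * exp (- b * \<bar>x - \<xi>\<bar>) * deriv (u t) \<xi>) = 0"
      if "0 < t"
      by (rule pde[OF t that])
  next
    fix t r x assume "t \<in> {0..\<tau>}" "r \<in> {0..\<tau>}"
    then have tr: "t \<in> I" "r \<in> I" using sub by blast+
    show "\<bar>(u r x - u t x) / (r - t) - V t x\<bar> \<le> n t r"
      "\<bar>(deriv (u r) x - deriv (u t) x) / (r - t) - V' t x\<bar> \<le> n t r"
      "L2norm (\<lambda>x. (u r x - u t x) / (r - t) - V t x) \<le> n t r"
      using quot[OF tr] by auto
  qed (rule n)
qed

theorem theorem1p1: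
  fixes s B b \<alpha> T x0 :: real and u0 :: "real \<Rightarrow> real"
    and u :: "real \<Rightarrow> real \<Rightarrow> real" and T0 :: ereal
  assumes "3 \<le> s" and "0 < B" and "0 < b"
    and "u0 \<in> sobolev s" and "continuous_on UNIV u0"
    and "0 < T" and "0 \<le> F_bound B b u0 T x0"
    and "1 \<le> \<alpha>"
    and "deriv u0 x0 \<le>
      - \<alpha> * ((F_bound B b u0 T x0 powr (1/4)
               + sqrt (F_bound B b u0 T x0 powr (1/2)
                       + (1 + 1 / \<alpha>) / (1 - 1 / (2 * \<alpha>)) * (4 / T))) / 2)\<^sup>2"
    and "is_maximal_solution B b s u0 T0 u"
  shows "blows_up_in_finite_time T0
    \<and> T0 \<le> ereal (- ((1 + 1 / \<alpha>) / (1 - 1 / (2 * \<alpha>)))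
                * (1 / (deriv u0 x0 + sqrt (- deriv u0 x0) * F_bound B b u0 T x0 powr (1/4))))
    \<and> - ((1 + 1 / \<alpha>) / (1 - 1 / (2 * \<alpha>)))
        * (1 / (deriv u0 x0 + sqrt (- deriv u0 x0) * F_bound B b u0 T x0 powr (1/4))) \<le> T"
proof -
  define F where "F = F_bound B b u0 T x0"
  define c where "c = (1 + 1 / \<alpha>) / (1 - 1 / (2 * \<alpha>))"
  define G where "G = F powr (1/4)"
  define p where "p = sqrt (- deriv u0 x0)"
  define S where "S = sqrt (G\<^sup>2 + 4 * (c / T))"
  \<comment> \<open>This is the expression squared in the hypothesis: the positive root of z^2 - G z
    = c/T.\<close>
  define y where "y = (G + S) / 2"
  have F0: "0 \<le> F" using assms(7) by (simp add: F_def)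
  have G0: "0 \<le> G" by (simp add: G_def)
  have G2: "F powr (1/2) = G\<^sup>2"
    by (simp add: G_def power2_eq_square flip: powr_add)
  have G4: "(G\<^sup>2)\<^sup>2 = F"
    unfolding G2[symmetric] using F0 by (simp add: powr_half_sqrt)
  \<comment> \<open>With a = 1/\<alpha> in (0,1] the numerator exceeds 1, while the denominator is
    positive and below 1.\<close>
  have c1: "1 \<le> c"
  proof -
    define a where "a = 1 / \<alpha>"
    have "0 < a" "a \<le> 1" using assms(8) by (auto simp: a_def)
    moreover have "c = (1 + a) / (1 - a / 2)" by (simp add: c_def a_def)
    ultimately show ?thesis by (simp add: pos_le_divide_eq)
  qed
  have cT: "0 < c / T" using c1 assms(6) by simp
  have y0: "0 < y"
    using G0 cT by (simp add: y_def S_def add_nonneg_pos)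
  have "2 * y - G = S"
    by (simp add: y_def field_simps)
  then have "(2 * y - G)\<^sup>2 = G\<^sup>2 + 4 * (c / T)"
    using cT by (simp add: S_def)
  moreover have "(2 * y - G)\<^sup>2 = 4 * (y\<^sup>2 - G * y) + G\<^sup>2"
    by (simp add: power2_eq_square algebra_simps)
  ultimately have yq: "y\<^sup>2 - G * y = c / T"
    by simp
  have "deriv u0 x0 \<le> - \<alpha> * y\<^sup>2"
    using assms(9)
    unfolding y_def S_def F_def[symmetric] G_def[symmetric] G2 c_def[symmetric] by (simp add: mult.commute)
  moreover have "y\<^sup>2 \<le> \<alpha> * y\<^sup>2"
    using assms(8) by (simp add: mult_le_cancel_right1)
  ultimately have dy: "y\<^sup>2 \<le> - deriv u0 x0" by simp
  then have p2: "p\<^sup>2 = - deriv u0 x0"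
    using order_trans[OF zero_le_power2 dy] by (simp add: p_def)
  have yp: "y \<le> p"
    using dy by (simp add: p_def real_le_rsqrt)
  have Gy: "G \<le> y"
  proof -
    have "G \<le> sqrt (G\<^sup>2 + 4 * (c / T))"
      using cT by (intro real_le_rsqrt) simp
    then show ?thesis by (simp add: y_def S_def)
  qed
  \<comment> \<open>z (z - G) is nondecreasing for z >= G, and G <= y <= p.\<close>
  have pq: "c / T \<le> p\<^sup>2 - p * G"
  proof -
    have "y * (y - G) \<le> p * (p - G)"
      using yp Gy y0 by (intro mult_mono) auto
    with yq show ?thesis by (simp add: power2_eq_square algebra_simps)
  qed
  define \<tau> where "\<tau> = c / (p\<^sup>2 - p * G)"
  have pG: "0 < p\<^sup>2 - p * G" using pq cT by linarith
  have \<tau>0: "0 < \<tau>" using pG c1 by (simp add: \<tau>_def)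
  have \<tau>T: "\<tau> \<le> T"
    using pq pG assms(6) by (simp add: \<tau>_def field_simps)
  have \<tau>_eq: "- c * (1 / (deriv u0 x0 + sqrt (- deriv u0 x0) * G)) = \<tau>"
  proof -
    have eq: "deriv u0 x0 + sqrt (- deriv u0 x0) * G = - (p\<^sup>2 - p * G)"
      by (simp add: p2) (simp add: p_def)
    have "- c * (1 / (- x)) = c / x" for x :: real by simp
    then show ?thesis unfolding eq \<tau>_def .
  qed
  have sol: "is_solution B b s u0 T0 u"
    using assms(10) by (simp add: is_maximal_solution_def)
  have "T0 \<le> ereal \<tau>"
  proof (rule ccontr)
    assume "\<not> T0 \<le> ereal \<tau>"
    then have "ereal \<tau> < T0" by simp
    from solution_classical[OF sol assms(1-3) \<tau>0 this] obtain uxx V V' n where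
      "classical_solution B b \<tau> u (\<lambda>t. deriv (u t)) uxx V V' n" .
    then interpret classical_solution B b \<tau> u "\<lambda>t. deriv (u t)" uxx V V' n .
    have u0: "u 0 = u0" using sol by (simp add: is_solution_def)
    \<comment> \<open>The constant q is G^2, the square root of F; since \<open>F_bound\<close> is
      nondecreasing in time and \<tau> \<le> T, its value at T serves on all of [0,\<tau>].\<close>
    have "\<tau> < 1 / (- deriv (u 0) x0 - G\<^sup>2)"
    proof (rule lifespan_bound)
      show "0 \<le> G\<^sup>2" by simp
      show "F_bound B b (u 0) t x0 \<le> (G\<^sup>2)\<^sup>2" if "0 \<le> t" "t \<le> \<tau>" for t
        unfolding G4 F_def u0 F_bound_def using that \<tau>T assms(2)
        by (intro add_left_mono mult_left_mono) auto
      have "0 < p * (p - G)" using pG by (simp add: power2_eq_square algebra_simps)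
      then have "G < p" using yp y0 by (simp add: zero_less_mult_iff)
      then have "G\<^sup>2 < p\<^sup>2" using G0 by (simp add: power_strict_mono)
      then show "deriv (u 0) x0 < - G\<^sup>2" by (simp add: u0 p2)
    qed
    also have "\<dots> = 1 / (p\<^sup>2 - G\<^sup>2)" by (simp add: u0 p2)
    also have "\<dots> \<le> 1 / (p\<^sup>2 - p * G)"
    proof (intro divide_left_mono)
      have "G * G \<le> p * G" using Gy yp G0 by (intro mult_right_mono) auto
      then show le: "p\<^sup>2 - p * G \<le> p\<^sup>2 - G\<^sup>2" by (simp add: power2_eq_square)
      show "0 < (p\<^sup>2 - G\<^sup>2) * (p\<^sup>2 - p * G)"
        using le pG by (intro mult_pos_pos) auto
    qed simp
    also have "\<dots> \<le> \<tau>"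
      unfolding \<tau>_def using c1 pG by (intro divide_right_mono) auto
    finally show False by simp
  qed
  moreover from this have "blows_up_in_finite_time T0"
    unfolding blows_up_in_finite_time_def by (rule le_less_trans) simp
  ultimately show ?thesis
    unfolding F_def[symmetric] G_def[symmetric] c_def[symmetric] \<tau>_eq using \<tau>T by blast
qed

end
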